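(* Let $\Omega\subset X$ be a nonempty open set with $X\setminus\Omega\ne\emptyset$ satisfying the measure density condition: there is $c_m>0$ such that $\mu(B(x,r)\cap\Omega)\ge c_m\,\mu(B(x,r))$ for every $x\in\overline\Omega$ and every $r\in(0,\mathrm{diam}(\Omega))$. Then there exist $0<c_H<1$ and a constant $C$ (independent of $u$) such that for any $u\in N^{1,1}(\Omega)$ there is $v\in M^{1,1}_{c_H}(\Omega)\cap \mathrm{Lip}_{\mathrm{loc}}(\Omega)$ satisfying $\|v\|_{M^{1,1}_{c_H}(\Omega)}\le C\|u\|_{N^{1,1}(\Omega)}$ and \[ \lim_{r\to0^+}\frac{1}{\mu(B(x,r)\cap\Omega)}\int_{B(x,r)\cap\Omega}|v-u|\,d\mu=0 \] for $\mathcal H$-a.e. $x\in\partial\Omega$, where $\mathcal H$ is the codimension $1$ Hausdorff measure. If additionally $\Omega$ is a uniform domain, then $v$ can be chosen in $M^{1,1}(\Omega)\cap \mathrm{Lip}_{\mathrm{loc}}(\Omega)$.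
   Context: Standing assumptions: $(X,d,\mu)$ is a complete metric space with a Borel regular outer measure $\mu$ that is doubling: there is $C_d\ge 1$ with $0<\mu(B(x,2r))\le C_d\,\mu(B(x,r))<\infty$ for all balls $B(x,r)=\{y\in X: d(x,y)<r\}$. $X$ supports a $(1,1)$-Poincaré inequality: there are $C_P>0$, $\lambda\ge 1$ such that for every ball $B(x,r)$, every $u\in L^1_{\mathrm{loc}}(X)$ and every upper gradient $g$ of $u$, $\frac{1}{\mu(B(x,r))}\int_{B(x,r)}|u-u_{B(x,r)}|\,d\mu\le C_P r\,\frac{1}{\mu(B(x,\lambda r))}\int_{B(x,\lambda r)}g\,d\mu$, where $u_B$ is the $\mu$-mean of $u$ over $B$. A curve is a rectifiable continuous map from a compact interval. A nonnegative Borel function $g$ is an upper gradient of $u$ if $|u(x)-u(y)|\le\int_\gamma g\,ds$ for all nonconstant curves $\gamma$ with end points $x,y$ (with $|u(x)-u(y)|:=\infty$ if $|u(x)|$ or $|u(y)|$ is infinite). A curve family $\Gamma$ has zero $1$-modulus if there is a nonnegative Borel $\rho\in L^1(X)$ with $\int_\gamma\rho\,ds=\infty$ for all $\gamma\in\Gamma$. A nonnegative $\mu$-measurable $g$ is a $1$-weak upper gradient of $u$ in $H\subset X$ if the upper gradient inequality holds for all curves in $H$ outside a family of zero $1$-modulus. $\|u\|_{N^{1,1}(H)}:=\|u\|_{L^1(H)}+\inf\|g\|_{L^1(H)}$ (infimum over $1$-weak upper gradients of $u$ in $H$), $N^{1,1}(H)=\{u:\|u\|_{N^{1,1}(H)}<\infty\}$.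 $\mathrm{Lip}_{\mathrm{loc}}(\Omega)$ is the set of functions that are Lipschitz on every open $\Omega'$ whose closure is a compact subset of $\Omega$. Hajłasz-Sobolev spaces: $M^{1,1}(\Omega)$ is the set of $u\in L^1(\Omega)$ for which there exist $0\le g\in L^1(\Omega)$ and a set $A\subset\Omega$ of $\mu$-measure zero such that $|u(x)-u(y)|\le d(x,y)(g(x)+g(y))$ for all $x,y\in\Omega\setminus A$; the norm is $\|u\|_{L^1(\Omega)}+\inf\|g\|_{L^1(\Omega)}$ over all such $g$. For $0<c_H<1$, $M^{1,1}_{c_H}(\Omega)$ and its norm are defined in the same way, except that the inequality is only required for those $x,y\in\Omega\setminus A$ with $d(x,y)\le c_H\min\{\mathrm{dist}(x,X\setminus\Omega),\mathrm{dist}(y,X\setminus\Omega)\}$. Codimension $1$ Hausdorff measure: $\mathcal H(A)=\lim_{R\to0^+}\mathcal H_R(A)$, where $\mathcal H_R(A)=\inf\{\sum_{j\in I}\mu(B(x_j,r_j))/r_j:\ A\subset\bigcup_{j\in I}B(x_j,r_j),\ r_j\le R,\ I\subset\mathbb N\}$. A domain $\Omega\subset X$ is uniform if there is $c_U\in(0,1]$ such that every pair of distinct points $x,y\in\Omega$ can be joined by a curve $\gamma:[0,\ell_\gamma]\to\Omega$ parametrized by arc-length with $\gamma(0)=x$, $\gamma(\ell_\gamma)=y$, $\ell_\gamma\le c_U^{-1}d(x,y)$ and $\mathrm{dist}(\gamma(t),X\setminus\Omega)\ge c_U\min\{t,\ell_\gamma-t\}$ for all $t\in[0,\ell_\gamma]$.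 *)

theory Defs
  imports "HOL-Analysis.Analysis"
begin

section \<open>Borel regular outer measures\<close>

definition borel_regular_outer_measure :: "('a::topological_space set \<Rightarrow> ennreal) \<Rightarrow> bool" where
  "borel_regular_outer_measure \<mu> \<longleftrightarrow>
     outer_measure_space (Pow UNIV) \<mu> \<and>
     sets borel \<subseteq> lambda_system UNIV (Pow UNIV) \<mu> \<and>
     (\<forall>A. \<exists>B \<in> sets borel. A \<subseteq> B \<and> \<mu> B = \<mu> A)"

text \<open>The measure space on the Caratheodory measurable sets of an outer measure; all
  measurability and integration with respect to \<open>\<mu>\<close> refers to it.\<close>

definition carath :: "('a set \<Rightarrow> ennreal) \<Rightarrow> 'a measure" where
  "carath \<mu> = measure_of UNIV (lambda_system UNIV (Pow UNIV) \<mu>) \<mu>"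

lemma
  assumes "borel_regular_outer_measure \<mu>"
  shows space_carath: "space (carath \<mu>) = UNIV"
    and sets_carath: "sets (carath \<mu>) = lambda_system UNIV (Pow UNIV) \<mu>"
    and emeasure_carath: "A \<in> sets (carath \<mu>) \<Longrightarrow> emeasure (carath \<mu>) A = \<mu> A"
    and borel_carath: "sets borel \<subseteq> sets (carath \<mu>)"
proof -
  interpret sigma_algebra UNIV "Pow UNIV :: 'a set set"
    by (rule sigma_algebra_Pow)
  have ms: "measure_space UNIV (lambda_system UNIV (Pow UNIV) \<mu>) \<mu>"
    using assms caratheodory_lemma unfolding borel_regular_outer_measure_def by blast
  then have sa: "sigma_algebra UNIV (lambda_system UNIV (Pow UNIV) \<mu>)"
    by (simp add: measure_space_def)
  show "space (carath \<mu>) = UNIV"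
    by (simp add: carath_def space_measure_of_conv)
  show s: "sets (carath \<mu>) = lambda_system UNIV (Pow UNIV) \<mu>"
    unfolding carath_def using sa by (rule sigma_algebra.sets_measure_of_eq)
  show "emeasure (carath \<mu>) A = \<mu> A" if "A \<in> sets (carath \<mu>)"
    unfolding carath_def
    using ms sa that s by (intro emeasure_measure_of_sigma) (auto simp: measure_space_def)
  show "sets borel \<subseteq> sets (carath \<mu>)"
    using assms s by (simp add: borel_regular_outer_measure_def)
qed

definition doubling :: "('a::metric_space set \<Rightarrow> ennreal) \<Rightarrow> bool" where
  "doubling \<mu> \<longleftrightarrow> (\<exists>Cd::real. 1 \<le> Cd \<and>
     (\<forall>x r. 0 < r \<longrightarrow> 0 < \<mu> (ball x (2 * r)) \<and>
        \<mu> (ball x (2 * r)) \<le> ennreal Cd * \<mu> (ball x r) \<and>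
        ennreal Cd * \<mu> (ball x r) < \<infinity>))"

section \<open>Curves and line integrals\<close>

text \<open>A curve is a triple \<open>(\<gamma>, a, b)\<close>; only the values of \<open>\<gamma>\<close> on \<open>{a..b}\<close> matter.\<close>

definition curve_length :: "(real \<Rightarrow> 'a::metric_space) \<Rightarrow> real \<Rightarrow> real \<Rightarrow> ennreal" where
  "curve_length \<gamma> a b =
     (SUP ts \<in> {ts. sorted ts \<and> set ts \<subseteq> {a..b}}.
        \<Sum>i<length ts - 1. ennreal (dist (\<gamma> (ts ! i)) (\<gamma> (ts ! Suc i))))"

definition is_curve :: "(real \<Rightarrow> 'a::metric_space) \<Rightarrow> real \<Rightarrow> real \<Rightarrow> bool" where
  "is_curve \<gamma> a b \<longleftrightarrow> a \<le> b \<and> continuous_on {a..b} \<gamma> \<and> curve_length \<gamma> a b < \<infinity>"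

definition nonconst_curve :: "(real \<Rightarrow> 'a::metric_space) \<Rightarrow> real \<Rightarrow> real \<Rightarrow> bool" where
  "nonconst_curve \<gamma> a b \<longleftrightarrow> is_curve \<gamma> a b \<and> \<not> \<gamma> constant_on {a..b}"

text \<open>The value does not depend on the parameter chosen by \<open>SOME\<close>: on an interval on which the
  length function is constant, so is \<open>\<gamma>\<close>.\<close>

definition arclength_param :: "(real \<Rightarrow> 'a::metric_space) \<Rightarrow> real \<Rightarrow> real \<Rightarrow> real \<Rightarrow> 'a" where
  "arclength_param \<gamma> a b s = \<gamma> (SOME t. t \<in> {a..b} \<and> curve_length \<gamma> a t = ennreal s)"

definition curve_integral ::
  "(real \<Rightarrow> 'a::metric_space) \<Rightarrow> real \<Rightarrow> real \<Rightarrow> ('a \<Rightarrow> ennreal) \<Rightarrow> ennreal" where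
  "curve_integral \<gamma> a b g =
     (\<integral>\<^sup>+ s \<in> {0..enn2real (curve_length \<gamma> a b)}. g (arclength_param \<gamma> a b s) \<partial>lebesgue)"

section \<open>Upper gradients and the Poincare inequality\<close>

text \<open>The quantity \<open>|x - y|\<close>, with value \<open>\<infinity>\<close> as soon as one of the arguments is infinite.\<close>

definition eabs_diff :: "ereal \<Rightarrow> ereal \<Rightarrow> ennreal" where
  "eabs_diff x y =
     (if \<bar>x\<bar> = \<infinity> \<or> \<bar>y\<bar> = \<infinity> then \<infinity> else ennreal \<bar>real_of_ereal x - real_of_ereal y\<bar>)"

definition ug_ineq ::
  "('a::metric_space \<Rightarrow> ereal) \<Rightarrow> ('a \<Rightarrow> ennreal) \<Rightarrow> (real \<Rightarrow> 'a) \<Rightarrow> real \<Rightarrow> real \<Rightarrow> bool" where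
  "ug_ineq u g \<gamma> a b \<longleftrightarrow> eabs_diff (u (\<gamma> a)) (u (\<gamma> b)) \<le> curve_integral \<gamma> a b g"

definition upper_gradient :: "('a::metric_space \<Rightarrow> ereal) \<Rightarrow> ('a \<Rightarrow> ennreal) \<Rightarrow> bool" where
  "upper_gradient u g \<longleftrightarrow> g \<in> borel_measurable borel \<and>
     (\<forall>\<gamma> a b. nonconst_curve \<gamma> a b \<longrightarrow> ug_ineq u g \<gamma> a b)"

definition zero_modulus ::
  "('a::metric_space set \<Rightarrow> ennreal) \<Rightarrow> ((real \<Rightarrow> 'a) \<times> real \<times> real) set \<Rightarrow> bool" where
  "zero_modulus \<mu> \<Gamma> \<longleftrightarrow>
     (\<exists>\<rho> :: 'a \<Rightarrow> ennreal. \<rho> \<in> borel_measurable borel \<and> (\<integral>\<^sup>+ x. \<rho> x \<partial>carath \<mu>) < \<infinity> \<and>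
        (\<forall>(\<gamma>, a, b) \<in> \<Gamma>. curve_integral \<gamma> a b \<rho> = \<infinity>))"

text \<open>Along a curve on which \<open>g\<close> is not Lebesgue measurable, the line integral below is a lower
  integral.  Such curves form a family of zero modulus, so they do not affect the notion.\<close>

definition weak_upper_gradient ::
  "('a::metric_space set \<Rightarrow> ennreal) \<Rightarrow> 'a set \<Rightarrow> ('a \<Rightarrow> ereal) \<Rightarrow> ('a \<Rightarrow> ennreal) \<Rightarrow> bool" where
  "weak_upper_gradient \<mu> H u g \<longleftrightarrow> g \<in> borel_measurable (restrict_space (carath \<mu>) H) \<and>
     (\<exists>\<Gamma>. zero_modulus \<mu> \<Gamma> \<and>
        (\<forall>\<gamma> a b. nonconst_curve \<gamma> a b \<and> \<gamma> ` {a..b} \<subseteq> H \<and> (\<gamma>, a, b) \<notin> \<Gamma> \<longrightarrow> ug_ineq u g \<gamma> a b))"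

definition L1_norm :: "('a set \<Rightarrow> ennreal) \<Rightarrow> 'a set \<Rightarrow> ('a \<Rightarrow> ereal) \<Rightarrow> ennreal" where
  "L1_norm \<mu> H u = (\<integral>\<^sup>+ x. e2ennreal \<bar>u x\<bar> \<partial>restrict_space (carath \<mu>) H)"

definition in_L1 :: "('a set \<Rightarrow> ennreal) \<Rightarrow> 'a set \<Rightarrow> ('a \<Rightarrow> ereal) \<Rightarrow> bool" where
  "in_L1 \<mu> H u \<longleftrightarrow>
     u \<in> borel_measurable (restrict_space (carath \<mu>) H) \<and> L1_norm \<mu> H u < \<infinity>"

definition compactly_inside :: "'a::topological_space set \<Rightarrow> 'a set \<Rightarrow> bool" where
  "compactly_inside \<Omega>' \<Omega> \<longleftrightarrow> open \<Omega>' \<and> compact (closure \<Omega>') \<and> closure \<Omega>' \<subseteq> \<Omega>"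

definition in_L1_loc :: "('a::metric_space set \<Rightarrow> ennreal) \<Rightarrow> 'a set \<Rightarrow> ('a \<Rightarrow> ereal) \<Rightarrow> bool" where
  "in_L1_loc \<mu> \<Omega> u \<longleftrightarrow> (\<forall>\<Omega>'. compactly_inside \<Omega>' \<Omega> \<longrightarrow> in_L1 \<mu> \<Omega>' u)"

text \<open>For \<open>u \<in> L\<^sup>1(B)\<close> the function \<open>u\<close> is finite a.e. in \<open>B\<close>, so passing to
  \<open>real_of_ereal\<close> does not change the integral.\<close>

definition mean :: "('a set \<Rightarrow> ennreal) \<Rightarrow> 'a set \<Rightarrow> ('a \<Rightarrow> ereal) \<Rightarrow> real" where
  "mean \<mu> B u = (\<integral>x. real_of_ereal (u x) \<partial>restrict_space (carath \<mu>) B) / enn2real (\<mu> B)"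

definition poincare_1_1 :: "('a::metric_space set \<Rightarrow> ennreal) \<Rightarrow> bool" where
  "poincare_1_1 \<mu> \<longleftrightarrow> (\<exists>CP \<Lambda> :: real. 0 < CP \<and> 1 \<le> \<Lambda> \<and>
     (\<forall>x r u g. 0 < r \<and> in_L1_loc \<mu> UNIV u \<and> upper_gradient u g \<longrightarrow>
        (\<integral>\<^sup>+ y. eabs_diff (u y) (ereal (mean \<mu> (ball x r) u))
            \<partial>restrict_space (carath \<mu>) (ball x r)) / \<mu> (ball x r)
        \<le> ennreal (CP * r) *
          ((\<integral>\<^sup>+ y. g y \<partial>restrict_space (carath \<mu>) (ball x (\<Lambda> * r))) / \<mu> (ball x (\<Lambda> * r)))))"

section \<open>Function spaces\<close>

definition N11_norm :: "('a::metric_space set \<Rightarrow> ennreal) \<Rightarrow> 'a set \<Rightarrow> ('a \<Rightarrow> ereal) \<Rightarrow> ennreal" where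
  "N11_norm \<mu> H u = L1_norm \<mu> H u +
     (INF g \<in> {g. weak_upper_gradient \<mu> H u g}. \<integral>\<^sup>+ x. g x \<partial>restrict_space (carath \<mu>) H)"

definition in_N11 :: "('a::metric_space set \<Rightarrow> ennreal) \<Rightarrow> 'a set \<Rightarrow> ('a \<Rightarrow> ereal) \<Rightarrow> bool" where
  "in_N11 \<mu> H u \<longleftrightarrow>
     u \<in> borel_measurable (restrict_space (carath \<mu>) H) \<and> N11_norm \<mu> H u < \<infinity>"

definition Lip_loc :: "'a::metric_space set \<Rightarrow> ('a \<Rightarrow> real) \<Rightarrow> bool" where
  "Lip_loc \<Omega> v \<longleftrightarrow> (\<forall>\<Omega>'. compactly_inside \<Omega>' \<Omega> \<longrightarrow> (\<exists>L. L-lipschitz_on \<Omega>' v))"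

text \<open>The relation \<open>R\<close> selects the pairs of points for which the Hajlasz inequality is required.\<close>

definition hajlasz_gradients ::
  "('a::metric_space set \<Rightarrow> ennreal) \<Rightarrow> 'a set \<Rightarrow> ('a \<Rightarrow> 'a \<Rightarrow> bool) \<Rightarrow> ('a \<Rightarrow> real) \<Rightarrow> ('a \<Rightarrow> ennreal) set"
  where
  "hajlasz_gradients \<mu> \<Omega> R u = {g. g \<in> borel_measurable (restrict_space (carath \<mu>) \<Omega>) \<and>
     (\<integral>\<^sup>+ x. g x \<partial>restrict_space (carath \<mu>) \<Omega>) < \<infinity> \<and>
     (\<exists>A \<subseteq> \<Omega>. \<mu> A = 0 \<and> (\<forall>x \<in> \<Omega> - A. \<forall>y \<in> \<Omega> - A. R x y \<longrightarrow>
        ennreal \<bar>u x - u y\<bar> \<le> ennreal (dist x y) * (g x + g y)))}"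

definition hajlasz_norm ::
  "('a::metric_space set \<Rightarrow> ennreal) \<Rightarrow> 'a set \<Rightarrow> ('a \<Rightarrow> 'a \<Rightarrow> bool) \<Rightarrow> ('a \<Rightarrow> real) \<Rightarrow> ennreal" where
  "hajlasz_norm \<mu> \<Omega> R u = L1_norm \<mu> \<Omega> (\<lambda>x. ereal (u x)) +
     (INF g \<in> hajlasz_gradients \<mu> \<Omega> R u. \<integral>\<^sup>+ x. g x \<partial>restrict_space (carath \<mu>) \<Omega>)"

definition in_hajlasz ::
  "('a::metric_space set \<Rightarrow> ennreal) \<Rightarrow> 'a set \<Rightarrow> ('a \<Rightarrow> 'a \<Rightarrow> bool) \<Rightarrow> ('a \<Rightarrow> real) \<Rightarrow> bool" where
  "in_hajlasz \<mu> \<Omega> R u \<longleftrightarrow>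
     in_L1 \<mu> \<Omega> (\<lambda>x. ereal (u x)) \<and> hajlasz_gradients \<mu> \<Omega> R u \<noteq> {}"

definition all_pairs :: "'a \<Rightarrow> 'a \<Rightarrow> bool" where
  "all_pairs x y \<longleftrightarrow> True"

text \<open>\<open>infdist\<close> to the empty set is \<open>0\<close> in the library; here and in \<open>uniform_domain\<close> the
  complement of \<open>\<Omega>\<close> is meant to be nonempty.\<close>

definition inner_pairs :: "real \<Rightarrow> 'a::metric_space set \<Rightarrow> 'a \<Rightarrow> 'a \<Rightarrow> bool" where
  "inner_pairs c \<Omega> x y \<longleftrightarrow> dist x y \<le> c * min (infdist x (- \<Omega>)) (infdist y (- \<Omega>))"

abbreviation "M11_norm \<mu> \<Omega> \<equiv> hajlasz_norm \<mu> \<Omega> all_pairs"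
abbreviation "in_M11 \<mu> \<Omega> \<equiv> in_hajlasz \<mu> \<Omega> all_pairs"
abbreviation "M11c_norm c \<mu> \<Omega> \<equiv> hajlasz_norm \<mu> \<Omega> (inner_pairs c \<Omega>)"
abbreviation "in_M11c c \<mu> \<Omega> \<equiv> in_hajlasz \<mu> \<Omega> (inner_pairs c \<Omega>)"

section \<open>Codimension 1 Hausdorff measure\<close>

definition codim1_content ::
  "('a::metric_space set \<Rightarrow> ennreal) \<Rightarrow> real \<Rightarrow> 'a set \<Rightarrow> ennreal" where
  "codim1_content \<mu> R A =
     (INF (I, x, r) \<in> {(I :: nat set, x :: nat \<Rightarrow> 'a, r :: nat \<Rightarrow> real).
          A \<subseteq> (\<Union>j\<in>I. ball (x j) (r j)) \<and> (\<forall>j\<in>I. 0 < r j \<and> r j \<le> R)}.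
        \<Sum>\<^sub>\<infinity>j\<in>I. \<mu> (ball (x j) (r j)) / ennreal (r j))"

definition codim1_hausdorff :: "('a::metric_space set \<Rightarrow> ennreal) \<Rightarrow> 'a set \<Rightarrow> ennreal" where
  "codim1_hausdorff \<mu> A = Lim (at_right 0) (\<lambda>R. codim1_content \<mu> R A)"

lemma codim1_content_antimono:
  assumes "R \<le> S"
  shows "codim1_content \<mu> S A \<le> codim1_content \<mu> R A"
  unfolding codim1_content_def using assms
  by (intro INF_superset_mono) (auto intro: order_trans)

lemma codim1_content_tendsto:
  "((\<lambda>R. codim1_content \<mu> R A) \<longlongrightarrow> codim1_hausdorff \<mu> A) (at_right 0)"
  and codim1_hausdorff_eq_SUP:
  "codim1_hausdorff \<mu> A = (SUP R\<in>{0<..}. codim1_content \<mu> R A)"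
proof -
  let ?f = "\<lambda>R. codim1_content \<mu> R A"
  have *: "(?f \<longlongrightarrow> (SUP R\<in>{0<..}. ?f R)) (at_right 0)"
  proof (rule order_tendstoI)
    fix a assume "a < (SUP R\<in>{0<..}. ?f R)"
    then obtain R where R: "0 < R" "a < ?f R"
      by (auto simp: less_SUP_iff)
    then show "eventually (\<lambda>x. a < ?f x) (at_right 0)"
      by (intro eventually_at_rightI[of 0 R])
         (auto intro: less_le_trans[OF _ codim1_content_antimono])
  next
    fix a assume a: "(SUP R\<in>{0<..}. ?f R) < a"
    show "eventually (\<lambda>x. ?f x < a) (at_right 0)"
      by (intro eventually_at_rightI[of 0 1]) (auto intro: le_less_trans[OF SUP_upper a])
  qed
  then show "codim1_hausdorff \<mu> A = (SUP R\<in>{0<..}. ?f R)"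
    unfolding codim1_hausdorff_def by (intro tendsto_Lim) auto
  with * show "(?f \<longlongrightarrow> codim1_hausdorff \<mu> A) (at_right 0)" by simp
qed

section \<open>Conditions on the open set\<close>

text \<open>Unlike the library's \<open>diameter\<close>, this takes the value \<open>\<infinity>\<close> on unbounded sets.\<close>

definition ediam :: "'a::metric_space set \<Rightarrow> ennreal" where
  "ediam \<Omega> = (SUP (x, y) \<in> \<Omega> \<times> \<Omega>. ennreal (dist x y))"

definition measure_density :: "('a::metric_space set \<Rightarrow> ennreal) \<Rightarrow> 'a set \<Rightarrow> bool" where
  "measure_density \<mu> \<Omega> \<longleftrightarrow> (\<exists>cm::real. 0 < cm \<and>
     (\<forall>x \<in> closure \<Omega>. \<forall>r. 0 < r \<and> ennreal r < ediam \<Omega> \<longrightarrow>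
        ennreal cm * \<mu> (ball x r) \<le> \<mu> (ball x r \<inter> \<Omega>)))"

definition uniform_domain :: "'a::metric_space set \<Rightarrow> bool" where
  "uniform_domain \<Omega> \<longleftrightarrow> open \<Omega> \<and> connected \<Omega> \<and> \<Omega> \<noteq> {} \<and>
     (\<exists>cU::real. 0 < cU \<and> cU \<le> 1 \<and>
        (\<forall>x \<in> \<Omega>. \<forall>y \<in> \<Omega>. x \<noteq> y \<longrightarrow>
           (\<exists>\<gamma> l. is_curve \<gamma> 0 l \<and> \<gamma> ` {0..l} \<subseteq> \<Omega> \<and>
              (\<forall>t \<in> {0..l}. curve_length \<gamma> 0 t = ennreal t) \<and>
              \<gamma> 0 = x \<and> \<gamma> l = y \<and> l \<le> dist x y / cU \<and>
              (\<forall>t \<in> {0..l}. cU * min t (l - t) \<le> infdist (\<gamma> t) (- \<Omega>)))))"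

definition same_trace_at ::
  "('a::metric_space set \<Rightarrow> ennreal) \<Rightarrow> 'a set \<Rightarrow> ('a \<Rightarrow> real) \<Rightarrow> ('a \<Rightarrow> ereal) \<Rightarrow> 'a \<Rightarrow> bool" where
  "same_trace_at \<mu> \<Omega> v u x \<longleftrightarrow>
     ((\<lambda>r. (\<integral>\<^sup>+ y. eabs_diff (ereal (v y)) (u y) \<partial>restrict_space (carath \<mu>) (ball x r \<inter> \<Omega>))
            / \<mu> (ball x r \<inter> \<Omega>)) \<longlongrightarrow> 0) (at_right 0)"

end

theory Submission
  imports Defs
begin

text \<open>Let \<open>D(x)\<close> be the distance from \<open>x\<close> to the complement of \<open>\<Omega>\<close> and let \<open>v(x)\<close> be
  the average of \<open>u\<close> with the weight \<open>max 0 (\<delta> D(x) - d(x, y))\<close> in \<open>y\<close>.  As \<open>u\<close> satisfies a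
  Poincare inequality on balls well inside \<open>\<Omega>\<close>, the local Lipschitz constant of \<open>v\<close> at \<open>x\<close> is
  at most a multiple of the mean of the upper gradient \<open>g\<close> over the ball \<open>B(x, D(x)/4)\<close>.  For
  every \<open>z\<close> with \<open>d(z, x) \<le> A D(x)\<close> this mean is at most a multiple of
  \<open>G(z) = \<integral> g(y) [d(z, y) \<le> (2 A + 1) D(y)] / \<mu>(B(y, D(y))) dy\<close>, and by Tonelli and doubling the
  integral of \<open>G\<close> is at most a multiple of that of \<open>g\<close>.  Taking \<open>z = x\<close> gives the Hajlasz
  inequality for nearby points.  On a curve given by the uniformity of \<open>\<Omega>\<close> the condition on \<open>z\<close>
  holds for the nearer end point \<open>z\<close>, so integrating along the curve gives it for all pairs.

  At a boundary point \<open>x\<close> the integral of \<open>|v - u|\<close> over \<open>B(x, r) \<inter> \<Omega>\<close> is at most a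
  multiple of \<open>r\<close> times that of \<open>g\<close> over \<open>B(x, 3 r) \<inter> \<Omega>\<close>.  Multiplying \<open>g\<close> by an integrable
  weight that blows up at the boundary, a Vitali covering shows that the set of boundary points
  where this is not \<open>o(\<mu>(B(x, r)))\<close> is a null set of the codimension 1 Hausdorff measure.\<close>

section \<open>Rectifiable curves\<close>

fun polygonal_length :: "'a::metric_space list \<Rightarrow> ennreal" where
  "polygonal_length (x # y # zs) = ennreal (dist x y) + polygonal_length (y # zs)"
| "polygonal_length _ = 0"

lemma polygonal_length_eq_sum:
  "(\<Sum>i<length ts - 1. ennreal (dist (f (ts ! i)) (f (ts ! Suc i)))) = polygonal_length (map f ts)"
proof (induction "map f ts" arbitrary: ts rule: polygonal_length.induct)
  case (1 x y zs)
  then obtain a b ts' where ts: "ts = a # b # ts'" "x = f a" "y = f b" "zs = map f ts'"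
    by (auto simp: Cons_eq_map_conv)
  show ?case
    using 1(1)[of "b # ts'"] ts(2-) by (simp add: ts(1) sum.lessThan_Suc_shift del: sum.lessThan_Suc)
qed auto

lemma curve_length_eq_SUP:
  "curve_length \<gamma> a b =
     (SUP ts\<in>{ts. sorted ts \<and> set ts \<subseteq> {a..b}}. polygonal_length (map \<gamma> ts))"
  unfolding curve_length_def polygonal_length_eq_sum ..

lemma polygonal_length_le_curve_length:
  "sorted ts \<Longrightarrow> set ts \<subseteq> {a..b} \<Longrightarrow> polygonal_length (map \<gamma> ts) \<le> curve_length \<gamma> a b"
  unfolding curve_length_eq_SUP by (intro SUP_upper) auto

lemma curve_length_mono: "a \<le> a' \<Longrightarrow> b' \<le> b \<Longrightarrow> curve_length \<gamma> a' b' \<le> curve_length \<gamma> a b"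
  unfolding curve_length_eq_SUP by (intro SUP_subset_mono) auto

lemma dist_le_curve_length:
  assumes "a \<le> s" "s \<le> t" "t \<le> b"
  shows "ennreal (dist (\<gamma> s) (\<gamma> t)) \<le> curve_length \<gamma> a b"
  using polygonal_length_le_curve_length[of "[s, t]" a b \<gamma>] assms by auto

lemma polygonal_length_append_ge:
  "polygonal_length xs + polygonal_length ys \<le> polygonal_length (xs @ ys)"
proof (induction xs rule: polygonal_length.induct)
  case ("2_2" v)
  then show ?case by (cases ys) auto
qed (auto simp: add.assoc intro: add_left_mono)

lemma polygonal_length_append_le:
  "polygonal_length (xs @ ys) \<le> polygonal_length (xs @ [p]) + polygonal_length (p # ys)"
proof (induction xs rule: polygonal_length.induct)
  case ("2_2" v)
  have "ennreal (dist v y) \<le> ennreal (dist v p) + ennreal (dist p y)" for y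
    by (simp add: dist_triangle flip: ennreal_plus)
  then show ?case by (cases ys) (auto simp: add_right_mono simp flip: add.assoc)
next
  case "2_1"
  show ?case by (cases ys) auto
qed (auto simp: add.assoc intro: add_left_mono)

lemma curve_length_add:
  assumes "a \<le> t" "t \<le> b"
  shows "curve_length \<gamma> a b = curve_length \<gamma> a t + curve_length \<gamma> t b"
proof (rule antisym)
  show "curve_length \<gamma> a b \<le> curve_length \<gamma> a t + curve_length \<gamma> t b"
    unfolding curve_length_eq_SUP[of \<gamma> a b]
  proof (rule SUP_least)
    fix ts assume "ts \<in> {ts. sorted ts \<and> set ts \<subseteq> {a..b}}"
    then have ts: "sorted ts" "set ts \<subseteq> {a..b}" by auto
    let ?us = "takeWhile (\<lambda>s. s \<le> t) ts" and ?vs = "dropWhile (\<lambda>s. s \<le> t) ts"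
    have vs: "t \<le> s" if "s \<in> set ?vs" for s
    proof -
      have "sorted ?vs"
        using ts(1) by (metis sorted_append takeWhile_dropWhile_id)
      then have "hd ?vs \<le> s"
        using that by (metis hd_Cons_tl list.set_cases list.sel(1) order_refl set_ConsD sorted_simps(2))
      moreover have "\<not> hd ?vs \<le> t"
        using that by (metis empty_iff empty_set hd_dropWhile)
      ultimately show ?thesis by linarith
    qed
    have "polygonal_length (map \<gamma> ts) = polygonal_length (map \<gamma> ?us @ map \<gamma> ?vs)"
      by (metis map_append takeWhile_dropWhile_id)
    also have "\<dots> \<le> polygonal_length (map \<gamma> (?us @ [t])) + polygonal_length (map \<gamma> (t # ?vs))"
      using polygonal_length_append_le by simp
    also have "polygonal_length (map \<gamma> (?us @ [t])) \<le> curve_length \<gamma> a t"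
    proof (rule polygonal_length_le_curve_length)
      have "sorted ?us"
        using ts(1) by (metis sorted_append takeWhile_dropWhile_id)
      then show "sorted (?us @ [t])"
        by (auto simp: sorted_append dest: set_takeWhileD)
      show "set (?us @ [t]) \<subseteq> {a..t}"
        using ts(2) assms by (fastforce dest: set_takeWhileD)
    qed
    also have "polygonal_length (map \<gamma> (t # ?vs)) \<le> curve_length \<gamma> t b"
    proof (rule polygonal_length_le_curve_length)
      have "sorted ?vs"
        using ts(1) by (metis sorted_append takeWhile_dropWhile_id)
      then show "sorted (t # ?vs)"
        using vs by auto
      show "set (t # ?vs) \<subseteq> {t..b}"
        using ts(2) assms vs by (fastforce dest: set_dropWhileD)
    qed
    finally show "polygonal_length (map \<gamma> ts) \<le> curve_length \<gamma> a t + curve_length \<gamma> t b"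
      by (simp add: add_mono)
  qed
next
  have ne: "{ts. sorted ts \<and> set ts \<subseteq> {c..d}} \<noteq> {}" for c d :: real
    by (auto intro!: exI[of _ "[]"])
  have *: "polygonal_length (map \<gamma> us) + polygonal_length (map \<gamma> vs) \<le> curve_length \<gamma> a b"
    if "sorted us \<and> set us \<subseteq> {a..t}" "sorted vs \<and> set vs \<subseteq> {t..b}" for us vs
  proof -
    have "polygonal_length (map \<gamma> us) + polygonal_length (map \<gamma> vs) \<le> polygonal_length (map \<gamma> (us @ vs))"
      using polygonal_length_append_ge by simp
    also have "\<dots> \<le> curve_length \<gamma> a b"
      using that assms by (intro polygonal_length_le_curve_length) (fastforce simp: sorted_append)+
    finally show ?thesis .
  qed
  show "curve_length \<gamma> a t + curve_length \<gamma> t b \<le> curve_length \<gamma> a b"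
    unfolding curve_length_eq_SUP[of \<gamma> a t] curve_length_eq_SUP[of \<gamma> t b]
      ennreal_SUP_add_left[OF ne, symmetric] 
    by (intro SUP_least, subst ennreal_SUP_add_right[OF ne]) (auto intro!: SUP_least *)
qed

lemma curve_length_left_small:
  assumes c: "continuous_on {a..b} \<gamma>" and fin: "curve_length \<gamma> a b < \<infinity>" and t: "a < t" "t \<le> b"
    and e: "0 < e"
  shows "\<exists>m<t. a \<le> m \<and> curve_length \<gamma> m t \<le> ennreal e"
proof -
  have fint: "curve_length \<gamma> a t < \<infinity>"
    using curve_length_mono[of a a t b \<gamma>] fin t by (auto intro: le_less_trans)
  have "\<exists>ts\<in>{ts. sorted ts \<and> set ts \<subseteq> {a..t}}. curve_length \<gamma> a t < polygonal_length (map \<gamma> ts) + ennreal (e/2)"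
    unfolding curve_length_eq_SUP
    by (intro SUP_approx_ennreal)
      (use e fint in \<open>auto simp: curve_length_eq_SUP[symmetric] intro!: exI[of _ "[]"]\<close>)
  then obtain ts where ts: "sorted ts" "set ts \<subseteq> {a..t}"
    and tl: "curve_length \<gamma> a t < polygonal_length (map \<gamma> ts) + ennreal (e/2)" by auto
  have "continuous (at t within {a..b}) \<gamma>"
    using c t by (auto simp: continuous_on_eq_continuous_within)
  then obtain d where d: "d > 0" "\<And>s. s \<in> {a..b} \<Longrightarrow> dist s t < d \<Longrightarrow> dist (\<gamma> s) (\<gamma> t) < e/2"
    using e unfolding continuous_within_eps_delta by (meson half_gt_zero)
  let ?us = "filter (\<lambda>s. s < t) ts"
  define m0 where "m0 = Max (insert a (insert (t - d/2) (set ?us)))"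
  have m0: "m0 < t" "a \<le> m0" "t - d/2 \<le> m0" "\<And>s. s \<in> set ?us \<Longrightarrow> s \<le> m0"
  proof -
    show "m0 < t" unfolding m0_def using t d by (subst Max_less_iff) auto
  qed (auto simp only: m0_def intro!: Max_ge)
  have tseq: "ts = ?us @ replicate (length (filter (\<lambda>s. \<not> s < t) ts)) t"
  proof -
    have "filter (\<lambda>s. \<not> s < t) ts = replicate (length (filter (\<lambda>s. \<not> s < t) ts)) t"
      using ts(2) by (subst replicate_length_same) auto
    moreover have "ts = ?us @ filter (\<lambda>s. \<not> s < t) ts"
      using ts(1)
    proof (induction ts)
      case (Cons x xs)
      have "filter (\<lambda>s. s < t) xs = []" if "\<not> x < t"
        using Cons(2) that by (fastforce simp: filter_empty_conv)
      with Cons show ?case by auto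
    qed simp
    ultimately show ?thesis by metis
  qed
  have rep: "polygonal_length (p # replicate n q) \<le> ennreal (dist p q)" for n and p q :: 'a
  proof (cases n)
    case (Suc k)
    have "polygonal_length (replicate k q) = 0 \<and> polygonal_length (q # replicate k q) = 0" for k
      by (induction k) auto
    then show ?thesis using Suc by simp
  qed simp
  define n where "n = length (filter (\<lambda>s. \<not> s < t) ts)"
  have "polygonal_length (map \<gamma> ts) = polygonal_length (map \<gamma> ?us @ replicate n (\<gamma> t))"
    by (subst tseq) (simp add: n_def)
  also have "\<dots> \<le> polygonal_length (map \<gamma> (?us @ [m0])) + polygonal_length (\<gamma> m0 # replicate n (\<gamma> t))"
    using polygonal_length_append_le by simp
  also have "polygonal_length (map \<gamma> (?us @ [m0])) \<le> curve_length \<gamma> a m0"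
    using ts m0 by (intro polygonal_length_le_curve_length) (auto simp: sorted_append sorted_wrt_filter)
  also have "polygonal_length (\<gamma> m0 # replicate n (\<gamma> t)) \<le> ennreal (dist (\<gamma> m0) (\<gamma> t))" by (rule rep)
  also have "dist (\<gamma> m0) (\<gamma> t) \<le> e/2"
    using d(2)[of m0] m0 t d(1) by (auto simp: dist_real_def)
  finally have "polygonal_length (map \<gamma> ts) \<le> curve_length \<gamma> a m0 + ennreal (e/2)"
    by (simp add: add_mono ennreal_leI)
  then have "curve_length \<gamma> a t < (curve_length \<gamma> a m0 + ennreal (e/2)) + ennreal (e/2)"
    using tl by (meson add_right_mono order_less_le_trans)
  then have "curve_length \<gamma> a m0 + curve_length \<gamma> m0 t \<le> curve_length \<gamma> a m0 + ennreal e"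
    using curve_length_add[of a m0 t \<gamma>] m0 e by (simp add: add.assoc less_imp_le flip: ennreal_plus)
  moreover have "curve_length \<gamma> a m0 \<noteq> \<infinity>"
    using curve_length_mono[of a a m0 t \<gamma>] fint m0 by (auto simp: less_top top_unique)
  ultimately have "curve_length \<gamma> m0 t \<le> ennreal e"
    by (simp add: ennreal_add_left_cancel_le)
  then show ?thesis using m0 by auto
qed

lemma polygonal_length_rev: "polygonal_length (rev xs) = polygonal_length xs"
proof (induction xs rule: polygonal_length.induct)
  case (1 x y zs)
  have snoc: "polygonal_length (us @ [p, q]) = polygonal_length (us @ [p]) + ennreal (dist p q)"
    for us and p q :: 'a
    by (induction us rule: polygonal_length.induct) (auto simp: ac_simps)
  show ?case using 1 snoc[of "rev zs" y x] by (simp add: dist_commute add.commute)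
qed auto

lemma curve_length_uminus: "curve_length (\<lambda>t. \<gamma> (- t)) (- b) (- a) = curve_length \<gamma> a b"
proof -
  have le: "curve_length \<gamma> a b \<le> curve_length (\<lambda>t. \<gamma> (- t)) (- b) (- a)" for \<gamma> :: "real \<Rightarrow> 'a" and a b
    unfolding curve_length_eq_SUP[of \<gamma>]
  proof (rule SUP_least)
    fix ts assume ts: "ts \<in> {ts. sorted ts \<and> set ts \<subseteq> {a..b}}"
    have "sorted (map uminus (rev ts))"
      using ts by (auto simp: sorted_iff_nth_mono rev_nth)
    then have "polygonal_length (map (\<lambda>t. \<gamma> (- t)) (map uminus (rev ts))) \<le> curve_length (\<lambda>t. \<gamma> (- t)) (- b) (- a)"
      using ts by (intro polygonal_length_le_curve_length) auto
    then show "polygonal_length (map \<gamma> ts) \<le> curve_length (\<lambda>t. \<gamma> (- t)) (- b) (- a)"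
      by (simp add: o_def polygonal_length_rev flip: rev_map)
  qed
  from le[of "\<lambda>t. \<gamma> (- t)" "-b" "-a"] le[of \<gamma> a b] show ?thesis by simp
qed

lemma curve_length_right_small:
  assumes c: "continuous_on {a..b} \<gamma>" and fin: "curve_length \<gamma> a b < \<infinity>" and t: "a \<le> t" "t < b"
    and e: "0 < e"
  shows "\<exists>m>t. m \<le> b \<and> curve_length \<gamma> t m \<le> ennreal e"
proof -
  have "continuous_on {-b..-a} (\<lambda>t. \<gamma> (- t))"
    using c by (intro continuous_on_compose2[OF c]) (auto intro!: continuous_intros)
  then obtain m where m: "m < -t" "-b \<le> m" "curve_length (\<lambda>t. \<gamma> (- t)) m (-t) \<le> ennreal e"
    using curve_length_left_small[of "-b" "-a" "\<lambda>t. \<gamma> (- t)" "-t" e] assms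
    by (auto simp: curve_length_uminus)
  then show ?thesis
    using curve_length_uminus[of \<gamma> "-m" t] by (intro exI[of _ "-m"]) auto
qed

lemma curve_length_eq_diff:
  assumes fin: "curve_length \<gamma> a b < \<infinity>" and "a \<le> s" "s \<le> t" "t \<le> b"
  shows "curve_length \<gamma> s t = ennreal (enn2real (curve_length \<gamma> a t) - enn2real (curve_length \<gamma> a s))"
proof -
  have f: "curve_length \<gamma> a t < \<infinity>" "curve_length \<gamma> a s < \<infinity>" "curve_length \<gamma> s t < \<infinity>"
    using assms curve_length_mono[of a a t b \<gamma>] curve_length_mono[of a a s b \<gamma>]
      curve_length_mono[of a s t b \<gamma>] by (auto intro: le_less_trans)
  have "curve_length \<gamma> a t = curve_length \<gamma> a s + curve_length \<gamma> s t"
    using assms by (intro curve_length_add) auto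
  then have "enn2real (curve_length \<gamma> a t) = enn2real (curve_length \<gamma> a s) + enn2real (curve_length \<gamma> s t)"
    using f by (simp add: enn2real_plus)
  then show ?thesis using f by simp
qed

lemma continuous_on_curve_length:
  assumes "is_curve \<gamma> a b"
  shows "continuous_on {a..b} (\<lambda>t. enn2real (curve_length \<gamma> a t))"
proof -
  let ?l = "\<lambda>t. enn2real (curve_length \<gamma> a t)"
  have c: "continuous_on {a..b} \<gamma>" and fin: "curve_length \<gamma> a b < \<infinity>"
    using assms by (auto simp: is_curve_def)
  have diff: "a \<le> s \<Longrightarrow> s \<le> t \<Longrightarrow> t \<le> b \<Longrightarrow> ?l s \<le> ?l t" for s t
    using curve_length_mono[of a a s t \<gamma>] curve_length_mono[of a a t b \<gamma>] fin
    by (auto intro!: enn2real_mono intro: le_less_trans)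
  show ?thesis
    unfolding continuous_on_iff
  proof (intro ballI allI impI)
    fix t and e :: real assume t: "t \<in> {a..b}" and e: "0 < e"
    have "\<exists>d>0. \<forall>s\<in>{a..b}. t - d < s \<longrightarrow> s \<le> t \<longrightarrow> ?l t - ?l s < e"
    proof (cases "a < t")
      case True
      obtain m where m: "m < t" "a \<le> m" "curve_length \<gamma> m t \<le> ennreal (e/2)"
        using curve_length_left_small[OF c fin True, of "e/2"] t e by auto
      then have "?l t - ?l m \<le> e/2"
        using curve_length_eq_diff[OF fin, of m t] e t by (auto simp: ennreal_le_iff)
      then show ?thesis
      proof (intro exI[of _ "t - m"] conjI ballI impI)
        fix s assume "s \<in> {a..b}" "t - (t - m) < s" "s \<le> t"
        then have "?l m \<le> ?l s" using m by (intro diff) auto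
        with \<open>?l t - ?l m \<le> e/2\<close> e show "?l t - ?l s < e" by linarith
      qed (use m in simp)
    next
      case False
      with t e show ?thesis by (intro exI[of _ 1]) auto
    qed
    moreover have "\<exists>d>0. \<forall>s\<in>{a..b}. s < t + d \<longrightarrow> t \<le> s \<longrightarrow> ?l s - ?l t < e"
    proof (cases "t < b")
      case True
      obtain m where m: "t < m" "m \<le> b" "curve_length \<gamma> t m \<le> ennreal (e/2)"
        using curve_length_right_small[OF c fin _ True, of "e/2"] t e by auto
      then have "?l m - ?l t \<le> e/2"
        using curve_length_eq_diff[OF fin, of t m] e t by (auto simp: ennreal_le_iff)
      then show ?thesis
      proof (intro exI[of _ "m - t"] conjI ballI impI)
        fix s assume "s \<in> {a..b}" "s < t + (m - t)" "t \<le> s"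
        then have "?l s \<le> ?l m" using m by (intro diff) auto
        with \<open>?l m - ?l t \<le> e/2\<close> e show "?l s - ?l t < e" by linarith
      qed (use m in simp)
    next
      case False
      with t e show ?thesis by (intro exI[of _ 1]) auto
    qed
    ultimately obtain d1 d2 where d: "d1 > 0" "d2 > 0"
      "\<And>s. s\<in>{a..b} \<Longrightarrow> t - d1 < s \<Longrightarrow> s \<le> t \<Longrightarrow> ?l t - ?l s < e"
      "\<And>s. s\<in>{a..b} \<Longrightarrow> s < t + d2 \<Longrightarrow> t \<le> s \<Longrightarrow> ?l s - ?l t < e" by blast
    show "\<exists>d>0. \<forall>s\<in>{a..b}. dist s t < d \<longrightarrow> dist (?l s) (?l t) < e"
    proof (intro exI[of _ "min d1 d2"] conjI ballI impI)
      show "0 < min d1 d2" using d by simp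
      fix s assume s: "s \<in> {a..b}" "dist s t < min d1 d2"
      show "dist (?l s) (?l t) < e"
        using d(3)[of s] d(4)[of s] diff[of s t] diff[of t s] s t
        by (cases "s \<le> t") (auto simp: dist_real_def)
    qed
  qed
qed

lemma arclength_paramE:
  assumes "is_curve \<gamma> a b" "0 \<le> s" "s \<le> enn2real (curve_length \<gamma> a b)"
  obtains t where "t \<in> {a..b}" "curve_length \<gamma> a t = ennreal s" "arclength_param \<gamma> a b s = \<gamma> t"
proof -
  let ?l = "\<lambda>t. enn2real (curve_length \<gamma> a t)"
  have fin: "curve_length \<gamma> a b < \<infinity>" and ab: "a \<le> b"
    using assms by (auto simp: is_curve_def)
  have "curve_length \<gamma> a a = 0"
    using curve_length_eq_diff[OF fin, of a a] ab by simp
  then have "\<exists>t\<ge>a. t \<le> b \<and> ?l t = s"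
    using assms ab by (intro IVT' continuous_on_curve_length) auto
  then obtain t where t: "t \<in> {a..b}" "?l t = s" by auto
  moreover have "curve_length \<gamma> a t < \<infinity>"
    using t fin curve_length_mono[of a a t b \<gamma>] by (auto intro: le_less_trans)
  ultimately have "t \<in> {a..b} \<and> curve_length \<gamma> a t = ennreal s" by auto
  then show thesis
    using someI[of "\<lambda>t. t \<in> {a..b} \<and> curve_length \<gamma> a t = ennreal s" t] that
    unfolding arclength_param_def by blast
qed

lemma curve_length_pos:
  assumes "nonconst_curve \<gamma> a b"
  shows "0 < enn2real (curve_length \<gamma> a b)"
proof (rule ccontr)
  assume "\<not> ?thesis"
  then have z: "curve_length \<gamma> a b = 0"
    using assms by (auto simp: nonconst_curve_def is_curve_def enn2real_positive_iff zero_less_iff_neq_zero)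
  have "\<gamma> t = \<gamma> a" if "t \<in> {a..b}" for t
  proof -
    have "ennreal (dist (\<gamma> a) (\<gamma> t)) \<le> 0"
      using dist_le_curve_length[of a a t b \<gamma>] that unfolding z by simp
    then show ?thesis by (simp add: ennreal_eq_0_iff)
  qed
  then have "\<gamma> constant_on {a..b}" unfolding constant_on_def by blast
  with assms show False by (simp add: nonconst_curve_def)
qed

lemma curve_integral_mono:
  assumes "is_curve \<gamma> a b" "\<And>t. t \<in> {a..b} \<Longrightarrow> f (\<gamma> t) \<le> g (\<gamma> t)"
  shows "curve_integral \<gamma> a b f \<le> curve_integral \<gamma> a b g"
  unfolding curve_integral_def
proof (intro nn_integral_mono)
  fix s
  show "f (arclength_param \<gamma> a b s) * indicator {0..enn2real (curve_length \<gamma> a b)} s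
      \<le> g (arclength_param \<gamma> a b s) * indicator {0..enn2real (curve_length \<gamma> a b)} s"
    by (cases "s \<in> {0..enn2real (curve_length \<gamma> a b)}")
       (auto elim!: arclength_paramE[OF assms(1)] simp: assms(2))
qed

text \<open>The version in the library needs measurability, which is not available here for compositions
  with \<^const>\<open>arclength_param\<close>.\<close>

lemma nn_integral_cmult_ge:
  fixes c :: real
  assumes "0 \<le> c"
  shows "ennreal c * (\<integral>\<^sup>+x. f x \<partial>M) \<le> (\<integral>\<^sup>+x. ennreal c * f x \<partial>M)"
proof -
  have "ennreal c * integral\<^sup>S M s \<le> (\<integral>\<^sup>+x. ennreal c * f x \<partial>M)" if s: "simple_function M s" "s \<le> f" for s
  proof -
    have "ennreal c * integral\<^sup>S M s = (\<integral>\<^sup>+x. ennreal c * s x \<partial>M)"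
      using s by (simp add: nn_integral_eq_simple_integral nn_integral_cmult borel_measurable_simple_function)
    also have "\<dots> \<le> (\<integral>\<^sup>+x. ennreal c * f x \<partial>M)"
      using s by (intro nn_integral_mono mult_left_mono) (auto simp: le_fun_def)
    finally show ?thesis .
  qed
  then show ?thesis
    unfolding nn_integral_def[of M f] SUP_mult_left_ennreal by (intro SUP_least) auto
qed

lemma curve_integral_cmult_eq_top:
  assumes "curve_integral \<gamma> a b f = \<infinity>" "0 < c"
  shows "curve_integral \<gamma> a b (\<lambda>x. ennreal c * f x) = \<infinity>"
  using nn_integral_cmult_ge[of c lebesgue "\<lambda>s. f (arclength_param \<gamma> a b s) * indicator {0..enn2real (curve_length \<gamma> a b)} s"]
    assms unfolding curve_integral_def
  by (simp add: mult.assoc ennreal_mult_top top_unique ennreal_mult_eq_top_iff)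

lemma curve_integral_eq_top:
  assumes c: "nonconst_curve \<gamma> a b" and t: "t \<in> {a..b}" and r: "0 < r"
    and g: "\<And>x. dist (\<gamma> t) x < r \<Longrightarrow> g x = \<infinity>"
  shows "curve_integral \<gamma> a b g = \<infinity>"
proof -
  define L where "L = enn2real (curve_length \<gamma> a b)"
  define s0 where "s0 = enn2real (curve_length \<gamma> a t)"
  have ic: "is_curve \<gamma> a b" using c by (simp add: nonconst_curve_def)
  then have fin: "curve_length \<gamma> a b < \<infinity>" by (auto simp: is_curve_def)
  have L: "0 < L" using curve_length_pos[OF c] by (simp add: L_def)
  have s0: "0 \<le> s0" "s0 \<le> L"
    using t fin curve_length_mono[of a a t b \<gamma>] by (auto simp: L_def s0_def intro!: enn2real_mono)
  define J where "J = {max 0 (s0 - r/2)..min L (s0 + r/2)}"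
  have top: "g (arclength_param \<gamma> a b s) = \<infinity>" if s: "s \<in> J" for s
  proof -
    obtain t' where t': "t' \<in> {a..b}" "curve_length \<gamma> a t' = ennreal s" "arclength_param \<gamma> a b s = \<gamma> t'"
      using arclength_paramE[OF ic, of s] s by (auto simp: J_def L_def)
    have s': "enn2real (curve_length \<gamma> a t') = s" using t' s by (auto simp: J_def)
    have "ennreal (dist (\<gamma> t) (\<gamma> t')) \<le> ennreal \<bar>s - s0\<bar>"
    proof (cases "t \<le> t'")
      case True
      then show ?thesis
        using dist_le_curve_length[of t t t' t' \<gamma>] curve_length_eq_diff[OF fin, of t t'] t t'(1) s'
        by (intro order_trans[OF _ ennreal_leI[OF abs_ge_self]]) (auto simp: s0_def)
    next
      case False
      then show ?thesis
        using dist_le_curve_length[of t' t' t t \<gamma>] curve_length_eq_diff[OF fin, of t' t] t t'(1) s'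
        by (intro order_trans[OF _ ennreal_leI[OF abs_ge_minus_self]]) (auto simp: s0_def dist_commute)
    qed
    then have "dist (\<gamma> t) (\<gamma> t') < r" using s r by (auto simp: J_def ennreal_le_iff)
    then show ?thesis using g t' by simp
  qed
  have "(\<integral>\<^sup>+s. \<infinity> * indicator J s \<partial>lebesgue) \<le> curve_integral \<gamma> a b g"
    unfolding curve_integral_def
    by (intro nn_integral_mono) (auto simp: top indicator_def J_def L_def)
  moreover have "emeasure lebesgue J \<noteq> 0"
    using L s0 r by (auto simp: J_def emeasure_lborel_Icc_eq ennreal_eq_0_iff)
  moreover have "(\<integral>\<^sup>+s. \<infinity> * indicator J s \<partial>lebesgue) = \<infinity> * emeasure lebesgue J"
    by (intro nn_integral_cmult_indicator) (simp add: J_def)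
  ultimately show ?thesis
    by (auto simp: ennreal_top_mult top_unique)
qed

section \<open>Covering and doubling\<close>

lemma greedy_selection:
  fixes P :: "'b set" and k :: "'b \<Rightarrow> nat" and conf :: "'b \<Rightarrow> 'b \<Rightarrow> bool"
  assumes sym: "\<And>p q. conf p q \<Longrightarrow> conf q p"
  obtains S where "S \<subseteq> P" "pairwise (\<lambda>p q. \<not> conf p q) S"
    "\<And>p. p \<in> P \<Longrightarrow> \<exists>q\<in>S. k q \<le> k p \<and> (q = p \<or> conf q p)"
proof -
  obtain W :: "'b rel" where W: "Well_order W" "Field W = UNIV"
    using well_ordering[where 'a = 'b] by (elim exE conjE)
  define r where "r = inv_image (less_than <*lex*> (W - Id)) (\<lambda>p. (k p, p))"
  have wf: "wf r"
    unfolding r_def using W by (intro wf_inv_image wf_lex_prod) (auto simp: well_order_on_def)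
  have total: "p \<noteq> q \<Longrightarrow> (p, q) \<in> r \<or> (q, p) \<in> r" for p q
    using W unfolding r_def
    by (auto simp: well_order_on_def linear_order_on_def total_on_def)
  define sel where "sel = wfrec r (\<lambda>f p. p \<in> P \<and> (\<forall>q. (q, p) \<in> r \<longrightarrow> f q \<longrightarrow> \<not> conf q p))"
  have sel: "sel p \<longleftrightarrow> p \<in> P \<and> (\<forall>q. (q, p) \<in> r \<longrightarrow> sel q \<longrightarrow> \<not> conf q p)" for p
    by (subst sel_def, subst wfrec[OF wf]) (simp add: cut_apply sel_def[symmetric] cong: conj_cong imp_cong)
  show thesis
  proof (rule that[of "Collect sel"])
    show "Collect sel \<subseteq> P" using sel by auto
    show "pairwise (\<lambda>p q. \<not> conf p q) (Collect sel)"
      using sel total sym unfolding pairwise_def by blast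
    fix p assume p: "p \<in> P"
    show "\<exists>q\<in>Collect sel. k q \<le> k p \<and> (q = p \<or> conf q p)"
    proof (cases "sel p")
      case False
      then obtain q where "(q, p) \<in> r" "sel q" "conf q p" using sel p by blast
      then show ?thesis unfolding r_def by (intro bexI[of _ q]) auto
    qed auto
  qed
qed

lemma five_times_covering:
  fixes P :: "'a::metric_space set" and \<rho> :: "'a \<Rightarrow> real"
  assumes \<rho>: "\<And>x. x \<in> P \<Longrightarrow> 0 < \<rho> x \<and> \<rho> x \<le> R"
  obtains S where "S \<subseteq> P" "disjoint_family_on (\<lambda>x. ball x (\<rho> x)) S"
    "(\<Union>x\<in>P. ball x (\<rho> x)) \<subseteq> (\<Union>x\<in>S. ball x (5 * \<rho> x))"
proof -
  define k where "k x = (LEAST k. R / 2 ^ Suc k < \<rho> x)" for x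
  have k: "R / 2 ^ Suc (k x) < \<rho> x" "\<rho> x \<le> R / 2 ^ k x" if x: "x \<in> P" for x
  proof -
    obtain n where "R / \<rho> x < 2 ^ n" using real_arch_pow[of 2] by auto
    also have "(2::real) ^ n \<le> 2 ^ Suc n" by simp
    finally have "R / 2 ^ Suc n < \<rho> x" using \<rho>[OF x] by (simp add: field_simps)
    then show "R / 2 ^ Suc (k x) < \<rho> x" unfolding k_def by (rule LeastI)
    show "\<rho> x \<le> R / 2 ^ k x"
    proof (cases "k x")
      case (Suc m)
      then have "\<not> R / 2 ^ Suc m < \<rho> x" unfolding k_def by (metis lessI not_less_Least)
      then show ?thesis using Suc by simp
    qed (use \<rho>[OF x] in simp)
  qed
  obtain S where S: "S \<subseteq> P" "pairwise (\<lambda>p q. \<not> ball p (\<rho> p) \<inter> ball q (\<rho> q) \<noteq> {}) S"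
    "\<And>p. p \<in> P \<Longrightarrow> \<exists>q\<in>S. k q \<le> k p \<and> (q = p \<or> ball q (\<rho> q) \<inter> ball p (\<rho> p) \<noteq> {})"
    by (rule greedy_selection[where P = P and k = k and conf = "\<lambda>p q. ball p (\<rho> p) \<inter> ball q (\<rho> q) \<noteq> {}"])
       (auto simp: Int_commute)
  show thesis
  proof (rule that[OF S(1)])
    show "disjoint_family_on (\<lambda>x. ball x (\<rho> x)) S"
      using S(2) by (auto simp: disjoint_family_on_def pairwise_def)
    show "(\<Union>x\<in>P. ball x (\<rho> x)) \<subseteq> (\<Union>x\<in>S. ball x (5 * \<rho> x))"
    proof safe
      fix p x assume p: "p \<in> P" and x: "x \<in> ball p (\<rho> p)"
      obtain q where q: "q \<in> S" "k q \<le> k p" "q = p \<or> ball q (\<rho> q) \<inter> ball p (\<rho> p) \<noteq> {}"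
        using S(3)[OF p] by blast
      have pos: "0 < \<rho> q" "0 < \<rho> p" "0 < R" using \<rho> q S(1) p by force+
      have "\<rho> p \<le> R / 2 ^ k p" using k p by auto
      also have "\<dots> \<le> R / 2 ^ k q"
        using q(2) pos by (intro divide_left_mono power_increasing mult_pos_pos) auto
      also have "\<dots> < 2 * \<rho> q" using k(1)[of q] q S(1) by (auto simp: field_simps)
      finally have le: "\<rho> p < 2 * \<rho> q" .
      have "dist q p < \<rho> q + \<rho> p"
      proof (cases "q = p")
        case False
        then obtain w where "dist q w < \<rho> q" "dist p w < \<rho> p" using q(3) by auto
        then show ?thesis using dist_triangle[of q p w] by (simp add: dist_commute)
      qed (use pos in simp)
      then have "dist q x < 5 * \<rho> q" using dist_triangle[of q x p] x le by simp
      then show "x \<in> (\<Union>x\<in>S. ball x (5 * \<rho> x))" using q(1) by auto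
    qed
  qed
qed

locale doubling_space =
  fixes M :: "'a::metric_space measure" and Cd :: real
  assumes space_M [simp]: "space M = UNIV"
    and borel_M: "sets borel \<subseteq> sets M"
    and Cd: "1 \<le> Cd"
    and ball_pos: "0 < r \<Longrightarrow> 0 < emeasure M (ball x r)"
    and ball_finite: "emeasure M (ball x r) < \<infinity>"
    and ball_double: "0 < r \<Longrightarrow> emeasure M (ball x (2 * r)) \<le> ennreal Cd * emeasure M (ball x r)"
begin

lemma ball_sets [measurable, simp]: "ball x r \<in> sets M"
  using borel_M by auto

lemma borel_measurable_M:
  fixes f :: "'a \<Rightarrow> 'b::topological_space"
  shows "f \<in> borel_measurable borel \<Longrightarrow> f \<in> borel_measurable M"
  using borel_M by (auto simp: measurable_def)

lemma ball_iterate: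
  assumes "0 < r"
  shows "emeasure M (ball x (2 ^ k * r)) \<le> ennreal (Cd ^ k) * emeasure M (ball x r)"
proof (induction k)
  case (Suc k)
  have "emeasure M (ball x (2 ^ Suc k * r)) \<le> ennreal Cd * emeasure M (ball x (2 ^ k * r))"
    using ball_double[of "2 ^ k * r" x] assms by (simp add: mult.assoc)
  also have "\<dots> \<le> ennreal Cd * (ennreal (Cd ^ k) * emeasure M (ball x r))"
    by (intro mult_left_mono Suc) auto
  also have "\<dots> = ennreal (Cd ^ Suc k) * emeasure M (ball x r)"
    using Cd by (simp add: ennreal_mult' mult.assoc)
  finally show ?case .
qed simp

lemma emeasure_ball_le:
  assumes "0 < r" "dist x y + R \<le> 2 ^ k * r"
  shows "emeasure M (ball y R) \<le> ennreal (Cd ^ k) * emeasure M (ball x r)"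
proof -
  have "ball y R \<subseteq> ball x (2 ^ k * r)"
  proof
    fix z assume "z \<in> ball y R"
    then show "z \<in> ball x (2 ^ k * r)" using assms(2) dist_triangle[of x z y] by simp
  qed
  then have "emeasure M (ball y R) \<le> emeasure M (ball x (2 ^ k * r))"
    by (intro emeasure_mono) auto
  with ball_iterate[OF assms(1), of x k] show ?thesis by (rule order_trans[rotated])
qed

lemma emeasure_ball: "emeasure M (ball x r) = ennreal (measure M (ball x r))"
  using ball_finite[of x r] by (simp add: emeasure_eq_ennreal_measure)

lemma measure_ball_pos: "0 < r \<Longrightarrow> 0 < measure M (ball x r)"
  using ball_pos[of r x] by (simp add: emeasure_ball)

lemma measure_ball_le:
  assumes "0 < r" "dist x y + R \<le> 2 ^ k * r"
  shows "measure M (ball y R) \<le> Cd ^ k * measure M (ball x r)"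
  using emeasure_ball_le[OF assms] Cd by (simp add: emeasure_ball flip: ennreal_mult)

sublocale sigma_finite_measure M
proof
  have "(\<Union>n::nat. ball undefined (real n)) = (UNIV :: 'a set)"
    using reals_Archimedean2 by auto
  then show "\<exists>A. countable A \<and> A \<subseteq> sets M \<and> \<Union> A = space M \<and> (\<forall>a\<in>A. emeasure M a \<noteq> \<infinity>)"
    using ball_finite by (intro exI[of _ "range (\<lambda>n::nat. ball undefined (real n))"]) (auto simp: less_top)
qed

lemma countable_separated:
  fixes S :: "'a set"
  assumes e: "0 < e" and sep: "pairwise (\<lambda>x y. \<not> dist x y < e) S"
  shows "countable S"
proof -
  have fin: "finite (S \<inter> ball p (real n))" for p :: 'a and n
  proof -
    obtain k where k: "(2 * real n + e) / (e/2) < 2 ^ k" using real_arch_pow[of 2] by auto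
    let ?V = "measure M (ball p (real n + e))"
    have "card G \<le> nat \<lfloor>Cd ^ k\<rfloor>" if G: "G \<subseteq> S \<inter> ball p (real n)" "finite G" for G
    proof -
      have "real (card G) * ?V = (\<Sum>x\<in>G. ?V)" by simp
      also have "\<dots> \<le> (\<Sum>x\<in>G. Cd ^ k * measure M (ball x (e/2)))"
      proof (rule sum_mono)
        fix x assume "x \<in> G"
        then have "dist x p < n" using G by (auto simp: dist_commute)
        then have "dist x p + (real n + e) \<le> 2 ^ k * (e/2)" using k e by (simp add: field_simps)
        then show "?V \<le> Cd ^ k * measure M (ball x (e/2))"
          using measure_ball_le[of "e/2" x p "real n + e" k] e by simp
      qed
      also have "\<dots> = Cd ^ k * (\<Sum>x\<in>G. measure M (ball x (e/2)))" by (simp add: sum_distrib_left)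
      also have "(\<Sum>x\<in>G. measure M (ball x (e/2))) = measure M (\<Union>x\<in>G. ball x (e/2))"
      proof (rule measure_finite_Union[symmetric])
        show "disjoint_family_on (\<lambda>x. ball x (e/2)) G"
          unfolding disjoint_family_on_def
        proof safe
          fix x y z assume xy: "x \<in> G" "y \<in> G" "x \<noteq> y" and z: "z \<in> ball x (e/2)" "z \<in> ball y (e/2)"
          then have "\<not> dist x y < e" using sep G by (auto simp: pairwise_def)
          with z dist_triangle[of x y z] show "z \<in> {}" by (simp add: dist_commute)
        qed
      qed (use G ball_finite in \<open>auto simp: less_top\<close>)
      also have "\<dots> \<le> ?V"
      proof (rule measure_mono_fmeasurable)
        show "(\<Union>x\<in>G. ball x (e/2)) \<subseteq> ball p (real n + e)"
        proof safe
          fix x z assume "x \<in> G" "z \<in> ball x (e/2)"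
          then show "z \<in> ball p (real n + e)"
            using G dist_triangle[of p z x] e by (force simp: dist_commute)
        qed
      qed (use G ball_finite in \<open>auto simp: fmeasurable_def\<close>)
      finally have "real (card G) * ?V \<le> Cd ^ k * ?V" using Cd by (simp add: mult_left_mono)
      moreover have "0 < ?V" using e by (intro measure_ball_pos) auto
      ultimately show ?thesis by (simp add: le_nat_floor)
    qed
    then show ?thesis using finite_if_finite_subsets_card_bdd by blast
  qed
  have "S = (\<Union>n::nat. S \<inter> ball undefined (real n))"
    using reals_Archimedean2 by auto
  also have "countable \<dots>" using fin by (intro countable_UN) (auto intro: countable_finite)
  finally show ?thesis .
qed

lemma ex_countable_dense: "\<exists>Q::'a set. countable Q \<and> (\<forall>x e. 0 < e \<longrightarrow> (\<exists>q\<in>Q. dist q x < e))"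
proof -
  have "\<exists>S::'a set. countable S \<and> (\<forall>x. \<exists>q\<in>S. dist q x < e)" if e: "0 < e" for e
  proof -
    obtain S :: "'a set" where S: "pairwise (\<lambda>x y. \<not> dist x y < e) S"
      "\<And>p. p \<in> UNIV \<Longrightarrow> \<exists>q\<in>S. (0::nat) \<le> 0 \<and> (q = p \<or> dist q p < e)"
      by (rule greedy_selection[where P = "UNIV :: 'a set" and k = "\<lambda>_. 0" and conf = "\<lambda>x y. dist x y < e"])
         (auto simp: dist_commute)
    then show ?thesis using countable_separated[OF e S(1)] e by (metis UNIV_I dist_self)
  qed
  then have "\<exists>S::'a set. countable S \<and> (\<forall>x. \<exists>q\<in>S. dist q x < 1 / real (Suc n))" for n
    by simp
  then obtain S :: "nat \<Rightarrow> 'a set" where S: "\<And>n. countable (S n)"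
    "\<And>n x. \<exists>q\<in>S n. dist q x < 1 / real (Suc n)" by metis
  show ?thesis
  proof (intro exI[of _ "\<Union>n. S n"] conjI allI impI)
    show "countable (\<Union>n. S n)" using S by auto
    fix x :: 'a and e :: real assume "0 < e"
    then obtain n where "1 / real (Suc n) < e" using nat_approx_posE by blast
    with S(2)[of n x] show "\<exists>q\<in>\<Union>n. S n. dist q x < e" by (force intro: less_trans)
  qed
qed

lemma measurable_dist [measurable (raw)]:
  assumes f: "f \<in> measurable N M" and g: "g \<in> measurable N M"
  shows "(\<lambda>x. dist (f x) (g x)) \<in> borel_measurable N"
proof -
  obtain Q :: "'a set" where Q: "countable Q" "\<And>x e. 0 < e \<Longrightarrow> \<exists>q\<in>Q. dist q x < e"
    using ex_countable_dense by blast
  have ne: "Q \<noteq> {}" using Q(2)[of 1 undefined] by auto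
  have [measurable]: "(\<lambda>x. dist x q) \<in> borel_measurable M" for q
    by (intro borel_measurable_M borel_measurable_continuous_onI continuous_intros)
  have bdd: "bdd_below ((\<lambda>q. dist (f x) q + dist (g x) q) ` Q)" for x
    by (rule bdd_belowI[of _ 0]) auto
  have "(\<lambda>x. INF q\<in>Q. dist (f x) q + dist (g x) q) \<in> borel_measurable N"
    using bdd by (intro borel_measurable_cINF Q(1))
      (auto intro!: borel_measurable_add measurable_compose[OF f] measurable_compose[OF g])
  also have "(\<lambda>x. INF q\<in>Q. dist (f x) q + dist (g x) q) = (\<lambda>x. dist (f x) (g x))"
  proof
    fix x
    show "(INF q\<in>Q. dist (f x) q + dist (g x) q) = dist (f x) (g x)"
    proof (rule antisym)
      show "dist (f x) (g x) \<le> (INF q\<in>Q. dist (f x) q + dist (g x) q)"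
        using ne by (intro cINF_greatest) (auto simp: dist_triangle2)
      show "(INF q\<in>Q. dist (f x) q + dist (g x) q) \<le> dist (f x) (g x)"
      proof (rule field_le_epsilon)
        fix e :: real assume "0 < e"
        then obtain q where q: "q \<in> Q" "dist q (f x) < e/2" using Q(2)[of "e/2" "f x"] by auto
        have "(INF q\<in>Q. dist (f x) q + dist (g x) q) \<le> dist (f x) q + dist (g x) q"
          using bdd q by (intro cINF_lower) auto
        also have "\<dots> \<le> dist (f x) (g x) + e"
          using q dist_triangle[of "g x" q "f x"] by (simp add: dist_commute)
        finally show "(INF q\<in>Q. dist (f x) q + dist (g x) q) \<le> dist (f x) (g x) + e" .
      qed
    qed
  qed
  finally show ?thesis .
qed

lemma countable_disjoint_balls:
  fixes S :: "'a set"
  assumes "disjoint_family_on (\<lambda>x. ball x (\<rho> x)) S" "\<And>x. x \<in> S \<Longrightarrow> 0 < \<rho> x"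
  shows "countable S"
proof -
  obtain Q :: "'a set" where Q: "countable Q" "\<And>x e. 0 < e \<Longrightarrow> \<exists>q\<in>Q. dist q x < e"
    using ex_countable_dense by blast
  then have "\<forall>x\<in>S. \<exists>q\<in>Q. q \<in> ball x (\<rho> x)"
    using assms(2) by (metis dist_commute mem_ball)
  then obtain f where f: "\<And>x. x \<in> S \<Longrightarrow> f x \<in> Q \<and> f x \<in> ball x (\<rho> x)" by metis
  have "inj_on f S"
    using assms(1) f unfolding inj_on_def disjoint_family_on_def by (metis disjoint_iff)
  moreover have "countable (f ` S)" using f Q(1) by (meson countable_subset image_subsetI)
  ultimately show ?thesis by (rule countable_image_inj_on[rotated])
qed

end

section \<open>Smoothing at the scale of the distance to the boundary\<close>

locale doubling_open = doubling_space M Cd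
  for M :: "'a::metric_space measure" and Cd +
  fixes \<Omega> :: "'a set"
  assumes open_\<Omega>: "open \<Omega>" and compl_\<Omega>: "- \<Omega> \<noteq> {}"
begin

definition bdist :: "'a \<Rightarrow> real" where
  "bdist x = infdist x (- \<Omega>)"

definition vol :: "'a \<Rightarrow> real" where
  "vol x = measure M (ball x (bdist x))"

definition kernel :: "real \<Rightarrow> 'a \<Rightarrow> 'a \<Rightarrow> ennreal" where
  "kernel A x y = (if y \<in> \<Omega> \<and> dist x y \<le> A * bdist y then ennreal (1 / vol y) else 0)"

definition avg :: "real \<Rightarrow> ('a \<Rightarrow> ennreal) \<Rightarrow> 'a \<Rightarrow> ennreal" where
  "avg A f x = (\<integral>\<^sup>+y. f y * kernel A x y \<partial>M)"

lemma bdist_pos_iff: "0 < bdist x \<longleftrightarrow> x \<in> \<Omega>"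
  using in_closed_iff_infdist_zero[of "- \<Omega>" x] open_\<Omega> compl_\<Omega> infdist_nonneg[of x "- \<Omega>"]
  by (auto simp: bdist_def closed_Compl less_le)

lemma bdist_diff: "\<bar>bdist x - bdist y\<bar> \<le> dist x y"
  unfolding bdist_def by (rule infdist_triangle_abs)

lemma bdist_le_dist: "x \<notin> \<Omega> \<Longrightarrow> bdist y \<le> dist x y"
  unfolding bdist_def by (metis ComplI infdist_le dist_commute)

lemma ball_bdist_subset: "r \<le> bdist x \<Longrightarrow> ball x r \<subseteq> \<Omega>"
  using bdist_le_dist[of _ x] by (fastforce simp: dist_commute)

lemma \<Omega>_sets [measurable]: "\<Omega> \<in> sets M"
  using open_\<Omega> borel_M by auto

lemma bdist_measurable [measurable]: "bdist \<in> borel_measurable M"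
  unfolding bdist_def
  by (intro borel_measurable_M borel_measurable_continuous_onI continuous_intros)

lemma vol_measurable [measurable]: "vol \<in> borel_measurable M"
proof -
  have "(\<lambda>x. enn2real (\<integral>\<^sup>+y. (if dist x y < bdist x then 1 else 0) \<partial>M)) \<in> borel_measurable M"
    by measurable
  also have "(\<lambda>x. enn2real (\<integral>\<^sup>+y. (if dist x y < bdist x then 1 else 0) \<partial>M)) = vol"
  proof
    fix x
    have "(\<integral>\<^sup>+y. (if dist x y < bdist x then 1 else 0) \<partial>M) = (\<integral>\<^sup>+y. indicator (ball x (bdist x)) y \<partial>M)"
      by (intro nn_integral_cong) (auto simp: indicator_def)
    then show "enn2real (\<integral>\<^sup>+y. (if dist x y < bdist x then 1 else 0) \<partial>M) = vol x"
      by (simp add: vol_def measure_def)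
  qed
  finally show ?thesis .
qed

lemma kernel_measurable [measurable (raw)]:
  assumes [measurable]: "f \<in> measurable N M" "g \<in> measurable N M"
  shows "(\<lambda>x. kernel A (f x) (g x)) \<in> borel_measurable N"
  unfolding kernel_def by measurable

lemma avg_measurable [measurable]:
  assumes [measurable]: "f \<in> borel_measurable M"
  shows "avg A f \<in> borel_measurable M"
  unfolding avg_def by measurable

lemma vol_pos: "x \<in> \<Omega> \<Longrightarrow> 0 < vol x"
  unfolding vol_def by (intro measure_ball_pos) (simp add: bdist_pos_iff)

lemma vol_le: "0 < r \<Longrightarrow> dist z x + bdist x \<le> 2 ^ k * r \<Longrightarrow> vol x \<le> Cd ^ k * measure M (ball z r)"
  unfolding vol_def by (rule measure_ball_le)

lemma vol_comparable:
  assumes "x \<in> \<Omega>" "dist x y < bdist x / 4"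
  shows "y \<in> \<Omega>" "vol y \<le> Cd * vol x" "vol x \<le> Cd * vol y" "3/4 * bdist x \<le> bdist y" "bdist y \<le> 5/4 * bdist x"
proof -
  have 1: "0 < bdist x" using assms by (simp add: bdist_pos_iff)
  show 2: "3/4 * bdist x \<le> bdist y" "bdist y \<le> 5/4 * bdist x"
    using bdist_diff[of x y] assms(2) by (auto simp: abs_le_iff)
  then have 3: "0 < bdist y" using 1 by linarith
  then show "y \<in> \<Omega>" by (simp add: bdist_pos_iff)
  show "vol y \<le> Cd * vol x"
    unfolding vol_def using measure_ball_le[of "bdist x" x y "bdist y" 1] 1 2 assms(2) by simp
  show "vol x \<le> Cd * vol y"
    unfolding vol_def using measure_ball_le[of "bdist y" y x "bdist x" 1] 3 2 assms(2)
    by (simp add: dist_commute)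
qed

lemma nn_integral_swap:
  "(\<lambda>(x, y). F x y) \<in> borel_measurable (M \<Otimes>\<^sub>M M) \<Longrightarrow>
    (\<integral>\<^sup>+x. \<integral>\<^sup>+y. F x y \<partial>M \<partial>M) = (\<integral>\<^sup>+y. \<integral>\<^sup>+x. F x y \<partial>M \<partial>M)"
proof -
  interpret pair_sigma_finite M M ..
  assume "(\<lambda>(x, y). F x y) \<in> borel_measurable (M \<Otimes>\<^sub>M M)"
  then show ?thesis using Fubini'[of "\<lambda>x y. F x y"] by simp
qed

lemma nn_integral_avg:
  assumes [measurable]: "f \<in> borel_measurable M" and A: "A < 2 ^ k"
  shows "(\<integral>\<^sup>+x. avg A f x \<partial>M) \<le> ennreal (Cd ^ k) * (\<integral>\<^sup>+y. f y * indicator \<Omega> y \<partial>M)"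
proof -
  have "(\<integral>\<^sup>+x. avg A f x \<partial>M) = (\<integral>\<^sup>+y. \<integral>\<^sup>+x. f y * kernel A x y \<partial>M \<partial>M)"
    unfolding avg_def by (rule nn_integral_swap) measurable
  also have "\<dots> \<le> (\<integral>\<^sup>+y. ennreal (Cd ^ k) * (f y * indicator \<Omega> y) \<partial>M)"
  proof (rule nn_integral_mono)
    fix y
    have ker: "(\<integral>\<^sup>+x. kernel A x y \<partial>M) \<le> ennreal (Cd ^ k)" if y: "y \<in> \<Omega>"
    proof -
      have pos: "0 < bdist y" using y by (simp add: bdist_pos_iff)
      have "(\<integral>\<^sup>+x. kernel A x y \<partial>M) \<le> (\<integral>\<^sup>+x. ennreal (1 / vol y) * indicator (ball y (2 ^ k * bdist y)) x \<partial>M)"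
      proof (rule nn_integral_mono)
        fix x
        have "dist y x < 2 ^ k * bdist y" if "dist x y \<le> A * bdist y"
          using that mult_strict_right_mono[OF A pos] by (simp add: dist_commute)
        then show "kernel A x y \<le> ennreal (1 / vol y) * indicator (ball y (2 ^ k * bdist y)) x"
          by (auto simp: kernel_def)
      qed
      also have "\<dots> = ennreal (1 / vol y) * ennreal (measure M (ball y (2 ^ k * bdist y)))"
        by (simp add: nn_integral_cmult_indicator emeasure_ball)
      also have "\<dots> \<le> ennreal (1 / vol y) * ennreal (Cd ^ k * vol y)"
        using measure_ball_le[OF pos, of y y "2 ^ k * bdist y" k]
        by (intro mult_left_mono ennreal_leI) (auto simp: vol_def)
      also have "\<dots> = ennreal (Cd ^ k)"
        using vol_pos[OF y] Cd by (simp flip: ennreal_mult)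
      finally show ?thesis .
    qed
    have "(\<integral>\<^sup>+x. f y * kernel A x y \<partial>M) = f y * (\<integral>\<^sup>+x. kernel A x y \<partial>M)"
      by (rule nn_integral_cmult) measurable
    also have "\<dots> \<le> ennreal (Cd ^ k) * (f y * indicator \<Omega> y)"
    proof (cases "y \<in> \<Omega>")
      case True
      then show ?thesis using mult_left_mono[OF ker[OF True], of "f y"] by (simp add: mult.commute)
    qed (simp add: kernel_def)
    finally show "(\<integral>\<^sup>+x. f y * kernel A x y \<partial>M) \<le> ennreal (Cd ^ k) * (f y * indicator \<Omega> y)" .
  qed
  also have "\<dots> = ennreal (Cd ^ k) * (\<integral>\<^sup>+y. f y * indicator \<Omega> y \<partial>M)"
    by (rule nn_integral_cmult) measurable
  finally show ?thesis .
qed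

lemma nn_integral_ball_le_avg:
  assumes [measurable]: "f \<in> borel_measurable M" and x: "x \<in> \<Omega>" and z: "dist z x \<le> A * bdist x" and A: "0 \<le> A"
  shows "(\<integral>\<^sup>+y. f y * indicator (ball x (bdist x / 4)) y \<partial>M) \<le> ennreal (Cd * vol x) * avg (2 * A + 1) f z"
proof -
  have "f y * indicator (ball x (bdist x / 4)) y \<le> ennreal (Cd * vol x) * (f y * kernel (2 * A + 1) z y)" for y
  proof (cases "dist x y < bdist x / 4")
    case True
    note y = vol_comparable[OF x True]
    have "dist z y \<le> A * bdist x + bdist x / 4"
      using dist_triangle[of z y x] z True by simp
    also have "\<dots> = (A + 1/4) * (4/3) * (3/4 * bdist x)" by (simp add: field_simps)
    also have "\<dots> \<le> (2 * A + 1) * bdist y"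
      using A y(4) bdist_pos_iff x by (intro mult_mono) (auto simp: less_imp_le)
    finally have k: "kernel (2 * A + 1) z y = ennreal (1 / vol y)"
      using y by (simp add: kernel_def)
    have "1 \<le> Cd * vol x * (1 / vol y)" using y(2) vol_pos[OF y(1)] by (simp add: field_simps)
    then have "ennreal 1 \<le> ennreal (Cd * vol x) * ennreal (1 / vol y)"
      using vol_pos[OF x] vol_pos[OF y(1)] Cd
      by (subst ennreal_mult[symmetric]) (auto intro: ennreal_leI)
    then have "f y * 1 \<le> f y * (ennreal (Cd * vol x) * ennreal (1 / vol y))"
      by (intro mult_left_mono) auto
    then show ?thesis using True k by (simp add: ac_simps)
  qed simp
  then have "(\<integral>\<^sup>+y. f y * indicator (ball x (bdist x / 4)) y \<partial>M)
      \<le> (\<integral>\<^sup>+y. ennreal (Cd * vol x) * (f y * kernel (2 * A + 1) z y) \<partial>M)"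
    by (rule nn_integral_mono)
  also have "\<dots> = ennreal (Cd * vol x) * avg (2 * A + 1) f z"
    unfolding avg_def by (rule nn_integral_cmult) measurable
  finally show ?thesis .
qed

end

locale smoothing = doubling_open M Cd \<Omega>
  for M :: "'a::metric_space measure" and Cd \<Omega> +
  fixes \<Lambda> :: real and w :: "'a \<Rightarrow> real"
  assumes \<Lambda>: "1 \<le> \<Lambda>" and w: "integrable M w"
begin

definition \<delta> :: real where "\<delta> = 1 / (12 * \<Lambda>)"

text \<open>A ball of radius \<open>bdist x\<close> has at most \<open>K\<close> times the measure of a ball of radius
  \<open>\<delta> * bdist x / 4\<close> near its centre.\<close>

definition K :: real where "K = Cd ^ nat \<lceil>100 * \<Lambda>\<rceil>"

definition bump :: "'a \<Rightarrow> 'a \<Rightarrow> real" where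
  "bump x y = max 0 (\<delta> * bdist x - dist x y)"

definition mass :: "'a \<Rightarrow> real" where
  "mass x = (\<integral>y. bump x y \<partial>M)"

definition smooth :: "'a \<Rightarrow> real" where
  "smooth x = (\<integral>y. w y * bump x y \<partial>M) / mass x"

definition osc :: "real \<Rightarrow> 'a \<Rightarrow> real" where
  "osc c x = (\<integral>y. \<bar>w y - c\<bar> * indicator (ball x (bdist x / (4 * \<Lambda>))) y \<partial>M)"

lemma \<delta>: "0 < \<delta>" "\<delta> \<le> 1/12" using \<Lambda> by (auto simp: \<delta>_def field_simps)

lemma K: "1 \<le> K" unfolding K_def using Cd by simp

lemma two_power_ge: "100 * \<Lambda> \<le> 2 ^ nat \<lceil>100 * \<Lambda>\<rceil>"
proof -
  have "100 * \<Lambda> \<le> real (nat \<lceil>100 * \<Lambda>\<rceil>)" using \<Lambda> by linarith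
  also have "\<dots> < 2 ^ nat \<lceil>100 * \<Lambda>\<rceil>" by (rule of_nat_less_two_power)
  finally show ?thesis by simp
qed

lemma w_measurable [measurable]: "w \<in> borel_measurable M"
  using w by auto

lemma bump_measurable [measurable (raw)]:
  assumes [measurable]: "f \<in> measurable N M" "g \<in> measurable N M"
  shows "(\<lambda>x. bump (f x) (g x)) \<in> borel_measurable N"
  unfolding bump_def by measurable

lemma smooth_measurable [measurable]: "smooth \<in> borel_measurable M"
  unfolding smooth_def mass_def by measurable

lemma \<delta>_radius: "3 * \<delta> * bdist x = bdist x / (4 * \<Lambda>)"
  by (simp add: \<delta>_def)

lemma integrable_ball [intro]:
  fixes f :: "'a \<Rightarrow> real"
  assumes "f \<in> borel_measurable M" "\<And>y. \<bar>f y\<bar> \<le> C * indicator (ball x r) y"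
  shows "integrable M f"
proof (rule Bochner_Integration.integrable_bound[of _ "\<lambda>y. C * indicator (ball x r) y"])
  show "integrable M (\<lambda>y. C * indicator (ball x r) y :: real)"
    using ball_finite by (intro integrable_mult_right) (auto simp: less_top)
  show "AE y in M. norm (f y) \<le> norm (C * indicator (ball x r) y)"
    using order_trans[OF assms(2) abs_ge_self] by (intro AE_I2) simp
qed (use assms in auto)

lemma integrable_w_ball:
  fixes f :: "'a \<Rightarrow> real"
  assumes [measurable]: "f \<in> borel_measurable M" and f: "\<And>y. \<bar>f y\<bar> \<le> C * indicator (ball x r) y"
  shows "integrable M (\<lambda>y. w y * f y)" "integrable M (\<lambda>y. (w y - c) * f y)" "integrable M (\<lambda>y. \<bar>w y - c\<bar> * \<bar>f y\<bar>)"
proof -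
  show 1: "integrable M (\<lambda>y. w y * f y)"
  proof (rule Bochner_Integration.integrable_bound[of _ "\<lambda>y. \<bar>C\<bar> * w y"])
    have "\<bar>f y\<bar> \<le> \<bar>C\<bar>" for y using f[of y] by (cases "y \<in> ball x r") auto
    then show "AE y in M. norm (w y * f y) \<le> norm (\<bar>C\<bar> * w y)"
      by (intro AE_I2) (auto simp: abs_mult mult.commute intro: mult_right_mono)
  qed (use w in auto)
  have "integrable M f" using f by (intro integrable_ball) auto
  with 1 have "integrable M (\<lambda>y. w y * f y - c * f y)" by auto
  then show "integrable M (\<lambda>y. (w y - c) * f y)" by (simp add: left_diff_distrib)
  then show "integrable M (\<lambda>y. \<bar>w y - c\<bar> * \<bar>f y\<bar>)"
    by (subst abs_mult[symmetric]) (rule integrable_abs)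
qed

context
  fixes x z assumes x: "x \<in> \<Omega>" and z: "dist x z \<le> \<delta> * bdist x"
begin

lemma near_bdist: "bdist z \<le> 2 * bdist x" "bdist x \<le> 2 * bdist z" "0 < bdist x" "0 < bdist z"
proof -
  show 1: "0 < bdist x" using x by (simp add: bdist_pos_iff)
  have "\<delta> * bdist x \<le> 1/12 * bdist x" using \<delta> 1 by (intro mult_right_mono) auto
  then show 2: "bdist z \<le> 2 * bdist x" "bdist x \<le> 2 * bdist z"
    using bdist_diff[of x z] z 1 by linarith+
  show "0 < bdist z" using 1 2 by linarith
qed

lemma bump_le: "0 \<le> bump z y" "bump z y \<le> 2 * \<delta> * bdist x * indicator (ball x (bdist x / (4 * \<Lambda>))) y"
proof -
  show "0 \<le> bump z y" by (simp add: bump_def)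
  have le: "\<delta> * bdist z \<le> \<delta> * (2 * bdist x)" using near_bdist \<delta> by (intro mult_left_mono) auto
  show "bump z y \<le> 2 * \<delta> * bdist x * indicator (ball x (bdist x / (4 * \<Lambda>))) y"
  proof (cases "dist x y < 3 * \<delta> * bdist x")
    case True
    have "\<delta> * bdist z - dist z y \<le> 2 * \<delta> * bdist x" using le zero_le_dist[of z y] by linarith
    then show ?thesis using True near_bdist \<delta> unfolding \<delta>_radius[symmetric]
      by (simp add: bump_def)
  next
    case False
    then have "\<delta> * bdist z - dist z y \<le> 0" using le z dist_triangle[of x y z] by linarith
    then show ?thesis using False unfolding \<delta>_radius[symmetric] by (auto simp: bump_def)
  qed
qed

lemma bump_diff: "\<bar>bump x y - bump z y\<bar> \<le> 2 * dist x z * indicator (ball x (bdist x / (4 * \<Lambda>))) y"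
proof (cases "y \<in> ball x (bdist x / (4 * \<Lambda>))")
  case True
  have "\<bar>bump x y - bump z y\<bar> \<le> \<bar>(\<delta> * bdist x - dist x y) - (\<delta> * bdist z - dist z y)\<bar>"
    unfolding bump_def by (auto simp: max_def)
  also have "\<dots> \<le> \<delta> * \<bar>bdist x - bdist z\<bar> + \<bar>dist x y - dist z y\<bar>"
  proof -
    have "\<bar>(\<delta> * bdist x - dist x y) - (\<delta> * bdist z - dist z y)\<bar> = \<bar>\<delta> * (bdist x - bdist z) - (dist x y - dist z y)\<bar>"
      by (simp add: algebra_simps)
    also have "\<dots> \<le> \<bar>\<delta> * (bdist x - bdist z)\<bar> + \<bar>dist x y - dist z y\<bar>"
      by (rule abs_triangle_ineq4)
    also have "\<bar>\<delta> * (bdist x - bdist z)\<bar> = \<delta> * \<bar>bdist x - bdist z\<bar>"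
      using \<delta> by (simp add: abs_mult)
    finally show ?thesis .
  qed
  also have "\<delta> * \<bar>bdist x - bdist z\<bar> \<le> 1 * dist x z"
    using \<delta> bdist_diff[of x z] by (intro mult_mono) auto
  also have "\<bar>dist x y - dist z y\<bar> \<le> dist x z"
    using dist_triangle[of x y z] dist_triangle[of z y x] by (auto simp: dist_commute)
  finally show ?thesis using True by simp
next
  case False
  have "0 < \<delta> * bdist x" using near_bdist \<delta> by simp
  moreover have "3 * \<delta> * bdist x \<le> dist x y" using False by (simp add: \<delta>_radius)
  ultimately have "bump x y = 0" by (simp add: bump_def)
  moreover have "bump z y = 0" using False bump_le[of y] by simp
  ultimately show ?thesis by simp
qed

lemma mass_ge: "\<delta> * bdist x * vol x / (4 * K) \<le> mass z"
proof -
  let ?r = "\<delta> * bdist x / 4"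
  have r: "0 < ?r" using \<delta> near_bdist by auto
  have le: "\<delta> * bdist x \<le> \<delta> * (2 * bdist z)" using near_bdist \<delta> by (intro mult_left_mono) auto
  have "dist z x + bdist x \<le> 2 * bdist x"
  proof -
    have "\<delta> * bdist x \<le> 1 * bdist x" using \<delta> near_bdist(3) by (intro mult_right_mono) auto
    then show ?thesis using z by (simp add: dist_commute)
  qed
  also have "\<dots> = 96 * \<Lambda> * ?r" using \<Lambda> by (simp add: \<delta>_def)
  also have "\<dots> \<le> 2 ^ nat \<lceil>100 * \<Lambda>\<rceil> * ?r" using two_power_ge \<Lambda> r by (intro mult_right_mono) auto
  finally have "vol x \<le> K * measure M (ball z ?r)"
    unfolding K_def by (intro vol_le r) 
  then have "\<delta> * bdist x * vol x / (4 * K) \<le> ?r * measure M (ball z ?r)"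
  proof -
    assume "vol x \<le> K * measure M (ball z ?r)"
    then have "?r * vol x / K \<le> ?r * (K * measure M (ball z ?r)) / K"
      using r K by (intro divide_right_mono mult_left_mono) auto
    then show ?thesis using K by (simp add: mult_ac)
  qed
  also have "\<dots> = (\<integral>y. ?r * indicator (ball z ?r) y \<partial>M)" by simp
  also have "\<dots> \<le> mass z"
    unfolding mass_def
  proof (rule integral_mono)
    show "integrable M (\<lambda>y. ?r * indicator (ball z ?r) y)"
      using r by (intro integrable_ball[of _ ?r z ?r]) (auto simp: indicator_def)
    show "integrable M (bump z)"
      using bump_le by (intro integrable_ball[of _ "2 * \<delta> * bdist x" x "bdist x / (4 * \<Lambda>)"]) auto
    show "?r * indicator (ball z ?r) y \<le> bump z y" for y
      using le r by (auto simp: bump_def indicator_def max_def)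
  qed
  finally show ?thesis .
qed

lemma smooth_dev_mass: "(smooth z - c) * mass z = (\<integral>y. (w y - c) * bump z y \<partial>M)"
proof -
  have "0 < \<delta> * bdist x * vol x / (4 * K)" using \<delta> near_bdist K vol_pos[OF x] by simp
  then have m: "mass z \<noteq> 0" using mass_ge by linarith
  have b: "bump z \<in> borel_measurable M"
    "\<And>y. \<bar>bump z y\<bar> \<le> 2 * \<delta> * bdist x * indicator (ball x (bdist x / (4 * \<Lambda>))) y"
    using bump_le by auto
  have "(\<integral>y. (w y - c) * bump z y \<partial>M) = (\<integral>y. w y * bump z y - c * bump z y \<partial>M)"
    by (simp add: left_diff_distrib)
  also have "\<dots> = (\<integral>y. w y * bump z y \<partial>M) - (\<integral>y. c * bump z y \<partial>M)"
    using integrable_w_ball(1)[OF b] integrable_ball[OF b] by (intro Bochner_Integration.integral_diff) auto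
  also have "\<dots> = (smooth z - c) * mass z"
    using m by (simp add: smooth_def left_diff_distrib mass_def)
  finally show ?thesis ..
qed

lemma osc_bound:
  assumes [measurable]: "f \<in> borel_measurable M"
    and f: "\<And>y. \<bar>f y\<bar> \<le> C * indicator (ball x (bdist x / (4 * \<Lambda>))) y"
  shows "\<bar>\<integral>y. (w y - c) * f y \<partial>M\<bar> \<le> C * osc c x"
proof -
  have "\<bar>\<integral>y. (w y - c) * f y \<partial>M\<bar> \<le> (\<integral>y. \<bar>w y - c\<bar> * \<bar>f y\<bar> \<partial>M)"
    by (rule order_trans[OF integral_abs_bound]) (simp add: abs_mult)
  also have "\<dots> \<le> (\<integral>y. C * (\<bar>w y - c\<bar> * indicator (ball x (bdist x / (4 * \<Lambda>))) y) \<partial>M)"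
  proof (rule integral_mono)
    show "integrable M (\<lambda>y. \<bar>w y - c\<bar> * \<bar>f y\<bar>)"
      using f by (rule integrable_w_ball(3)[rotated]) simp
    have "integrable M (\<lambda>y. \<bar>w y - c\<bar> * \<bar>indicator (ball x (bdist x / (4 * \<Lambda>))) y\<bar>)"
      by (rule integrable_w_ball(3)[of _ 1 x "bdist x / (4 * \<Lambda>)"]) auto
    then show "integrable M (\<lambda>y. C * (\<bar>w y - c\<bar> * indicator (ball x (bdist x / (4 * \<Lambda>))) y))" by simp
    show "\<bar>w y - c\<bar> * \<bar>f y\<bar> \<le> C * (\<bar>w y - c\<bar> * indicator (ball x (bdist x / (4 * \<Lambda>))) y)" for y
      using mult_left_mono[OF f[of y], of "\<bar>w y - c\<bar>"] by (simp add: ac_simps)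
  qed
  finally show ?thesis by (simp add: osc_def)
qed

lemma smooth_dev: "\<bar>smooth z - c\<bar> \<le> 8 * K / vol x * osc c x"
proof -
  let ?m = "\<delta> * bdist x * vol x / (4 * K)"
  have m: "0 < ?m" using \<delta> near_bdist K vol_pos[OF x] by simp
  have "\<bar>smooth z - c\<bar> * ?m \<le> \<bar>smooth z - c\<bar> * mass z"
    using mass_ge by (intro mult_left_mono) auto
  also have "\<dots> = \<bar>\<integral>y. (w y - c) * bump z y \<partial>M\<bar>"
    using m mass_ge by (simp flip: smooth_dev_mass add: abs_mult)
  also have "\<dots> \<le> 2 * \<delta> * bdist x * osc c x"
    using bump_le by (intro osc_bound) auto
  finally have "\<bar>smooth z - c\<bar> \<le> 2 * \<delta> * bdist x * osc c x / ?m"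
    using m by (subst pos_le_divide_eq)
  also have "\<dots> = 8 * K / vol x * osc c x"
    using \<delta> near_bdist K vol_pos[OF x] by (simp add: field_simps)
  finally show ?thesis .
qed

end

lemma osc_nonneg: "0 \<le> osc c x"
  unfolding osc_def by (intro Bochner_Integration.integral_nonneg) auto

lemma smooth_diff:
  assumes x: "x \<in> \<Omega>" and z: "dist x z \<le> \<delta> * bdist x"
  shows "\<bar>smooth x - smooth z\<bar> \<le> 72 * K\<^sup>2 / (\<delta> * bdist x * vol x) * dist x z * osc c x"
proof -
  note near = near_bdist[OF x z]
  have xx: "dist x x \<le> \<delta> * bdist x" using near \<delta> by simp
  let ?m = "\<delta> * bdist x * vol x / (4 * K)"
  have m: "0 < ?m" using \<delta> near K vol_pos[OF x] by simp
  have mx: "?m \<le> mass x" using mass_ge[OF x xx] .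
  have bi: "integrable M (bump z')" if "dist x z' \<le> \<delta> * bdist x" for z'
    using bump_le[OF x that] by (intro integrable_ball[of _ "2 * \<delta> * bdist x" x "bdist x / (4 * \<Lambda>)"]) auto
  have wi: "integrable M (\<lambda>y. (w y - c) * bump z' y)" if "dist x z' \<le> \<delta> * bdist x" for z'
    using bump_le[OF x that]
    by (intro integrable_w_ball(2)[of _ "2 * \<delta> * bdist x" x "bdist x / (4 * \<Lambda>)"]) auto
  have a: "\<bar>(smooth x - c) * mass x - (smooth z - c) * mass z\<bar> \<le> 2 * dist x z * osc c x"
  proof -
    have "(smooth x - c) * mass x - (smooth z - c) * mass z = (\<integral>y. (w y - c) * (bump x y - bump z y) \<partial>M)"
      unfolding smooth_dev_mass[OF x xx] smooth_dev_mass[OF x z] right_diff_distrib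
      using wi[OF xx] wi[OF z] by (intro Bochner_Integration.integral_diff[symmetric])
    then show ?thesis using osc_bound[OF x z, of "\<lambda>y. bump x y - bump z y" "2 * dist x z" c] bump_diff[OF x z] by simp
  qed
  have b: "\<bar>mass z - mass x\<bar> \<le> 2 * dist x z * vol x"
  proof -
    have "\<bar>mass z - mass x\<bar> = \<bar>\<integral>y. bump x y - bump z y \<partial>M\<bar>"
      unfolding mass_def using bi[OF xx] bi[OF z] by (subst Bochner_Integration.integral_diff) auto
    also have "\<dots> \<le> (\<integral>y. \<bar>bump x y - bump z y\<bar> \<partial>M)"
      by (rule integral_abs_bound)
    also have "\<dots> \<le> (\<integral>y. 2 * dist x z * indicator (ball x (bdist x / (4 * \<Lambda>))) y \<partial>M)"
      using bump_diff[OF x z] bi[OF xx] bi[OF z]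
      by (intro integral_mono integrable_ball[of _ "2 * dist x z" x "bdist x / (4 * \<Lambda>)"]) auto
    also have "\<dots> = 2 * dist x z * measure M (ball x (bdist x / (4 * \<Lambda>)))" by simp
    also have "\<dots> \<le> 2 * dist x z * vol x"
    proof (intro mult_left_mono)
      have "bdist x / (4 * \<Lambda>) \<le> bdist x" using near \<Lambda> by (simp add: field_simps)
      then have "ball x (bdist x / (4 * \<Lambda>)) \<subseteq> ball x (bdist x)" by (rule subset_ball)
      then show "measure M (ball x (bdist x / (4 * \<Lambda>))) \<le> vol x"
        unfolding vol_def using ball_finite by (intro measure_mono_fmeasurable) (auto simp: fmeasurable_def)
    qed auto
    finally show ?thesis .
  qed
  have "smooth x - smooth z = ((smooth x - c) * mass x - (smooth z - c) * mass z + (smooth z - c) * (mass z - mass x)) / mass x"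
    using m mx by (simp add: field_simps)
  then have "\<bar>smooth x - smooth z\<bar> = \<bar>(smooth x - c) * mass x - (smooth z - c) * mass z + (smooth z - c) * (mass z - mass x)\<bar> / mass x"
    using m mx by simp
  also have "\<dots> \<le> (2 * dist x z * osc c x + 8 * K / vol x * osc c x * (2 * dist x z * vol x)) / mass x"
  proof (intro divide_right_mono order_trans[OF abs_triangle_ineq] add_mono a)
    show "\<bar>(smooth z - c) * (mass z - mass x)\<bar> \<le> 8 * K / vol x * osc c x * (2 * dist x z * vol x)"
      unfolding abs_mult using b smooth_dev[OF x z, of c] by (intro mult_mono) auto
  qed (use m mx in linarith)
  also have "\<dots> \<le> (2 * dist x z * osc c x + 8 * K / vol x * osc c x * (2 * dist x z * vol x)) / ?m"
    using mx m osc_nonneg[of c x] K vol_pos[OF x] by (intro divide_left_mono add_nonneg_nonneg mult_nonneg_nonneg mult_pos_pos) auto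
  also have "\<dots> = (2 * dist x z * osc c x + 16 * K * dist x z * osc c x) / ?m"
    using vol_pos[OF x] by simp
  also have "\<dots> \<le> (2 * K * dist x z * osc c x + 16 * K * dist x z * osc c x) / ?m"
  proof (intro divide_right_mono add_right_mono)
    show "2 * dist x z * osc c x \<le> 2 * K * dist x z * osc c x"
      using K osc_nonneg[of c x] by (intro mult_right_mono) auto
  qed (use m in linarith)
  also have "\<dots> = 72 * K\<^sup>2 / (\<delta> * bdist x * vol x) * dist x z * osc c x"
    using \<delta> near K vol_pos[OF x] by (simp add: field_simps power2_eq_square)
  finally show ?thesis .
qed

end

lemma ennreal_mult3:
  "0 \<le> a \<Longrightarrow> 0 \<le> b \<Longrightarrow> 0 \<le> c \<Longrightarrow>
    ennreal a * (ennreal b * (ennreal c * x)) = ennreal (a * b * c) * x"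
  by (simp add: ennreal_mult mult.assoc)

context smoothing
begin

definition local_poincare :: "real \<Rightarrow> ('a \<Rightarrow> ennreal) \<Rightarrow> bool" where
  "local_poincare CP h \<longleftrightarrow> 0 < CP \<and> h \<in> borel_measurable M \<and>
     (\<forall>x r. 0 < r \<longrightarrow> ball x (2 * \<Lambda> * r) \<subseteq> \<Omega> \<longrightarrow>
        (\<exists>c. (\<integral>\<^sup>+y. ennreal \<bar>w y - c\<bar> * indicator (ball x r) y \<partial>M)
             \<le> ennreal (CP * r) * (\<integral>\<^sup>+y. h y * indicator (ball x (\<Lambda> * r)) y \<partial>M)))"

lemma ennreal_osc:
  "ennreal (osc c x) = (\<integral>\<^sup>+y. ennreal \<bar>w y - c\<bar> * indicator (ball x (bdist x / (4 * \<Lambda>))) y \<partial>M)"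
proof -
  have "integrable M (\<lambda>y. \<bar>w y - c\<bar> * \<bar>indicator (ball x (bdist x / (4 * \<Lambda>))) y\<bar>)"
    by (rule integrable_w_ball(3)[of _ 1 x "bdist x / (4 * \<Lambda>)"]) auto
  then have "ennreal (osc c x) = (\<integral>\<^sup>+y. ennreal (\<bar>w y - c\<bar> * indicator (ball x (bdist x / (4 * \<Lambda>))) y) \<partial>M)"
    unfolding osc_def by (subst nn_integral_eq_integral) auto
  also have "\<dots> = (\<integral>\<^sup>+y. ennreal \<bar>w y - c\<bar> * indicator (ball x (bdist x / (4 * \<Lambda>))) y \<partial>M)"
    by (intro nn_integral_cong) (auto simp: indicator_def)
  finally show ?thesis .
qed

lemma osc_le:
  assumes lp: "local_poincare CP h" and x: "x \<in> \<Omega>"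
  shows "\<exists>c. ennreal (osc c x)
    \<le> ennreal (CP * bdist x / (4 * \<Lambda>)) * (\<integral>\<^sup>+y. h y * indicator (ball x (bdist x / 4)) y \<partial>M)"
proof -
  have b: "0 < bdist x" using x by (simp add: bdist_pos_iff)
  let ?r = "bdist x / (4 * \<Lambda>)"
  have r: "0 < ?r" "2 * \<Lambda> * ?r = bdist x / 2" "\<Lambda> * ?r = bdist x / 4" using b \<Lambda> by auto
  have "ball x (bdist x / 2) \<subseteq> \<Omega>" using b by (intro ball_bdist_subset) auto
  then obtain c where c: "(\<integral>\<^sup>+y. ennreal \<bar>w y - c\<bar> * indicator (ball x ?r) y \<partial>M)
      \<le> ennreal (CP * ?r) * (\<integral>\<^sup>+y. h y * indicator (ball x (bdist x / 4)) y \<partial>M)"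
    using lp[unfolded local_poincare_def, THEN conjunct2, THEN conjunct2, rule_format, of ?r x]
    unfolding r(2,3) using r(1) by auto
  then show ?thesis by (intro exI[of _ c]) (simp add: ennreal_osc)
qed

lemma smooth_diff_avg:
  assumes lp: "local_poincare CP h" and x: "x \<in> \<Omega>" and x': "dist x x' \<le> \<delta> * bdist x"
    and z: "dist z x \<le> A * bdist x" and A: "0 \<le> A"
  shows "ennreal \<bar>smooth x - smooth x'\<bar> \<le> ennreal (216 * K\<^sup>2 * CP * Cd * dist x x') * avg (2 * A + 1) h z"
proof -
  have b: "0 < bdist x" using x by (simp add: bdist_pos_iff)
  have v: "0 < vol x" using x by (rule vol_pos)
  have CP: "0 < CP" and [measurable]: "h \<in> borel_measurable M" using lp by (auto simp: local_poincare_def)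
  obtain c where c: "ennreal (osc c x)
    \<le> ennreal (CP * bdist x / (4 * \<Lambda>)) * (\<integral>\<^sup>+y. h y * indicator (ball x (bdist x / 4)) y \<partial>M)"
    using osc_le[OF lp x] by blast
  let ?C = "72 * K\<^sup>2 / (\<delta> * bdist x * vol x) * dist x x'"
  have C: "0 \<le> ?C" using b v \<delta> by simp
  have "ennreal \<bar>smooth x - smooth x'\<bar> \<le> ennreal (?C * osc c x)"
    by (intro ennreal_leI smooth_diff x x')
  also have "\<dots> = ennreal ?C * ennreal (osc c x)"
    using C osc_nonneg by (rule ennreal_mult)
  also have "\<dots> \<le> ennreal ?C * (ennreal (CP * bdist x / (4 * \<Lambda>)) * (ennreal (Cd * vol x) * avg (2 * A + 1) h z))"
    using nn_integral_ball_le_avg[OF _ x z A, of h]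
    by (intro mult_left_mono order_trans[OF c]) auto
  also have "\<dots> = ennreal (?C * (CP * bdist x / (4 * \<Lambda>)) * (Cd * vol x)) * avg (2 * A + 1) h z"
    using C CP b v Cd \<Lambda> by (intro ennreal_mult3) auto
  also have "?C * (CP * bdist x / (4 * \<Lambda>)) * (Cd * vol x) = 216 * K\<^sup>2 * CP * Cd * dist x x'"
    using b v \<Lambda> by (simp add: \<delta>_def field_simps)
  finally show ?thesis .
qed

lemma smooth_le_avg:
  assumes x: "x \<in> \<Omega>"
  shows "ennreal \<bar>smooth x\<bar> \<le> ennreal (8 * K * Cd) * avg 1 (\<lambda>y. ennreal \<bar>w y\<bar>) x"
proof -
  have b: "0 < bdist x" using x by (simp add: bdist_pos_iff)
  have v: "0 < vol x" using x by (rule vol_pos)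
  have "dist x x \<le> \<delta> * bdist x" using b \<delta> by simp
  then have "ennreal \<bar>smooth x\<bar> \<le> ennreal (8 * K / vol x * osc 0 x)"
    using smooth_dev[OF x, of x 0] by (intro ennreal_leI) simp
  also have "\<dots> = ennreal (8 * K / vol x) * ennreal (osc 0 x)"
    using K v osc_nonneg by (intro ennreal_mult) auto
  also have "\<dots> \<le> ennreal (8 * K / vol x) * (ennreal (Cd * vol x) * avg (2 * 0 + 1) (\<lambda>y. ennreal \<bar>w y\<bar>) x)"
  proof (intro mult_left_mono)
    have "ball x (bdist x / (4 * \<Lambda>)) \<subseteq> ball x (bdist x / 4)"
      using b \<Lambda> by (intro subset_ball) (simp add: field_simps)
    then have "ennreal (osc 0 x) \<le> (\<integral>\<^sup>+y. ennreal \<bar>w y\<bar> * indicator (ball x (bdist x / 4)) y \<partial>M)"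
      unfolding ennreal_osc by (intro nn_integral_mono) (auto simp: indicator_def)
    also have "\<dots> \<le> ennreal (Cd * vol x) * avg (2 * 0 + 1) (\<lambda>y. ennreal \<bar>w y\<bar>) x"
      by (intro nn_integral_ball_le_avg x) auto
    finally show "ennreal (osc 0 x) \<le> ennreal (Cd * vol x) * avg (2 * 0 + 1) (\<lambda>y. ennreal \<bar>w y\<bar>) x" .
  qed auto
  also have "\<dots> = ennreal (8 * K / vol x * (Cd * vol x)) * avg 1 (\<lambda>y. ennreal \<bar>w y\<bar>) x"
    using K v Cd by (subst ennreal_mult) (auto simp: mult.assoc)
  also have "8 * K / vol x * (Cd * vol x) = 8 * K * Cd" using v by simp
  finally show ?thesis .
qed

lemma Lip_loc_smooth: "Lip_loc \<Omega> smooth"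
  unfolding Lip_loc_def
proof (intro allI impI)
  fix U assume U: "compactly_inside U \<Omega>"
  show "\<exists>L. L-lipschitz_on U smooth"
  proof (cases "U = {}")
    case True
    then show ?thesis by (auto intro!: exI[of _ 0])
  next
    case False
    then obtain p where p: "p \<in> U" by auto
    have cpt: "compact (closure U)" and sub: "closure U \<subseteq> \<Omega>"
      using U by (auto simp: compactly_inside_def)
    have "continuous_on (closure U) bdist"
      unfolding bdist_def by (intro continuous_intros)
    then obtain q where q: "q \<in> closure U" "\<And>x. x \<in> closure U \<Longrightarrow> bdist q \<le> bdist x"
      using continuous_attains_inf[OF cpt, of bdist] p closure_subset by blast
    define m where "m = bdist q"
    have m: "0 < m" "\<And>x. x \<in> U \<Longrightarrow> m \<le> bdist x"
      using q sub closure_subset[of U] by (auto simp: m_def bdist_pos_iff)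
    have "bounded U" using compact_imp_bounded[OF cpt] by (rule bounded_subset) (rule closure_subset)
    then obtain B where B: "\<And>x. x \<in> U \<Longrightarrow> dist p x \<le> B" unfolding bounded_def using bounded_any_center[of U p] \<open>bounded U\<close> by auto
    obtain k where k: "(B + 1) / m < 2 ^ k" using real_arch_pow[of 2] by auto
    define V where "V = measure M (ball p 1) / Cd ^ k"
    have V: "0 < V" using measure_ball_pos[of 1 p] Cd by (simp add: V_def)
    have vol: "V \<le> vol x" if x: "x \<in> U" for x
    proof -
      have "dist x p + 1 \<le> 2 ^ k * m" using B[OF x] k m by (simp add: field_simps dist_commute)
      also have "\<dots> \<le> 2 ^ k * bdist x" using m(2)[OF x] by simp
      finally have "measure M (ball p 1) \<le> Cd ^ k * vol x"
        unfolding vol_def using m x by (intro measure_ball_le) force+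
      then show ?thesis using Cd by (simp add: V_def field_simps)
    qed
    define W where "W = (\<integral>y. \<bar>w y\<bar> \<partial>M)"
    have W: "0 \<le> W" unfolding W_def by simp
    have osc: "osc 0 x \<le> W" for x
      unfolding osc_def W_def using w
    proof (intro integral_mono)
      show "integrable M (\<lambda>y. \<bar>w y - 0\<bar> * indicator (ball x (bdist x / (4 * \<Lambda>))) y)"
        using w by (intro integrable_real_mult_indicator) auto
    qed (auto simp: indicator_def)
    define L where "L = max (72 * K\<^sup>2 / (\<delta> * m * V) * W) (2 * (8 * K / V * W) / (\<delta> * m))"
    have far: "\<bar>smooth x\<bar> \<le> 8 * K / V * W" if x: "x \<in> U" for x
    proof -
      have x': "x \<in> \<Omega>" using x sub closure_subset by auto
      have "dist x x \<le> \<delta> * bdist x" using x' \<delta> bdist_pos_iff[of x] by simp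
      then have "\<bar>smooth x\<bar> \<le> 8 * K / vol x * osc 0 x"
        using smooth_dev[OF x', of x 0] by simp
      also have "\<dots> \<le> 8 * K / V * W"
        using vol[OF x] osc osc_nonneg K V W by (intro mult_mono divide_left_mono) auto
      finally show ?thesis .
    qed
    have "L-lipschitz_on U smooth"
    proof (rule lipschitz_onI)
      show "0 \<le> L" using K m V W \<delta> by (auto simp: L_def intro!: max.coboundedI1)
      fix x y assume xy: "x \<in> U" "y \<in> U"
      have x': "x \<in> \<Omega>" using xy sub closure_subset by auto
      show "dist (smooth x) (smooth y) \<le> L * dist x y"
      proof (cases "dist x y \<le> \<delta> * m")
        case True
        moreover have "\<delta> * m \<le> \<delta> * bdist x" using m(2)[OF xy(1)] \<delta> by simp
        ultimately have "\<bar>smooth x - smooth y\<bar> \<le> 72 * K\<^sup>2 / (\<delta> * bdist x * vol x) * dist x y * osc 0 x"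
          by (intro smooth_diff x') linarith
        also have "\<dots> \<le> 72 * K\<^sup>2 / (\<delta> * m * V) * dist x y * W"
        proof (intro mult_mono divide_left_mono mult_pos_pos)
          show "0 < bdist x" "0 < vol x" using x' vol_pos by (auto simp: bdist_pos_iff)
          show "0 \<le> \<delta> * bdist x"
            using mult_pos_pos[OF \<delta>(1) m(1)] \<open>\<delta> * m \<le> \<delta> * bdist x\<close> by linarith
        qed (use vol[OF xy(1)] m xy osc osc_nonneg K V W \<delta> in auto)
        also have "\<dots> = (72 * K\<^sup>2 / (\<delta> * m * V) * W) * dist x y" by (simp only: ac_simps)
        also have "\<dots> \<le> L * dist x y" unfolding L_def by (intro mult_right_mono) auto
        finally show ?thesis by (simp add: dist_real_def)
      next
        case False
        have "\<bar>smooth x - smooth y\<bar> \<le> 2 * (8 * K / V * W)"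
          using far[OF xy(1)] far[OF xy(2)] by linarith
        also have "\<dots> = 2 * (8 * K / V * W) / (\<delta> * m) * (\<delta> * m)" using \<delta> m by simp
        also have "\<dots> \<le> 2 * (8 * K / V * W) / (\<delta> * m) * dist x y"
          using False \<delta> m K V W by (intro mult_left_mono) auto
        also have "\<dots> \<le> L * dist x y" unfolding L_def by (intro mult_right_mono) auto
        finally show ?thesis by (simp add: dist_real_def)
      qed
    qed
    then show ?thesis by blast
  qed
qed

lemma smooth_along_curve:
  assumes lp: "local_poincare CP h" and c: "0 < c" and L: "0 \<le> L"
    and \<gamma>: "\<And>s t. s \<in> {0..L} \<Longrightarrow> t \<in> {0..L} \<Longrightarrow> dist (\<gamma> s) (\<gamma> t) \<le> \<bar>s - t\<bar>"
    and in\<Omega>: "\<And>t. t \<in> {0..L} \<Longrightarrow> \<gamma> t \<in> \<Omega>"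
    and far: "\<And>t. t \<in> {0..L} \<Longrightarrow> c * t \<le> bdist (\<gamma> t)"
  shows "ennreal \<bar>smooth (\<gamma> 0) - smooth (\<gamma> L)\<bar> \<le> ennreal (216 * K\<^sup>2 * CP * Cd * L) * avg (2 / c + 1) h (\<gamma> 0)"
proof -
  let ?H = "avg (2 / c + 1) h (\<gamma> 0)" and ?C = "216 * K\<^sup>2 * CP * Cd"
  have CP: "0 < CP" using lp by (auto simp: local_poincare_def)
  then have C: "0 < ?C" using K Cd by simp
  consider "L = 0" | "0 < L" "?H = \<infinity>" | "0 < L" "?H < \<infinity>" using L by (fastforce simp: less_top)
  then show ?thesis
  proof cases
    case 2
    have "ennreal (?C * L) \<noteq> 0" using C 2(1) by (simp only: ennreal_eq_0_iff not_le mult_pos_pos)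
    then have "ennreal (?C * L) * ?H = \<infinity>" unfolding 2(2) by (simp only: ennreal_mult_top infinity_ennreal_def if_False)
    then show ?thesis by simp
  next
    case 3
    then obtain H where H: "?H = ennreal H" "0 \<le> H" by (cases ?H) auto
    have loc: "\<bar>smooth (\<gamma> s) - smooth (\<gamma> t)\<bar> \<le> ?C * H * \<bar>s - t\<bar>"
      if s: "s \<in> {0..L}" and t: "t \<in> {0..L}" and st: "\<bar>s - t\<bar> \<le> \<delta> * bdist (\<gamma> s)" for s t
    proof -
      have "dist (\<gamma> 0) (\<gamma> s) \<le> s" using \<gamma>[of 0 s] s L by auto
      also have "s \<le> (1/c) * bdist (\<gamma> s)" using far[OF s] c by (simp add: field_simps)
      finally have "ennreal \<bar>smooth (\<gamma> s) - smooth (\<gamma> t)\<bar>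
          \<le> ennreal (?C * dist (\<gamma> s) (\<gamma> t)) * avg (2 * (1 / c) + 1) h (\<gamma> 0)"
        using c order_trans[OF \<gamma>[OF s t] st] by (intro smooth_diff_avg[OF lp] in\<Omega>[OF s]) auto
      also have "\<dots> = ennreal (?C * dist (\<gamma> s) (\<gamma> t) * H)"
        using C H by (simp add: ennreal_mult)
      also have "\<dots> \<le> ennreal (?C * \<bar>s - t\<bar> * H)"
        using \<gamma>[OF s t] C H by (intro ennreal_leI mult_right_mono mult_left_mono) auto
      finally have "\<bar>smooth (\<gamma> s) - smooth (\<gamma> t)\<bar> \<le> ?C * \<bar>s - t\<bar> * H"
        using C H by (subst (asm) ennreal_le_iff) (auto simp del: ennreal_le_iff)
      then show ?thesis by (simp only: ac_simps)
    qed
    have pos: "0 < \<delta> * bdist (\<gamma> s)" if "s \<in> {0..L}" for s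
      using in\<Omega>[OF that] \<delta> by (simp add: bdist_pos_iff)
    have "(?C * H)-lipschitz_on {0..L} (\<lambda>t. smooth (\<gamma> t))"
    proof (rule locally_lipschitz_imp_lipschitz)
      show "continuous_on {0..L} (\<lambda>t. smooth (\<gamma> t))"
        unfolding continuous_on_iff
      proof (intro ballI allI impI)
        fix s and e :: real assume s: "s \<in> {0..L}" and e: "0 < e"
        let ?d = "min (\<delta> * bdist (\<gamma> s)) (e / (?C * H + 1))"
        have "0 < ?C * H + 1" using C H by (simp add: add_nonneg_pos)
        then have "0 < ?d" using pos[OF s] e by simp
        moreover have "dist (smooth (\<gamma> t)) (smooth (\<gamma> s)) < e" if t: "t \<in> {0..L}" "dist t s < ?d" for t
        proof -
          have d: "\<bar>s - t\<bar> \<le> \<delta> * bdist (\<gamma> s)" "\<bar>s - t\<bar> < e / (?C * H + 1)"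
            using t(2) by (auto simp: dist_real_def)
          have "\<bar>smooth (\<gamma> s) - smooth (\<gamma> t)\<bar> \<le> ?C * H * \<bar>s - t\<bar>" by (rule loc[OF s t(1) d(1)])
          also have "\<dots> \<le> (?C * H + 1) * \<bar>s - t\<bar>" by (intro mult_right_mono) auto
          also have "\<dots> < e" using d(2) \<open>0 < ?C * H + 1\<close> by (simp add: field_simps)
          finally show ?thesis by (simp add: dist_real_def abs_minus_commute)
        qed
        ultimately show "\<exists>d>0. \<forall>t\<in>{0..L}. dist t s < d \<longrightarrow> dist (smooth (\<gamma> t)) (smooth (\<gamma> s)) < e"
          by blast
      qed
      show "0 \<le> ?C * H" using C H by simp
      fix s y assume s: "s \<in> {0..<L}" and y: "s < y"
      define z where "z = min y (min L (s + \<delta> * bdist (\<gamma> s)))"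
      have z: "s < z" "z \<le> y" "z \<le> L" "z \<le> s + \<delta> * bdist (\<gamma> s)" using y s pos[of s] by (auto simp: z_def)
      then have "\<bar>smooth (\<gamma> s) - smooth (\<gamma> z)\<bar> \<le> ?C * H * \<bar>s - z\<bar>" using s by (intro loc) auto
      with z show "\<exists>z\<in>{s<..y}. dist (smooth (\<gamma> z)) (smooth (\<gamma> s)) \<le> ?C * H * (z - s)"
        by (intro bexI[of _ z]) (auto simp: dist_real_def abs_minus_commute)
    qed
    then have "\<bar>smooth (\<gamma> 0) - smooth (\<gamma> L)\<bar> \<le> ?C * H * L"
      using L lipschitz_onD[of "?C * H" "{0..L}" "\<lambda>t. smooth (\<gamma> t)" 0 L] by (simp add: dist_real_def)
    then have "ennreal \<bar>smooth (\<gamma> 0) - smooth (\<gamma> L)\<bar> \<le> ennreal (?C * L * H)"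
      by (intro ennreal_leI) (simp add: ac_simps)
    also have "\<dots> = ennreal (?C * L) * ?H" using C L H by (simp add: ennreal_mult)
    finally show ?thesis .
  qed simp
qed

definition near :: "real \<Rightarrow> 'a \<Rightarrow> 'a \<Rightarrow> ennreal" where
  "near a p z = (if p \<in> \<Omega> \<and> dist p z < a * bdist p then ennreal (1 / vol p) else 0)"

lemma near_measurable [measurable (raw)]:
  assumes [measurable]: "f \<in> measurable N M" "g \<in> measurable N M"
  shows "(\<lambda>x. near a (f x) (g x)) \<in> borel_measurable N"
  unfolding near_def by measurable

lemma nn_integral_near_ge:
  assumes z: "z \<in> \<Omega>"
  shows "1 \<le> ennreal K * (\<integral>\<^sup>+p. near \<delta> p z \<partial>M)"
proof -
  let ?r = "\<delta> * bdist z / 2"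
  have b: "0 < bdist z" using z by (simp add: bdist_pos_iff)
  have r: "0 < ?r" using b \<delta> by simp
  let ?V = "measure M (ball z ?r)"
  have V: "0 < ?V" using r by (rule measure_ball_pos)
  have ge: "ennreal (1 / (K * ?V)) * indicator (ball z ?r) p \<le> near \<delta> p z" for p
  proof (cases "p \<in> ball z ?r")
    case True
    then have zp: "dist z p \<le> \<delta> * bdist z" "dist z p < ?r" using r by auto
    note nb = near_bdist[OF z zp(1)]
    have p: "p \<in> \<Omega>" using nb by (simp add: bdist_pos_iff)
    have "\<delta> * bdist z \<le> \<delta> * (2 * bdist p)" using nb \<delta> by (intro mult_left_mono) auto
    then have d: "dist p z < \<delta> * bdist p" using zp(2) by (simp add: dist_commute)
    have "\<delta> * bdist z \<le> 1 * bdist z" using \<delta> b by (intro mult_right_mono) auto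
    then have "dist z p + bdist p \<le> 3 * bdist z" using nb zp by linarith
    also have "\<dots> = 72 * \<Lambda> * ?r" using \<Lambda> by (simp add: \<delta>_def)
    also have "\<dots> \<le> 2 ^ nat \<lceil>100 * \<Lambda>\<rceil> * ?r" using two_power_ge \<Lambda> r by (intro mult_right_mono) auto
    finally have "vol p \<le> K * ?V"
      unfolding K_def by (intro vol_le r)
    then have "1 / (K * ?V) \<le> 1 / vol p" using vol_pos[OF p] K V by (intro divide_left_mono) auto
    then show ?thesis using p d True by (auto simp: near_def intro: ennreal_leI)
  qed simp
  have "1 = ennreal (K * (1 / (K * ?V)) * ?V)" using K V by simp
  also have "\<dots> = ennreal K * (ennreal (1 / (K * ?V)) * emeasure M (ball z ?r))"
    using K V unfolding emeasure_ball by (simp flip: ennreal_mult)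
  also have "\<dots> = ennreal K * (\<integral>\<^sup>+p. ennreal (1 / (K * ?V)) * indicator (ball z ?r) p \<partial>M)"
    by (simp add: nn_integral_cmult_indicator)
  also have "\<dots> \<le> ennreal K * (\<integral>\<^sup>+p. near \<delta> p z \<partial>M)"
    using ge by (intro mult_left_mono nn_integral_mono) auto
  finally show ?thesis .
qed

lemma nn_integral_near_le: "(\<integral>\<^sup>+p. near (1/4) p y \<partial>M) \<le> ennreal Cd"
proof (cases "y \<in> \<Omega>")
  case True
  have "near (1/4) p y \<le> ennreal (Cd / vol y) * indicator (ball y (bdist y)) p" for p
  proof (cases "p \<in> \<Omega> \<and> dist p y < bdist p / 4")
    case t: True
    then have p: "p \<in> \<Omega>" "dist p y < bdist p / 4" by auto
    note c = vol_comparable[OF p]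
    have "dist y p < bdist y" using p c(4) bdist_pos_iff[of p] by (simp add: dist_commute)
    moreover have "1 / vol p \<le> Cd / vol y"
      using c(2) vol_pos[OF p(1)] vol_pos[OF c(1)] by (simp add: field_simps)
    ultimately show ?thesis using p by (auto simp: near_def intro: ennreal_leI)
  qed (auto simp: near_def)
  then have "(\<integral>\<^sup>+p. near (1/4) p y \<partial>M) \<le> (\<integral>\<^sup>+p. ennreal (Cd / vol y) * indicator (ball y (bdist y)) p \<partial>M)"
    by (intro nn_integral_mono)
  also have "\<dots> = ennreal (Cd / vol y) * ennreal (vol y)"
    by (simp add: nn_integral_cmult_indicator emeasure_ball vol_def)
  also have "\<dots> = ennreal Cd" using vol_pos[OF True] Cd by (simp flip: ennreal_mult)
  finally show ?thesis .
next
  case False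
  then have "near (1/4) p y = 0" for p
    using vol_comparable(1)[of p y] by (auto simp: near_def)
  then show ?thesis by simp
qed

lemma smooth_dev_ball:
  assumes lp: "local_poincare CP h" and p: "p \<in> \<Omega>"
  shows "(\<integral>\<^sup>+z. ennreal \<bar>smooth z - w z\<bar> * indicator (ball p (\<delta> * bdist p)) z \<partial>M)
    \<le> ennreal (9 * K * CP * bdist p) * (\<integral>\<^sup>+y. h y * indicator (ball p (bdist p / 4)) y \<partial>M)"
proof -
  let ?B = "ball p (bdist p / (4 * \<Lambda>))"
  have b: "0 < bdist p" using p by (simp add: bdist_pos_iff)
  have v: "0 < vol p" using p by (rule vol_pos)
  have CP: "0 < CP" using lp by (auto simp: local_poincare_def)
  obtain c where c: "ennreal (osc c p)
    \<le> ennreal (CP * bdist p / (4 * \<Lambda>)) * (\<integral>\<^sup>+y. h y * indicator (ball p (bdist p / 4)) y \<partial>M)"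
    using osc_le[OF lp p] by blast
  have sub: "ball p (\<delta> * bdist p) \<subseteq> ?B" "?B \<subseteq> ball p (bdist p)"
    using b \<Lambda> by (auto intro!: subset_ball simp: \<delta>_def field_simps)
  have o: "0 \<le> 8 * K / vol p * osc c p" using osc_nonneg K v by simp
  have "ennreal \<bar>smooth z - w z\<bar> * indicator (ball p (\<delta> * bdist p)) z
      \<le> ennreal \<bar>w z - c\<bar> * indicator ?B z + ennreal (8 * K / vol p * osc c p) * indicator ?B z" for z
  proof (cases "z \<in> ball p (\<delta> * bdist p)")
    case True
    then have "\<bar>smooth z - c\<bar> \<le> 8 * K / vol p * osc c p" by (intro smooth_dev p) auto
    then have "\<bar>smooth z - w z\<bar> \<le> \<bar>w z - c\<bar> + 8 * K / vol p * osc c p" by linarith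
    then have "ennreal \<bar>smooth z - w z\<bar> \<le> ennreal (\<bar>w z - c\<bar> + 8 * K / vol p * osc c p)"
      by (rule ennreal_leI)
    also have "\<dots> = ennreal \<bar>w z - c\<bar> + ennreal (8 * K / vol p * osc c p)"
      using o by (intro ennreal_plus) auto
    finally have "ennreal \<bar>smooth z - w z\<bar> \<le> ennreal \<bar>w z - c\<bar> + ennreal (8 * K / vol p * osc c p)" .
    then show ?thesis using True sub by auto
  qed simp
  then have "(\<integral>\<^sup>+z. ennreal \<bar>smooth z - w z\<bar> * indicator (ball p (\<delta> * bdist p)) z \<partial>M)
    \<le> (\<integral>\<^sup>+z. ennreal \<bar>w z - c\<bar> * indicator ?B z + ennreal (8 * K / vol p * osc c p) * indicator ?B z \<partial>M)"
    by (intro nn_integral_mono)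
  also have "\<dots> = ennreal (osc c p) + ennreal (8 * K / vol p * osc c p) * emeasure M ?B"
    by (subst nn_integral_add) (auto simp: ennreal_osc nn_integral_cmult_indicator)
  also have "\<dots> \<le> ennreal (osc c p) + ennreal (8 * K / vol p * osc c p) * ennreal (vol p)"
    unfolding vol_def emeasure_ball[symmetric] using sub
    by (intro add_left_mono mult_left_mono emeasure_mono) auto
  also have "\<dots> = ennreal (osc c p + 8 * K / vol p * osc c p * vol p)"
    unfolding ennreal_mult''[OF less_imp_le[OF v], symmetric]
    using o v osc_nonneg[of c p] by (intro ennreal_plus[symmetric] mult_nonneg_nonneg[OF o]) auto
  also have "osc c p + 8 * K / vol p * osc c p * vol p = (1 + 8 * K) * osc c p"
    using v by (simp add: distrib_right)
  also have "\<dots> \<le> ennreal (9 * K * osc c p)"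
    using K osc_nonneg by (intro ennreal_leI mult_right_mono) auto
  also have "\<dots> = ennreal (9 * K) * ennreal (osc c p)"
    using K osc_nonneg by (intro ennreal_mult) auto
  also have "\<dots> \<le> ennreal (9 * K) * (ennreal (CP * bdist p) * (\<integral>\<^sup>+y. h y * indicator (ball p (bdist p / 4)) y \<partial>M))"
  proof (intro mult_left_mono order_trans[OF c] mult_right_mono ennreal_leI)
    have "CP * bdist p * 1 \<le> CP * bdist p * (4 * \<Lambda>)" using CP b \<Lambda> by (intro mult_left_mono) auto
    then show "CP * bdist p / (4 * \<Lambda>) \<le> CP * bdist p" using \<Lambda> by (simp add: field_simps)
  qed auto
  also have "\<dots> = ennreal (9 * K * CP * bdist p) * (\<integral>\<^sup>+y. h y * indicator (ball p (bdist p / 4)) y \<partial>M)"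
    using K CP b by (simp add: ennreal_mult mult.assoc)
  finally show ?thesis .
qed

text \<open>The differences on balls of radius comparable to the distance to the boundary are averaged
  over the centres \<open>p\<close>; this replaces a Whitney covering.\<close>

lemma smooth_trace:
  assumes lp: "local_poincare CP h" and x: "x \<notin> \<Omega>" and r: "0 < r"
  shows "(\<integral>\<^sup>+z. ennreal \<bar>smooth z - w z\<bar> * indicator (ball x r \<inter> \<Omega>) z \<partial>M)
    \<le> ennreal (18 * K\<^sup>2 * CP * Cd * r) * (\<integral>\<^sup>+y. h y * indicator (ball x (3 * r) \<inter> \<Omega>) y \<partial>M)"
proof -
  have CP: "0 < CP" and [measurable]: "h \<in> borel_measurable M" using lp by (auto simp: local_poincare_def)
  let ?S = "ball x r \<inter> \<Omega>" and ?T = "ball x (3 * r) \<inter> \<Omega>"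
  let ?F = "\<lambda>z. ennreal \<bar>smooth z - w z\<bar> * indicator ?S z"
  have "(\<integral>\<^sup>+z. ?F z \<partial>M) \<le> (\<integral>\<^sup>+z. ennreal K * (\<integral>\<^sup>+p. ?F z * near \<delta> p z \<partial>M) \<partial>M)"
  proof (rule nn_integral_mono)
    fix z
    have "?F z * 1 \<le> ?F z * (ennreal K * (\<integral>\<^sup>+p. near \<delta> p z \<partial>M))"
    proof (cases "z \<in> \<Omega>")
      case True
      then show ?thesis by (intro mult_left_mono nn_integral_near_ge) auto
    qed simp
    also have "\<dots> = ennreal K * (\<integral>\<^sup>+p. ?F z * near \<delta> p z \<partial>M)"
      by (subst nn_integral_cmult) (auto simp: ac_simps)
    finally show "?F z \<le> ennreal K * (\<integral>\<^sup>+p. ?F z * near \<delta> p z \<partial>M)" by simp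
  qed
  also have "\<dots> = ennreal K * (\<integral>\<^sup>+z. \<integral>\<^sup>+p. ?F z * near \<delta> p z \<partial>M \<partial>M)"
    by (rule nn_integral_cmult) measurable
  also have "(\<integral>\<^sup>+z. \<integral>\<^sup>+p. ?F z * near \<delta> p z \<partial>M \<partial>M) = (\<integral>\<^sup>+p. \<integral>\<^sup>+z. ?F z * near \<delta> p z \<partial>M \<partial>M)"
    by (rule nn_integral_swap) measurable
  also have "\<dots> \<le> (\<integral>\<^sup>+p. ennreal (18 * K * CP * r) * (\<integral>\<^sup>+y. h y * indicator ?T y * near (1/4) p y \<partial>M) \<partial>M)"
  proof (rule nn_integral_mono)
    fix p
    show "(\<integral>\<^sup>+z. ?F z * near \<delta> p z \<partial>M) \<le> ennreal (18 * K * CP * r) * (\<integral>\<^sup>+y. h y * indicator ?T y * near (1/4) p y \<partial>M)"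
    proof (cases "p \<in> \<Omega> \<and> dist x p < 2 * r")
      case True
      then have p: "p \<in> \<Omega>" and xp: "dist x p < 2 * r" by auto
      have b: "0 < bdist p" "bdist p \<le> 2 * r" using p xp bdist_le_dist[OF x, of p] by (auto simp: bdist_pos_iff)
      have v: "0 < vol p" using p by (rule vol_pos)
      have "(\<integral>\<^sup>+z. ?F z * near \<delta> p z \<partial>M)
          \<le> (\<integral>\<^sup>+z. ennreal (1 / vol p) * (ennreal \<bar>smooth z - w z\<bar> * indicator (ball p (\<delta> * bdist p)) z) \<partial>M)"
        by (intro nn_integral_mono) (auto simp: near_def indicator_def mult.commute)
      also have "\<dots> = ennreal (1 / vol p) * (\<integral>\<^sup>+z. ennreal \<bar>smooth z - w z\<bar> * indicator (ball p (\<delta> * bdist p)) z \<partial>M)"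
        by (rule nn_integral_cmult) measurable
      also have "\<dots> \<le> ennreal (1 / vol p) * (ennreal (18 * K * CP * r) * (\<integral>\<^sup>+y. h y * indicator (ball p (bdist p / 4)) y \<partial>M))"
        using b K CP by (intro mult_left_mono order_trans[OF smooth_dev_ball[OF lp p]] mult_right_mono ennreal_leI) auto
      also have "\<dots> = ennreal (18 * K * CP * r) * (\<integral>\<^sup>+y. ennreal (1 / vol p) * (h y * indicator (ball p (bdist p / 4)) y) \<partial>M)"
        by (subst nn_integral_cmult) (auto simp: ac_simps)
      also have "\<dots> \<le> ennreal (18 * K * CP * r) * (\<integral>\<^sup>+y. h y * indicator ?T y * near (1/4) p y \<partial>M)"
      proof (intro mult_left_mono nn_integral_mono)
        fix y
        show "ennreal (1 / vol p) * (h y * indicator (ball p (bdist p / 4)) y) \<le> h y * indicator ?T y * near (1/4) p y"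
        proof (cases "dist p y < bdist p / 4")
          case True
          have "y \<in> \<Omega>" using vol_comparable(1)[OF p True] .
          moreover have "dist x y < 3 * r" using dist_triangle[of x y p] xp True b r by linarith
          ultimately show ?thesis using True p by (simp add: near_def mult.commute)
        qed simp
      qed auto
      finally show ?thesis .
    next
      case False
      have "?F z * near \<delta> p z = 0" for z
      proof (rule ccontr)
        assume "?F z * near \<delta> p z \<noteq> 0"
        then have z: "dist x z < r" "p \<in> \<Omega>" "dist p z < \<delta> * bdist p"
          by (auto simp: near_def indicator_def split: if_splits)
        have "\<delta> * bdist p \<le> 1/12 * dist x p"
          using \<delta> bdist_le_dist[OF x, of p] z(2) bdist_pos_iff[of p] by (intro mult_mono) auto
        then show False using False z r dist_triangle[of x p z] by (simp add: dist_commute)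
      qed
      then have "(\<integral>\<^sup>+z. ?F z * near \<delta> p z \<partial>M) = (\<integral>\<^sup>+z. 0 \<partial>M)" by (intro nn_integral_cong)
      then show ?thesis by simp
    qed
  qed
  also have "\<dots> = ennreal (18 * K * CP * r) * (\<integral>\<^sup>+p. \<integral>\<^sup>+y. h y * indicator ?T y * near (1/4) p y \<partial>M \<partial>M)"
    by (rule nn_integral_cmult) measurable
  also have "(\<integral>\<^sup>+p. \<integral>\<^sup>+y. h y * indicator ?T y * near (1/4) p y \<partial>M \<partial>M)
      = (\<integral>\<^sup>+y. \<integral>\<^sup>+p. h y * indicator ?T y * near (1/4) p y \<partial>M \<partial>M)"
    by (rule nn_integral_swap) measurable
  also have "\<dots> \<le> (\<integral>\<^sup>+y. ennreal Cd * (h y * indicator ?T y) \<partial>M)"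
  proof (rule nn_integral_mono)
    fix y
    have "(\<integral>\<^sup>+p. h y * indicator ?T y * near (1/4) p y \<partial>M) = h y * indicator ?T y * (\<integral>\<^sup>+p. near (1/4) p y \<partial>M)"
      by (rule nn_integral_cmult) measurable
    also have "\<dots> \<le> h y * indicator ?T y * ennreal Cd"
      by (intro mult_left_mono nn_integral_near_le) auto
    finally show "(\<integral>\<^sup>+p. h y * indicator ?T y * near (1/4) p y \<partial>M) \<le> ennreal Cd * (h y * indicator ?T y)"
      by (simp add: mult.commute)
  qed
  also have "\<dots> = ennreal Cd * (\<integral>\<^sup>+y. h y * indicator ?T y \<partial>M)"
    by (rule nn_integral_cmult) measurable
  finally have "(\<integral>\<^sup>+z. ?F z \<partial>M)
      \<le> ennreal K * (ennreal (18 * K * CP * r) * (ennreal Cd * (\<integral>\<^sup>+y. h y * indicator ?T y \<partial>M)))"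
    by (simp add: mult_left_mono)
  also have "\<dots> = ennreal (K * (18 * K * CP * r) * Cd) * (\<integral>\<^sup>+y. h y * indicator ?T y \<partial>M)"
    using K CP r Cd by (simp add: ennreal_mult mult.assoc)
  also have "K * (18 * K * CP * r) * Cd = 18 * K\<^sup>2 * CP * Cd * r" by (simp add: power2_eq_square)
  finally show ?thesis .
qed

end

section \<open>Exceptional sets on the boundary\<close>

lemma divide_ennreal_eq_mult: "0 < t \<Longrightarrow> x / ennreal t = x * ennreal (1 / t)"
  by (simp only: divide_ennreal_def inverse_ennreal inverse_eq_divide)

lemma (in doubling_open) ex_boundary_weight:
  assumes [measurable]: "f \<in> borel_measurable M" and fin: "(\<integral>\<^sup>+y. f y * indicator \<Omega> y \<partial>M) < \<infinity>"
  obtains F and R :: "nat \<Rightarrow> real" where "F \<in> borel_measurable M" "(\<integral>\<^sup>+y. F y \<partial>M) < \<infinity>"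
    "\<And>k. 0 < R k" "\<And>k y. y \<in> \<Omega> \<Longrightarrow> bdist y < R k \<Longrightarrow> 2 ^ k * f y \<le> F y"
proof -
  define U where "U r = {y \<in> \<Omega>. bdist y < r}" for r
  have [measurable]: "U r \<in> sets M" for r
    unfolding U_def by measurable
  have "(\<lambda>n. \<integral>\<^sup>+y. f y * indicator (U (1 / Suc n)) y \<partial>M) \<longlonglongrightarrow> (\<integral>\<^sup>+y. 0 \<partial>M)"
  proof (rule nn_integral_dominated_convergence[where w = "\<lambda>y. f y * indicator \<Omega> y"])
    show "AE y in M. (\<lambda>n. f y * indicator (U (1 / Suc n)) y) \<longlonglongrightarrow> 0"
    proof (rule AE_I2)
      fix y
      show "(\<lambda>n. f y * indicator (U (1 / Suc n)) y) \<longlonglongrightarrow> 0"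
      proof (cases "y \<in> \<Omega>")
        case True
        then have "0 < bdist y" by (simp add: bdist_pos_iff)
        then have "eventually (\<lambda>n. 1 / Suc n < bdist y) sequentially"
          by real_asymp
        then have "eventually (\<lambda>n. f y * indicator (U (1 / Suc n)) y = 0) sequentially"
          by eventually_elim (auto simp: U_def)
        then show ?thesis by (rule tendsto_eventually)
      qed (simp add: U_def)
    qed
  qed (use fin in \<open>auto simp: U_def indicator_def\<close>)
  then have lim: "(\<lambda>n. \<integral>\<^sup>+y. f y * indicator (U (1 / Suc n)) y \<partial>M) \<longlonglongrightarrow> 0" by simp
  have "\<exists>n. (\<integral>\<^sup>+y. f y * indicator (U (1 / Suc n)) y \<partial>M) < ennreal ((1/4) ^ k)" for k
    using order_tendstoD(2)[OF lim, of "ennreal ((1/4) ^ k)"] by (auto simp: eventually_sequentially)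
  then obtain n where n: "\<And>k. (\<integral>\<^sup>+y. f y * indicator (U (1 / Suc (n k))) y \<partial>M) < ennreal ((1/4) ^ k)" by metis
  define R where "R k = 1 / real (Suc (n k))" for k
  define F where "F y = (\<Sum>k. 2 ^ k * (f y * indicator (U (R k)) y))" for y
  show thesis
  proof (rule that[of F R])
    show [measurable]: "F \<in> borel_measurable M" unfolding F_def by measurable
    have "(\<integral>\<^sup>+y. F y \<partial>M) = (\<Sum>k. \<integral>\<^sup>+y. 2 ^ k * (f y * indicator (U (R k)) y) \<partial>M)"
      unfolding F_def by (intro nn_integral_suminf) measurable
    also have "\<dots> \<le> (\<Sum>k. ennreal ((1/2) ^ k))"
    proof (intro suminf_le)
      fix k
      have "(\<integral>\<^sup>+y. 2 ^ k * (f y * indicator (U (R k)) y) \<partial>M) = 2 ^ k * (\<integral>\<^sup>+y. f y * indicator (U (R k)) y \<partial>M)"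
        by (rule nn_integral_cmult) measurable
      also have "\<dots> \<le> ennreal (2 ^ k) * ennreal ((1/4) ^ k)"
        using less_imp_le[OF n[of k]] by (intro mult_mono) (auto simp: R_def simp flip: ennreal_power)
      also have "\<dots> = ennreal ((1/2) ^ k)"
        by (simp flip: ennreal_mult power_mult_distrib)
      finally show "(\<integral>\<^sup>+y. 2 ^ k * (f y * indicator (U (R k)) y) \<partial>M) \<le> ennreal ((1/2) ^ k)" .
    qed auto
    also have "\<dots> < \<infinity>"
      by (subst suminf_ennreal2) (auto intro!: summable_geometric)
    finally show "(\<integral>\<^sup>+y. F y \<partial>M) < \<infinity>" .
    show "0 < R k" for k by (simp add: R_def)
    show "2 ^ k * f y \<le> F y" if "y \<in> \<Omega>" "bdist y < R k" for k y
    proof -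
      have "2 ^ k * f y = (\<Sum>j\<in>{k}. 2 ^ j * (f y * indicator (U (R j)) y))"
        using that by (simp add: U_def)
      also have "\<dots> \<le> F y" unfolding F_def by (intro sum_le_suminf) auto
      finally show ?thesis .
    qed
  qed
qed

lemma (in doubling_space) codim1_content_le:
  assumes \<mu>: "\<And>x r. \<mu> (ball x r) = emeasure M (ball x r)"
    and [measurable]: "F \<in> borel_measurable M" and R: "0 < R"
    and E: "\<And>x. x \<in> E \<Longrightarrow> \<exists>r>0. 15 * r \<le> R \<and>
      of_nat N * emeasure M (ball x r) \<le> ennreal r * (\<integral>\<^sup>+y. F y * indicator (ball x (3 * r)) y \<partial>M)"
  shows "of_nat N * codim1_content \<mu> R E \<le> ennreal (Cd ^ 4) * (\<integral>\<^sup>+y. F y \<partial>M)"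
proof -
  obtain \<rho> where \<rho>: "\<And>x. x \<in> E \<Longrightarrow> 0 < \<rho> x \<and> 15 * \<rho> x \<le> R \<and>
      of_nat N * emeasure M (ball x (\<rho> x)) \<le> ennreal (\<rho> x) * (\<integral>\<^sup>+y. F y * indicator (ball x (3 * \<rho> x)) y \<partial>M)"
    using E by metis
  obtain S where S: "S \<subseteq> E" "disjoint_family_on (\<lambda>x. ball x (3 * \<rho> x)) S"
    "(\<Union>x\<in>E. ball x (3 * \<rho> x)) \<subseteq> (\<Union>x\<in>S. ball x (5 * (3 * \<rho> x)))"
    using \<rho> by (rule_tac five_times_covering[of E "\<lambda>x. 3 * \<rho> x" R]) force+
  have pos: "0 < \<rho> x" if "x \<in> S" for x using that S(1) \<rho> by auto
  have cS: "countable S" using S(2) pos by (intro countable_disjoint_balls) auto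
  define I where "I = to_nat_on S ` S"
  define c where "c = from_nat_into S"
  have c: "c j \<in> S" if "j \<in> I" for j using that cS by (auto simp: I_def c_def)
  have inj: "inj_on c I" using cS by (auto simp: I_def c_def inj_on_def)
  let ?t = "\<lambda>j. \<mu> (ball (c j) (15 * \<rho> (c j))) / ennreal (15 * \<rho> (c j))"
  have cover: "E \<subseteq> (\<Union>j\<in>I. ball (c j) (15 * \<rho> (c j)))"
  proof
    fix x assume x: "x \<in> E"
    then have "x \<in> (\<Union>x\<in>E. ball x (3 * \<rho> x))" using \<rho> by force
    then obtain s where s: "s \<in> S" "x \<in> ball s (5 * (3 * \<rho> s))" using S(3) by blast
    then have "x \<in> ball s (15 * \<rho> s)" by simp
    moreover have "to_nat_on S s \<in> I" "c (to_nat_on S s) = s" using s cS by (auto simp: I_def c_def)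
    ultimately show "x \<in> (\<Union>j\<in>I. ball (c j) (15 * \<rho> (c j)))" by (auto intro!: bexI[of _ "to_nat_on S s"])
  qed
  have "codim1_content \<mu> R E \<le> (\<Sum>\<^sub>\<infinity>j\<in>I. ?t j)"
    unfolding codim1_content_def
    by (rule INF_lower2[of "(I, c, \<lambda>j. 15 * \<rho> (c j))"]) (use cover c \<rho> S(1) in auto)
  then have "of_nat N * codim1_content \<mu> R E \<le> of_nat N * (\<Sum>\<^sub>\<infinity>j\<in>I. ?t j)"
    by (intro mult_left_mono) auto
  also have "\<dots> = (SUP G\<in>{G. finite G \<and> G \<subseteq> I}. of_nat N * sum ?t G)"
    by (subst nonneg_infsum_complete) (auto simp: SUP_mult_left_ennreal)
  also have "\<dots> \<le> ennreal (Cd ^ 4) * (\<integral>\<^sup>+y. F y \<partial>M)"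
  proof (rule SUP_least)
    fix G assume "G \<in> {G. finite G \<and> G \<subseteq> I}"
    then have G: "finite G" "G \<subseteq> I" by auto
    let ?J = "\<lambda>j. \<integral>\<^sup>+y. F y * indicator (ball (c j) (3 * \<rho> (c j))) y \<partial>M"
    have t: "of_nat N * ?t j \<le> ennreal (Cd ^ 4) * ?J j" if "j \<in> G" for j
    proof -
      let ?x = "c j" and ?r = "\<rho> (c j)"
      have j: "?x \<in> E" "0 < ?r" using that G c S(1) pos by auto
      have "of_nat N * \<mu> (ball ?x (15 * ?r)) \<le> of_nat N * (ennreal (Cd ^ 4) * emeasure M (ball ?x ?r))"
        unfolding \<mu> using j by (intro mult_left_mono emeasure_ball_le) auto
      also have "\<dots> = ennreal (Cd ^ 4) * (of_nat N * emeasure M (ball ?x ?r))" by (simp add: ac_simps)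
      also have "\<dots> \<le> ennreal (Cd ^ 4) * (ennreal ?r * ?J j)"
        using \<rho>[OF j(1)] by (intro mult_left_mono) auto
      finally have le: "of_nat N * \<mu> (ball ?x (15 * ?r)) \<le> ennreal (Cd ^ 4) * (ennreal ?r * ?J j)" .
      have "of_nat N * ?t j = of_nat N * \<mu> (ball ?x (15 * ?r)) * ennreal (1 / (15 * ?r))"
        using j by (subst divide_ennreal_eq_mult) (simp_all only: mult.assoc mult_pos_pos zero_less_numeral)
      also have "\<dots> \<le> ennreal (Cd ^ 4) * (ennreal ?r * ?J j) * ennreal (1 / (15 * ?r))"
        using le by (intro mult_right_mono) auto
      also have "\<dots> = ennreal (Cd ^ 4) * (ennreal (?r * (1 / (15 * ?r))) * ?J j)"
        using j by (subst ennreal_mult) (auto simp: ac_simps)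
      also have "\<dots> \<le> ennreal (Cd ^ 4) * (1 * ?J j)"
        using j by (intro mult_left_mono mult_right_mono) (auto simp: ennreal_le_1)
      finally show ?thesis by simp
    qed
    have "of_nat N * sum ?t G = (\<Sum>j\<in>G. of_nat N * ?t j)" by (rule sum_distrib_left)
    also have "\<dots> \<le> (\<Sum>j\<in>G. ennreal (Cd ^ 4) * ?J j)" by (intro sum_mono t)
    also have "\<dots> = ennreal (Cd ^ 4) * (\<Sum>j\<in>G. ?J j)" by (rule sum_distrib_left[symmetric])
    also have "(\<Sum>j\<in>G. ?J j) = (\<integral>\<^sup>+y. (\<Sum>j\<in>G. F y * indicator (ball (c j) (3 * \<rho> (c j))) y) \<partial>M)"
      by (intro nn_integral_sum[symmetric]) measurable
    also have "\<dots> \<le> (\<integral>\<^sup>+y. F y \<partial>M)"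
    proof (rule nn_integral_mono)
      fix y
      have "disjoint_family_on (\<lambda>j. ball (c j) (3 * \<rho> (c j))) G"
        using S(2) G c inj unfolding disjoint_family_on_def inj_on_def by (metis subsetD)
      then have "(\<Sum>j\<in>G. indicator (ball (c j) (3 * \<rho> (c j))) y) = (indicator (\<Union>j\<in>G. ball (c j) (3 * \<rho> (c j))) y :: ennreal)"
        using G by (subst indicator_UN_disjoint) auto
      also have "\<dots> \<le> 1" by (simp add: indicator_def)
      finally have "F y * (\<Sum>j\<in>G. indicator (ball (c j) (3 * \<rho> (c j))) y) \<le> F y * 1"
        by (intro mult_left_mono) auto
      then show "(\<Sum>j\<in>G. F y * indicator (ball (c j) (3 * \<rho> (c j))) y) \<le> F y"
        by (simp add: sum_distrib_left)
    qed
    finally show "of_nat N * sum ?t G \<le> ennreal (Cd ^ 4) * (\<integral>\<^sup>+y. F y \<partial>M)"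
      by (simp add: mult_left_mono)
  qed
  finally show ?thesis .
qed

lemma (in doubling_open) codim1_hausdorff_density_eq_0:
  assumes \<mu>: "\<And>x r. \<mu> (ball x r) = emeasure M (ball x r)"
    and [measurable]: "f \<in> borel_measurable M" and fin: "(\<integral>\<^sup>+y. f y * indicator \<Omega> y \<partial>M) < \<infinity>"
    and E: "\<And>x. x \<in> E \<Longrightarrow> x \<notin> \<Omega> \<and> \<not> ((\<lambda>r. ennreal r *
      (\<integral>\<^sup>+y. f y * indicator (ball x (3 * r) \<inter> \<Omega>) y \<partial>M) / emeasure M (ball x r)) \<longlongrightarrow> 0) (at_right 0)"
  shows "codim1_hausdorff \<mu> E = 0"
proof -
  obtain F and R :: "nat \<Rightarrow> real" where F [measurable]: "F \<in> borel_measurable M"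
    and Ffin: "(\<integral>\<^sup>+y. F y \<partial>M) < \<infinity>" and R: "\<And>k. 0 < R k"
    and FR: "\<And>k y. y \<in> \<Omega> \<Longrightarrow> bdist y < R k \<Longrightarrow> 2 ^ k * f y \<le> F y"
    using ex_boundary_weight[of f] fin by auto
  have "codim1_content \<mu> S E = 0" if S: "0 < S" for S
  proof -
    have "of_nat N * codim1_content \<mu> S E \<le> ennreal (Cd ^ 4) * (\<integral>\<^sup>+y. F y \<partial>M)" for N
    proof (rule codim1_content_le[OF \<mu> F S])
      fix x assume x: "x \<in> E"
      let ?I = "\<lambda>r. \<integral>\<^sup>+y. f y * indicator (ball x (3 * r) \<inter> \<Omega>) y \<partial>M"
      let ?q = "\<lambda>r. ennreal r * ?I r / emeasure M (ball x r)"
      have xn: "x \<notin> \<Omega>" using E[OF x] by simp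
      have "\<exists>a>0. \<not> eventually (\<lambda>r. ?q r < a) (at_right 0)"
      proof (rule ccontr)
        assume "\<not> ?thesis"
        then have "\<And>a. 0 < a \<Longrightarrow> eventually (\<lambda>r. ?q r < a) (at_right 0)" by blast
        then have "(?q \<longlongrightarrow> 0) (at_right 0)" by (intro order_tendstoI) auto
        with E[OF x] show False by blast
      qed
      then obtain a where a: "0 < a" and freq: "\<not> eventually (\<lambda>r. ?q r < a) (at_right 0)" by blast
      obtain k where k: "of_nat N \<le> 2 ^ k * a"
      proof (cases a)
        case (real t)
        then have "0 < t" using a by simp
        obtain k where "real N / t < 2 ^ k" using real_arch_pow[of 2] by auto
        then have "real N \<le> 2 ^ k * t" using \<open>0 < t\<close> by (simp add: field_simps)
        then have "ennreal (real N) \<le> ennreal (2 ^ k * t)" by (rule ennreal_leI)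
        then have "of_nat N \<le> 2 ^ k * a"
          using real \<open>0 < t\<close> by (simp add: ennreal_of_nat_eq_real_of_nat ennreal_mult flip: ennreal_power)
        then show ?thesis by (rule that)
      next
        case top
        then have "of_nat N \<le> 2 ^ 0 * a" by simp
        then show ?thesis by (rule that)
      qed
      let ?e = "min (S / 15) (R k / 3)"
      have "0 < ?e" using S R by simp
      moreover have "\<not> (\<exists>b>0. \<forall>r>0. r < b \<longrightarrow> ?q r < a)"
        using freq unfolding eventually_at_right_field .
      ultimately have "\<not> (\<forall>r>0. r < ?e \<longrightarrow> ?q r < a)" by blast
      then obtain r where "0 < r" "r < ?e" "\<not> ?q r < a" by blast
      then have r: "0 < r" "r < ?e" "a \<le> ?q r" by (simp_all only: not_less)
      have "a * emeasure M (ball x r) \<le> ?q r * emeasure M (ball x r)" using r by (intro mult_right_mono) auto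
      also have "\<dots> = ennreal r * ?I r"
        using ball_pos[OF r(1), of x] ball_finite[of x r]
        by (subst ennreal_divide_times, subst ennreal_divide_self) auto
      finally have am: "a * emeasure M (ball x r) \<le> ennreal r * ?I r" .
      have "of_nat N * emeasure M (ball x r) \<le> 2 ^ k * a * emeasure M (ball x r)"
        using k by (intro mult_right_mono) auto
      also have "\<dots> \<le> 2 ^ k * (ennreal r * ?I r)"
        using am by (simp add: mult.assoc mult_left_mono)
      also have "\<dots> = ennreal r * (\<integral>\<^sup>+y. 2 ^ k * (f y * indicator (ball x (3 * r) \<inter> \<Omega>) y) \<partial>M)"
        by (subst nn_integral_cmult) (auto simp: ac_simps)
      also have "\<dots> \<le> ennreal r * (\<integral>\<^sup>+y. F y * indicator (ball x (3 * r)) y \<partial>M)"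
      proof (intro mult_left_mono nn_integral_mono)
        fix y
        show "2 ^ k * (f y * indicator (ball x (3 * r) \<inter> \<Omega>) y) \<le> F y * indicator (ball x (3 * r)) y"
        proof (cases "y \<in> ball x (3 * r) \<inter> \<Omega>")
          case True
          then have "bdist y < R k" using bdist_le_dist[OF xn, of y] r by auto
          then show ?thesis using FR[of y k] True by simp
        qed simp
      qed auto
      finally show "\<exists>r>0. 15 * r \<le> S \<and> of_nat N * emeasure M (ball x r)
          \<le> ennreal r * (\<integral>\<^sup>+y. F y * indicator (ball x (3 * r)) y \<partial>M)"
        using r by (intro exI[of _ r]) auto
    qed
    moreover obtain B where "ennreal (Cd ^ 4) * (\<integral>\<^sup>+y. F y \<partial>M) = ennreal B" "0 \<le> B"
      using Ffin by (cases "ennreal (Cd ^ 4) * (\<integral>\<^sup>+y. F y \<partial>M)") (auto simp: ennreal_mult_eq_top_iff)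
    ultimately have B: "of_nat N * codim1_content \<mu> S E \<le> ennreal B" for N by simp
    show ?thesis
    proof (cases "codim1_content \<mu> S E")
      case (real t)
      have "real N * t \<le> B" for N
        using B[of N] real \<open>0 \<le> B\<close> by (simp add: ennreal_of_nat_eq_real_of_nat flip: ennreal_mult)
      then have "t \<le> 0" by (metis real(1) reals_Archimedean3 not_le order_le_less)
      then show ?thesis using real by simp
    next
      case top
      then show ?thesis using B[of 1] by (simp add: top_unique)
    qed
  qed
  then show ?thesis unfolding codim1_hausdorff_eq_SUP by simp
qed

lemma divide_left_mono_ennreal:
  fixes a b c :: ennreal
  assumes "a \<le> b"
  shows "c / b \<le> c / a"
proof -
  have "inverse b \<le> inverse a"
    using assms by (simp add: less_eq_ennreal.rep_eq inverse_ennreal.rep_eq ereal_inverse_antimono)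
  then show ?thesis unfolding divide_ennreal_def by (intro mult_left_mono) auto
qed

section \<open>Localisation of the Poincare inequality\<close>

locale newtonian_smoothing = smoothing M Cd \<Omega> \<Lambda> w
  for M :: "'a::metric_space measure" and Cd \<Omega> \<Lambda> w +
  fixes \<mu> :: "'a set \<Rightarrow> ennreal" and u :: "'a \<Rightarrow> ereal" and CP :: real
  assumes reg: "borel_regular_outer_measure \<mu>"
    and M: "M = carath \<mu>"
    and CP: "0 < CP"
    and poincare: "\<And>x r u g. 0 < r \<Longrightarrow> in_L1_loc \<mu> UNIV u \<Longrightarrow> upper_gradient u g \<Longrightarrow>
        (\<integral>\<^sup>+ y. eabs_diff (u y) (ereal (mean \<mu> (ball x r) u))
            \<partial>restrict_space (carath \<mu>) (ball x r)) / \<mu> (ball x r)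
        \<le> ennreal (CP * r) *
          ((\<integral>\<^sup>+ y. g y \<partial>restrict_space (carath \<mu>) (ball x (\<Lambda> * r))) / \<mu> (ball x (\<Lambda> * r)))"
    and u: "in_N11 \<mu> \<Omega> u"
    and w_eq: "\<And>y. w y = (if y \<in> \<Omega> then real_of_ereal (u y) else 0)"
begin

lemma emeasure_M: "A \<in> sets M \<Longrightarrow> emeasure M A = \<mu> A"
  using reg by (simp add: M emeasure_carath)

lemma \<mu>_ball: "\<mu> (ball x r) = emeasure M (ball x r)"
  by (simp add: emeasure_M)

lemma ex_borel_superset:
  assumes A: "A \<in> sets M"
  shows "\<exists>B\<in>sets borel. A \<subseteq> B \<and> emeasure M (B - A) = 0"
proof -
  have "\<exists>B\<in>sets borel. A \<inter> ball undefined (real n) \<subseteq> B \<and> emeasure M (B - A \<inter> ball undefined (real n)) = 0" for n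
  proof -
    let ?A = "A \<inter> ball undefined (real n)"
    have A' [measurable]: "?A \<in> sets M" using A by auto
    obtain B where B: "B \<in> sets borel" "?A \<subseteq> B" "\<mu> B = \<mu> ?A"
      using reg unfolding borel_regular_outer_measure_def by blast
    have BM: "B \<in> sets M" using B borel_M by auto
    have "emeasure M ?A \<le> emeasure M (ball undefined (real n))" by (intro emeasure_mono) auto
    then have "emeasure M ?A < \<infinity>" using ball_finite by (rule le_less_trans)
    then have "emeasure M (B - ?A) = emeasure M B - emeasure M ?A"
      using A' BM B by (intro emeasure_Diff) auto
    also have "\<dots> = 0" using B BM A' \<open>emeasure M ?A < \<infinity>\<close> by (simp add: emeasure_M)
    finally show ?thesis using B by blast
  qed
  then obtain B where B: "\<And>n. B n \<in> sets borel" "\<And>n. A \<inter> ball undefined (real n) \<subseteq> B n"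
    "\<And>n. emeasure M (B n - A \<inter> ball undefined (real n)) = 0" by metis
  have BM [measurable]: "B n \<in> sets M" for n using B borel_M by auto
  show ?thesis
  proof (intro bexI[of _ "\<Union>n. B n"] conjI)
    show "(\<Union>n. B n) \<in> sets borel" using B by auto
    show "A \<subseteq> (\<Union>n. B n)"
    proof
      fix x assume "x \<in> A"
      moreover obtain n :: nat where "dist undefined x < n" using reals_Archimedean2 by blast
      ultimately show "x \<in> (\<Union>n. B n)" using B(2)[of n] by auto
    qed
    have "emeasure M (\<Union>n. B n - A \<inter> ball undefined (real n)) = 0"
      using A B(3) by (intro emeasure_UN_eq_0) auto
    moreover have "emeasure M ((\<Union>n. B n) - A) \<le> emeasure M (\<Union>n. B n - A \<inter> ball undefined (real n))"
      using A by (intro emeasure_mono) auto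
    ultimately show "emeasure M ((\<Union>n. B n) - A) = 0" by simp
  qed
qed

lemma ex_borel_majorant:
  fixes f :: "'a \<Rightarrow> ennreal"
  assumes [measurable]: "f \<in> borel_measurable M"
  obtains F where "F \<in> borel_measurable borel" "\<And>x. f x \<le> F x" "AE x in M. F x = f x"
proof -
  define A where "A q = {x. ennreal (real_of_rat q) < f x}" for q
  have A: "A q \<in> sets M" for q
  proof -
    have "{x \<in> space M. ennreal (real_of_rat q) < f x} \<in> sets M" by measurable
    then show ?thesis by (simp add: A_def)
  qed
  obtain B where B: "\<And>q. B q \<in> sets borel" "\<And>q. A q \<subseteq> B q" "\<And>q. emeasure M (B q - A q) = 0"
    using ex_borel_superset[OF A] by metis
  have BM: "B q \<in> sets M" for q using B borel_M by auto
  define F where "F x = (SUP q. ennreal (real_of_rat q) * indicator (B q) x)" for x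
  show thesis
  proof (rule that[of F])
    have [measurable]: "B q \<in> sets borel" for q by (rule B(1))
    show "F \<in> borel_measurable borel" unfolding F_def by measurable
    show "f x \<le> F x" for x
    proof (rule ccontr)
      assume "\<not> f x \<le> F x"
      then obtain q where q: "F x < ennreal (real_of_rat q)" "ennreal (real_of_rat q) < f x"
        using ennreal_rat_dense[of "F x" "f x"] by (auto simp: not_le)
      then have "x \<in> B q" using B(2) by (auto simp: A_def)
      then have "ennreal (real_of_rat q) \<le> F x"
        unfolding F_def by (intro SUP_upper2[of q]) auto
      with q show False by simp
    qed
    then have ge: "\<And>x. f x \<le> F x" .
    have "AE x in M. \<forall>q. x \<notin> B q - A q"
    proof (subst AE_all_countable, intro allI)
      show "AE x in M. x \<notin> B q - A q" for q
        by (rule AE_I[of _ _ "B q - A q"]) (use B(3) BM A in auto)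
    qed
    then show "AE x in M. F x = f x"
    proof eventually_elim
      case (elim x)
      have "F x \<le> f x" unfolding F_def
      proof (rule SUP_least)
        show "ennreal (real_of_rat q) * indicator (B q) x \<le> f x" for q
          using elim[rule_format, of q] by (auto simp: A_def indicator_def)
      qed
      then show ?case using ge by (rule antisym)
    qed
  qed
qed

lemma u_measurable: "(\<lambda>y. u y * indicator \<Omega> y) \<in> borel_measurable M"
  using u unfolding in_N11_def M[symmetric] by (subst (asm) borel_measurable_restrict_space_iff_ereal) auto

lemma restrict_nn_integral:
  "A \<in> sets M \<Longrightarrow> (\<integral>\<^sup>+y. f y \<partial>restrict_space M A) = (\<integral>\<^sup>+y. f y * indicator A y \<partial>M)"
  by (rule nn_integral_restrict_space) simp

lemma L1_norm_finite: "L1_norm \<mu> \<Omega> u < \<infinity>"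
  using u unfolding in_N11_def N11_norm_def by (auto simp: less_top)

text \<open>Extending the upper gradient by \<open>\<infinity>\<close> off the ball makes it an upper gradient on the whole
  space: a curve leaving \<open>\<Omega>\<close> spends positive length where it is infinite.\<close>

lemma ex_local_poincare:
  assumes g: "weak_upper_gradient \<mu> \<Omega> u g" and e: "0 < e"
  shows "\<exists>h. local_poincare CP h \<and>
    (\<integral>\<^sup>+y. h y * indicator \<Omega> y \<partial>M) \<le> (\<integral>\<^sup>+y. g y \<partial>restrict_space (carath \<mu>) \<Omega>) + ennreal e"
proof -
  let ?g = "\<lambda>y. g y * indicator \<Omega> y"
  obtain \<Gamma> where gm: "g \<in> borel_measurable (restrict_space M \<Omega>)" and zm: "zero_modulus \<mu> \<Gamma>"
    and ug: "\<And>\<gamma> a b. nonconst_curve \<gamma> a b \<Longrightarrow> \<gamma> ` {a..b} \<subseteq> \<Omega> \<Longrightarrow> (\<gamma>, a, b) \<notin> \<Gamma> \<Longrightarrow> ug_ineq u g \<gamma> a b"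
    using g unfolding weak_upper_gradient_def M[symmetric] by blast
  obtain \<rho> :: "'a \<Rightarrow> ennreal" where \<rho>: "\<rho> \<in> borel_measurable borel" "(\<integral>\<^sup>+x. \<rho> x \<partial>M) < \<infinity>"
    "\<And>\<gamma> a b. (\<gamma>, a, b) \<in> \<Gamma> \<Longrightarrow> curve_integral \<gamma> a b \<rho> = \<infinity>"
    using zm unfolding zero_modulus_def M[symmetric] by blast
  have "?g \<in> borel_measurable M"
    using gm by (subst (asm) borel_measurable_restrict_space_iff_ennreal) auto
  then obtain G where G: "G \<in> borel_measurable borel" "\<And>x. ?g x \<le> G x" "AE x in M. G x = ?g x"
    using ex_borel_majorant by blast
  define s where "s = enn2real (\<integral>\<^sup>+x. \<rho> x \<partial>M)"
  have s: "0 \<le> s" "(\<integral>\<^sup>+x. \<rho> x \<partial>M) = ennreal s" using \<rho>(2) by (auto simp: s_def)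
  define \<epsilon> where "\<epsilon> = e / (1 + s)"
  have \<epsilon>: "0 < \<epsilon>" "\<epsilon> * s \<le> e" using s e by (auto simp: \<epsilon>_def field_simps)
  define h where "h y = G y + ennreal \<epsilon> * \<rho> y" for y
  have hb: "h \<in> borel_measurable borel" unfolding h_def using G(1) \<rho>(1) by measurable
  have [measurable]: "G \<in> borel_measurable M" "\<rho> \<in> borel_measurable M" "h \<in> borel_measurable M"
    using G(1) \<rho>(1) hb by (auto intro: borel_measurable_M)
  have hcurve: "ug_ineq u k \<gamma> a b"
    if c: "nonconst_curve \<gamma> a b" "\<gamma> ` {a..b} \<subseteq> \<Omega>" and k: "\<And>y. h y \<le> k y" for \<gamma> a b k
  proof (cases "(\<gamma>, a, b) \<in> \<Gamma>")
    case True
    have "curve_integral \<gamma> a b (\<lambda>y. ennreal \<epsilon> * \<rho> y) \<le> curve_integral \<gamma> a b k"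
      using c(1) by (intro curve_integral_mono order_trans[OF _ k]) (auto simp: nonconst_curve_def h_def)
    then have "curve_integral \<gamma> a b k = \<infinity>"
      using curve_integral_cmult_eq_top[OF \<rho>(3)[OF True] \<epsilon>(1)] by (simp add: top_unique)
    then show ?thesis by (simp add: ug_ineq_def)
  next
    case False
    have "curve_integral \<gamma> a b g \<le> curve_integral \<gamma> a b k"
    proof (rule curve_integral_mono)
      fix t assume "t \<in> {a..b}"
      then have "\<gamma> t \<in> \<Omega>" using c by auto
      then have "g (\<gamma> t) \<le> G (\<gamma> t)" using G(2)[of "\<gamma> t"] by simp
      also have "\<dots> \<le> h (\<gamma> t)" by (simp add: h_def)
      finally show "g (\<gamma> t) \<le> k (\<gamma> t)" using k by (rule order_trans)
    qed (use c in \<open>simp add: nonconst_curve_def\<close>)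
    then show ?thesis using ug[OF c False] by (auto simp: ug_ineq_def)
  qed
  let ?u = "\<lambda>y. u y * indicator \<Omega> y"
  have u_loc: "in_L1_loc \<mu> UNIV ?u"
    unfolding in_L1_loc_def in_L1_def M[symmetric]
  proof (intro allI impI conjI)
    fix U assume "compactly_inside U (UNIV :: 'a set)"
    then have U: "U \<in> sets M" using borel_M by (auto simp: compactly_inside_def)
    show "?u \<in> borel_measurable (restrict_space M U)"
      using u_measurable by (rule measurable_restrict_space1)
    have "L1_norm \<mu> U ?u = (\<integral>\<^sup>+y. e2ennreal \<bar>?u y\<bar> * indicator U y \<partial>M)"
      unfolding L1_norm_def M[symmetric] using U by (rule restrict_nn_integral)
    also have "\<dots> \<le> (\<integral>\<^sup>+y. e2ennreal \<bar>u y\<bar> * indicator \<Omega> y \<partial>M)"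
      by (intro nn_integral_mono) (auto simp: indicator_def e2ennreal_neg)
    also have "\<dots> = L1_norm \<mu> \<Omega> u"
      unfolding L1_norm_def M[symmetric] by (rule restrict_nn_integral[symmetric]) simp
    finally show "L1_norm \<mu> U ?u < \<infinity>" using L1_norm_finite by (rule le_less_trans)
  qed
  have "local_poincare CP h"
    unfolding local_poincare_def
  proof (intro conjI allI impI CP)
    show "h \<in> borel_measurable M" by measurable
    fix x r assume r: "0 < (r::real)" and sub: "ball x (2 * \<Lambda> * r) \<subseteq> \<Omega>"
    let ?B = "ball x (\<Lambda> * r)"
    define k where "k y = (if y \<in> ?B then h y else \<infinity>)" for y
    have kb: "k \<in> borel_measurable borel" unfolding k_def using hb by (intro measurable_If_set) auto
    have Lr: "r \<le> \<Lambda> * r" "0 < \<Lambda> * r" using \<Lambda> r by auto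
    have "upper_gradient ?u k"
      unfolding upper_gradient_def
    proof (intro conjI kb allI impI)
      fix \<gamma> :: "real \<Rightarrow> 'a" and a b assume c: "nonconst_curve \<gamma> a b"
      show "ug_ineq ?u k \<gamma> a b"
      proof (cases "\<gamma> ` {a..b} \<subseteq> \<Omega>")
        case True
        have "a \<le> b" using c by (simp add: nonconst_curve_def is_curve_def)
        then have "\<gamma> a \<in> \<Omega>" "\<gamma> b \<in> \<Omega>" using True by auto
        moreover have "ug_ineq u k \<gamma> a b"
          using hcurve[OF c True, of k] by (simp add: k_def)
        ultimately show ?thesis by (simp add: ug_ineq_def)
      next
        case False
        then obtain t where t: "t \<in> {a..b}" "\<gamma> t \<notin> \<Omega>"
          unfolding image_subset_iff by blast
        have "curve_integral \<gamma> a b k = \<infinity>"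
        proof (rule curve_integral_eq_top[OF c t(1) Lr(2)])
          fix y assume y: "dist (\<gamma> t) y < \<Lambda> * r"
          have "2 * \<Lambda> * r \<le> dist x (\<gamma> t)" using t(2) sub by (auto simp: not_less[symmetric])
          then have "\<Lambda> * r \<le> dist x y"
            using y dist_triangle[of x "\<gamma> t" y] by (simp add: dist_commute)
          then show "k y = \<infinity>" by (simp add: k_def)
        qed
        then show ?thesis by (simp add: ug_ineq_def)
      qed
    qed
    from poincare[OF r u_loc this, of x] obtain c where
      P: "(\<integral>\<^sup>+y. eabs_diff (?u y) (ereal c) \<partial>restrict_space M (ball x r)) / \<mu> (ball x r)
        \<le> ennreal (CP * r) * ((\<integral>\<^sup>+y. k y \<partial>restrict_space M ?B) / \<mu> ?B)"
      unfolding M by blast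
    let ?X = "\<integral>\<^sup>+y. eabs_diff (?u y) (ereal c) \<partial>restrict_space M (ball x r)"
    let ?Y = "\<integral>\<^sup>+y. k y \<partial>restrict_space M ?B"
    have mb: "0 < \<mu> (ball x r)" "\<mu> (ball x r) < \<infinity>" "0 < \<mu> ?B" "\<mu> ?B < \<infinity>" "\<mu> (ball x r) \<le> \<mu> ?B"
      unfolding \<mu>_ball using ball_pos[OF r] ball_pos[OF Lr(2)] ball_finite
      by (auto intro!: emeasure_mono subset_ball[OF Lr(1)])
    have "?X = ?X / \<mu> (ball x r) * \<mu> (ball x r)"
      using mb by (subst ennreal_divide_times, subst ennreal_divide_self) auto
    also have "\<dots> \<le> ennreal (CP * r) * (?Y / \<mu> ?B) * \<mu> ?B"
      using P mb by (intro mult_mono) auto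
    also have "\<dots> = ennreal (CP * r) * ?Y"
      using mb by (subst mult.assoc, subst ennreal_divide_times, subst ennreal_divide_self) auto
    also have "?Y = (\<integral>\<^sup>+y. h y * indicator ?B y \<partial>M)"
      by (subst restrict_nn_integral) (auto intro!: nn_integral_cong simp: k_def indicator_def)
    finally have X: "?X \<le> ennreal (CP * r) * (\<integral>\<^sup>+y. h y * indicator ?B y \<partial>M)" .
    have "(\<integral>\<^sup>+y. ennreal \<bar>w y - c\<bar> * indicator (ball x r) y \<partial>M) \<le> ?X"
    proof (subst restrict_nn_integral)
      have "ennreal \<bar>w y - c\<bar> \<le> eabs_diff (?u y) (ereal c)" for y
        by (simp add: eabs_diff_def w_eq)
      then show "(\<integral>\<^sup>+y. ennreal \<bar>w y - c\<bar> * indicator (ball x r) y \<partial>M)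
          \<le> (\<integral>\<^sup>+y. eabs_diff (?u y) (ereal c) * indicator (ball x r) y \<partial>M)"
        by (intro nn_integral_mono mult_right_mono) auto
    qed simp
    with X show "\<exists>c. (\<integral>\<^sup>+y. ennreal \<bar>w y - c\<bar> * indicator (ball x r) y \<partial>M)
        \<le> ennreal (CP * r) * (\<integral>\<^sup>+y. h y * indicator ?B y \<partial>M)"
      by (blast intro: order_trans)
  qed
  moreover have "(\<integral>\<^sup>+y. h y * indicator \<Omega> y \<partial>M) \<le> (\<integral>\<^sup>+y. g y \<partial>restrict_space (carath \<mu>) \<Omega>) + ennreal e"
  proof -
    have "(\<integral>\<^sup>+y. h y * indicator \<Omega> y \<partial>M) \<le> (\<integral>\<^sup>+y. G y + ennreal \<epsilon> * \<rho> y \<partial>M)"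
      by (intro nn_integral_mono) (auto simp: h_def indicator_def)
    also have "\<dots> = (\<integral>\<^sup>+y. G y \<partial>M) + ennreal \<epsilon> * (\<integral>\<^sup>+y. \<rho> y \<partial>M)"
      by (simp add: nn_integral_add nn_integral_cmult)
    also have "(\<integral>\<^sup>+y. G y \<partial>M) = (\<integral>\<^sup>+y. ?g y \<partial>M)" using G(3) by (rule nn_integral_cong_AE)
    also have "\<dots> = (\<integral>\<^sup>+y. g y \<partial>restrict_space (carath \<mu>) \<Omega>)"
      unfolding M[symmetric] by (rule restrict_nn_integral[symmetric]) simp
    also have "ennreal \<epsilon> * (\<integral>\<^sup>+y. \<rho> y \<partial>M) = ennreal (\<epsilon> * s)"
      unfolding s(2) using \<epsilon>(1) s(1) by (simp add: ennreal_mult)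
    also have "\<dots> \<le> ennreal e" using \<epsilon> by (intro ennreal_leI)
    finally show ?thesis by (simp add: add_left_mono)
  qed
  ultimately show ?thesis by blast
qed

lemma nn_integral_w: "(\<integral>\<^sup>+y. ennreal \<bar>w y\<bar> * indicator \<Omega> y \<partial>M) \<le> L1_norm \<mu> \<Omega> u"
proof -
  have "ennreal \<bar>w y\<bar> * indicator \<Omega> y \<le> e2ennreal \<bar>u y\<bar> * indicator \<Omega> y" for y
    by (cases "u y") (auto simp: w_eq indicator_def)
  then have "(\<integral>\<^sup>+y. ennreal \<bar>w y\<bar> * indicator \<Omega> y \<partial>M) \<le> (\<integral>\<^sup>+y. e2ennreal \<bar>u y\<bar> * indicator \<Omega> y \<partial>M)"
    by (rule nn_integral_mono)
  also have "\<dots> = L1_norm \<mu> \<Omega> u"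
    unfolding L1_norm_def M[symmetric] by (rule restrict_nn_integral[symmetric]) simp
  finally show ?thesis .
qed

lemma AE_finite: "AE y in M. y \<in> \<Omega> \<longrightarrow> \<bar>u y\<bar> \<noteq> \<infinity>"
proof -
  let ?f = "\<lambda>y. e2ennreal \<bar>u y * indicator \<Omega> y\<bar>"
  have "(\<lambda>y. u y * indicator \<Omega> y) \<in> borel_measurable M" by (rule u_measurable)
  then have f: "?f \<in> borel_measurable M" by measurable
  have "(\<integral>\<^sup>+y. ?f y \<partial>M) = L1_norm \<mu> \<Omega> u"
    unfolding L1_norm_def M[symmetric]
    by (subst restrict_nn_integral) (auto intro!: nn_integral_cong simp: indicator_def e2ennreal_neg)
  then have "(\<integral>\<^sup>+y. ?f y \<partial>M) \<noteq> \<infinity>" using L1_norm_finite by auto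
  with f have "AE y in M. ?f y \<noteq> \<infinity>" by (rule nn_integral_PInf_AE)
  then show ?thesis by eventually_elim (auto simp: indicator_def)
qed

lemma ex_weak_upper_gradient:
  obtains g where "weak_upper_gradient \<mu> \<Omega> u g" "(\<integral>\<^sup>+y. g y \<partial>restrict_space (carath \<mu>) \<Omega>) < \<infinity>"
proof -
  have "(INF g \<in> {g. weak_upper_gradient \<mu> \<Omega> u g}. \<integral>\<^sup>+ x. g x \<partial>restrict_space (carath \<mu>) \<Omega>) < \<infinity>"
    using u unfolding in_N11_def N11_norm_def by (auto simp: less_top)
  then show thesis using that by (auto simp: INF_less_iff)
qed

lemma in_hajlasz_smooth:
  assumes A: "A < 2 ^ k" and C: "0 \<le> C"
    and bound: "\<And>h x y. local_poincare CP h \<Longrightarrow> x \<in> \<Omega> \<Longrightarrow> y \<in> \<Omega> \<Longrightarrow> R x y \<Longrightarrow>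
      ennreal \<bar>smooth x - smooth y\<bar> \<le> ennreal (C * dist x y) * (avg A h x + avg A h y)"
  shows "in_hajlasz \<mu> \<Omega> R smooth"
    and "hajlasz_norm \<mu> \<Omega> R smooth \<le> ennreal (8 * K * Cd\<^sup>2 + C * Cd ^ k) * N11_norm \<mu> \<Omega> u"
proof -
  let ?V = "8 * K * Cd\<^sup>2" and ?D = "C * Cd ^ k"
  have pos: "0 \<le> ?V" "0 \<le> ?D" using K Cd C by auto
  have norm: "L1_norm \<mu> \<Omega> (\<lambda>x. ereal (smooth x)) \<le> ennreal ?V * L1_norm \<mu> \<Omega> u"
  proof -
    have "L1_norm \<mu> \<Omega> (\<lambda>x. ereal (smooth x)) = (\<integral>\<^sup>+x. ennreal \<bar>smooth x\<bar> * indicator \<Omega> x \<partial>M)"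
      unfolding L1_norm_def M[symmetric] by (subst restrict_nn_integral) auto
    also have "\<dots> \<le> (\<integral>\<^sup>+x. ennreal (8 * K * Cd) * avg 1 (\<lambda>y. ennreal \<bar>w y\<bar>) x \<partial>M)"
      using smooth_le_avg by (intro nn_integral_mono) (auto simp: indicator_def)
    also have "\<dots> = ennreal (8 * K * Cd) * (\<integral>\<^sup>+x. avg 1 (\<lambda>y. ennreal \<bar>w y\<bar>) x \<partial>M)"
      by (rule nn_integral_cmult) measurable
    also have "\<dots> \<le> ennreal (8 * K * Cd) * (ennreal (Cd ^ 1) * (\<integral>\<^sup>+y. ennreal \<bar>w y\<bar> * indicator \<Omega> y \<partial>M))"
      by (intro mult_left_mono nn_integral_avg) auto
    also have "\<dots> \<le> ennreal (8 * K * Cd) * (ennreal (Cd ^ 1) * L1_norm \<mu> \<Omega> u)"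
      by (intro mult_left_mono nn_integral_w) auto
    also have "\<dots> = ennreal ?V * L1_norm \<mu> \<Omega> u"
      using K Cd by (simp add: ennreal_mult power2_eq_square ac_simps)
    finally show ?thesis .
  qed
  have grad: "\<exists>G\<in>hajlasz_gradients \<mu> \<Omega> R smooth. (\<integral>\<^sup>+x. G x \<partial>restrict_space (carath \<mu>) \<Omega>)
      \<le> ennreal ?D * ((\<integral>\<^sup>+y. g y \<partial>restrict_space (carath \<mu>) \<Omega>) + ennreal e)"
    if g: "weak_upper_gradient \<mu> \<Omega> u g" and e: "0 < e"
      and gfin: "(\<integral>\<^sup>+y. g y \<partial>restrict_space (carath \<mu>) \<Omega>) < \<infinity>" for g e
  proof -
    obtain h where h: "local_poincare CP h"
      and hle: "(\<integral>\<^sup>+y. h y * indicator \<Omega> y \<partial>M) \<le> (\<integral>\<^sup>+y. g y \<partial>restrict_space (carath \<mu>) \<Omega>) + ennreal e"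
      using ex_local_poincare[OF g e] by blast
    have [measurable]: "h \<in> borel_measurable M" using h by (simp add: local_poincare_def)
    define G where "G x = ennreal C * avg A h x" for x
    have Gm [measurable]: "G \<in> borel_measurable M" unfolding G_def by measurable
    have "(\<integral>\<^sup>+x. G x \<partial>restrict_space (carath \<mu>) \<Omega>) \<le> (\<integral>\<^sup>+x. G x \<partial>M)"
      unfolding M[symmetric] by (subst restrict_nn_integral) (auto intro!: nn_integral_mono simp: indicator_def)
    also have "\<dots> = ennreal C * (\<integral>\<^sup>+x. avg A h x \<partial>M)"
      unfolding G_def by (rule nn_integral_cmult) measurable
    also have "\<dots> \<le> ennreal C * (ennreal (Cd ^ k) * (\<integral>\<^sup>+y. h y * indicator \<Omega> y \<partial>M))"
      by (intro mult_left_mono nn_integral_avg A) auto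
    also have "\<dots> \<le> ennreal C * (ennreal (Cd ^ k) * ((\<integral>\<^sup>+y. g y \<partial>restrict_space (carath \<mu>) \<Omega>) + ennreal e))"
      by (intro mult_left_mono hle) auto
    also have "\<dots> = ennreal ?D * ((\<integral>\<^sup>+y. g y \<partial>restrict_space (carath \<mu>) \<Omega>) + ennreal e)"
      using C Cd by (simp add: ennreal_mult mult.assoc)
    finally have le: "(\<integral>\<^sup>+x. G x \<partial>restrict_space (carath \<mu>) \<Omega>)
      \<le> ennreal ?D * ((\<integral>\<^sup>+y. g y \<partial>restrict_space (carath \<mu>) \<Omega>) + ennreal e)" .
    also have "\<dots> < \<infinity>" using gfin by (simp add: ennreal_mult_less_top)
    finally have fin: "(\<integral>\<^sup>+x. G x \<partial>restrict_space (carath \<mu>) \<Omega>) < \<infinity>" .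
    have "G \<in> hajlasz_gradients \<mu> \<Omega> R smooth"
      unfolding hajlasz_gradients_def
    proof (intro CollectI conjI fin exI[of _ "{}"] ballI impI)
      show "G \<in> borel_measurable (restrict_space (carath \<mu>) \<Omega>)"
        unfolding M[symmetric] using Gm by (rule measurable_restrict_space1)
      have "emeasure M {} = \<mu> {}" by (rule emeasure_M) simp
      then show "\<mu> {} = 0" by simp
      fix x y assume "x \<in> \<Omega> - {}" "y \<in> \<Omega> - {}" "R x y"
      then have "ennreal \<bar>smooth x - smooth y\<bar> \<le> ennreal (C * dist x y) * (avg A h x + avg A h y)"
        by (intro bound h) auto
      also have "\<dots> = ennreal (dist x y) * (G x + G y)"
        using C by (simp add: G_def ennreal_mult distrib_left ac_simps)
      finally show "ennreal \<bar>smooth x - smooth y\<bar> \<le> ennreal (dist x y) * (G x + G y)" .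
    qed auto
    with le show ?thesis by blast
  qed
  obtain g0 where g0: "weak_upper_gradient \<mu> \<Omega> u g0" "(\<integral>\<^sup>+y. g0 y \<partial>restrict_space (carath \<mu>) \<Omega>) < \<infinity>"
    by (rule ex_weak_upper_gradient)
  have sm: "(\<lambda>x. ereal (smooth x)) \<in> borel_measurable (restrict_space M \<Omega>)"
    using smooth_measurable by (intro measurable_restrict_space1) measurable
  have "ennreal ?V * L1_norm \<mu> \<Omega> u < \<infinity>" using L1_norm_finite by (simp add: ennreal_mult_less_top)
  with norm have "L1_norm \<mu> \<Omega> (\<lambda>x. ereal (smooth x)) < \<infinity>" by (rule le_less_trans)
  then show "in_hajlasz \<mu> \<Omega> R smooth"
    using grad[OF g0(1) zero_less_one g0(2)] sm by (auto simp: in_hajlasz_def in_L1_def M[symmetric])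
  let ?H = "INF G\<in>hajlasz_gradients \<mu> \<Omega> R smooth. \<integral>\<^sup>+x. G x \<partial>restrict_space (carath \<mu>) \<Omega>"
  let ?N = "INF g\<in>{g. weak_upper_gradient \<mu> \<Omega> u g}. \<integral>\<^sup>+x. g x \<partial>restrict_space (carath \<mu>) \<Omega>"
  have "?H \<le> ennreal ?D * ?N"
  proof -
    obtain n where n: "?N = ennreal n" "0 \<le> n"
      using INF_lower[of g0 "{g. weak_upper_gradient \<mu> \<Omega> u g}" "\<lambda>g. \<integral>\<^sup>+x. g x \<partial>restrict_space (carath \<mu>) \<Omega>"] g0
      by (cases ?N) (auto simp: top_unique)
    have "?H \<le> ennreal (?D * n) + ennreal e" if e: "0 < e" for e
    proof -
      define e' where "e' = e / (2 * (?D + 1))"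
      have e': "0 < e'" using e pos by (simp add: e'_def add_nonneg_pos)
      have "?N < ennreal (n + e')" unfolding n(1) using n(2) e' by (intro ennreal_lessI) auto
      then obtain g where g: "weak_upper_gradient \<mu> \<Omega> u g"
        "(\<integral>\<^sup>+x. g x \<partial>restrict_space (carath \<mu>) \<Omega>) < ennreal (n + e')" by (auto simp: INF_less_iff)
      then have "(\<integral>\<^sup>+x. g x \<partial>restrict_space (carath \<mu>) \<Omega>) < \<infinity>" using less_trans ennreal_less_top by fastforce
      from grad[OF g(1) e' this] have "?H \<le> ennreal ?D * ((\<integral>\<^sup>+y. g y \<partial>restrict_space (carath \<mu>) \<Omega>) + ennreal e')"
        by (meson INF_lower2)
      also have "\<dots> \<le> ennreal ?D * (ennreal (n + e') + ennreal e')"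
        using g by (intro mult_left_mono add_right_mono) auto
      also have "\<dots> = ennreal (?D * (n + e' + e'))"
      proof -
        have "ennreal (n + e') + ennreal e' = ennreal (n + e' + e')"
          using n(2) e' by (intro ennreal_plus[symmetric]) auto
        moreover have "ennreal (?D * (n + e' + e')) = ennreal ?D * ennreal (n + e' + e')"
          using n(2) e' pos(2) by (intro ennreal_mult) auto
        ultimately show ?thesis by (simp only:)
      qed
      also have "\<dots> \<le> ennreal (?D * n + e)"
      proof (rule ennreal_leI)
        have "?D * (2 * e') \<le> (?D + 1) * (2 * e')" using e' by (intro mult_right_mono) auto
        also have "\<dots> = e"
        proof -
          have "d * (2 * (e / (2 * d))) = e" if "0 < d" for d :: real using that by simp
          moreover have "0 < ?D + 1" using pos(2) by linarith
          ultimately show ?thesis unfolding e'_def by blast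
        qed
        finally show "?D * (n + e' + e') \<le> ?D * n + e" by (simp add: algebra_simps)
      qed
      also have "\<dots> = ennreal (?D * n) + ennreal e" using n pos e by (intro ennreal_plus) auto
      finally show ?thesis .
    qed
    then have "?H \<le> ennreal (?D * n)" by (rule ennreal_le_epsilon)
    also have "\<dots> = ennreal ?D * ?N" unfolding n(1) using pos(2) n(2) by (rule ennreal_mult)
    finally show ?thesis .
  qed
  then have "hajlasz_norm \<mu> \<Omega> R smooth \<le> ennreal ?V * L1_norm \<mu> \<Omega> u + ennreal ?D * ?N"
    unfolding hajlasz_norm_def by (intro add_mono norm)
  also have "\<dots> \<le> ennreal (?V + ?D) * L1_norm \<mu> \<Omega> u + ennreal (?V + ?D) * ?N"
    using pos by (intro add_mono mult_right_mono ennreal_leI) auto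
  finally show "hajlasz_norm \<mu> \<Omega> R smooth \<le> ennreal (?V + ?D) * N11_norm \<mu> \<Omega> u"
    by (simp add: N11_norm_def distrib_left)
qed

lemma same_trace_smooth:
  assumes md: "measure_density \<mu> \<Omega>"
  shows "codim1_hausdorff \<mu> {x \<in> frontier \<Omega>. \<not> same_trace_at \<mu> \<Omega> smooth u x} = 0"
proof -
  obtain g where g: "weak_upper_gradient \<mu> \<Omega> u g" "(\<integral>\<^sup>+y. g y \<partial>restrict_space (carath \<mu>) \<Omega>) < \<infinity>"
    by (rule ex_weak_upper_gradient)
  obtain h where h: "local_poincare CP h"
    and hle: "(\<integral>\<^sup>+y. h y * indicator \<Omega> y \<partial>M) \<le> (\<integral>\<^sup>+y. g y \<partial>restrict_space (carath \<mu>) \<Omega>) + ennreal 1"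
    using ex_local_poincare[OF g(1) zero_less_one] by blast
  have [measurable]: "h \<in> borel_measurable M" using h by (simp add: local_poincare_def)
  have hfin: "(\<integral>\<^sup>+y. h y * indicator \<Omega> y \<partial>M) < \<infinity>" using hle g(2) by (auto intro: le_less_trans)
  obtain cm where cm: "0 < cm" "\<And>x r. x \<in> closure \<Omega> \<Longrightarrow> 0 < r \<Longrightarrow> ennreal r < ediam \<Omega> \<Longrightarrow>
      ennreal cm * \<mu> (ball x r) \<le> \<mu> (ball x r \<inter> \<Omega>)"
    using md unfolding measure_density_def by blast
  let ?I = "\<lambda>x r. \<integral>\<^sup>+y. h y * indicator (ball x (3 * r) \<inter> \<Omega>) y \<partial>M"
  let ?q = "\<lambda>x r. ennreal r * ?I x r / emeasure M (ball x r)"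
  let ?C = "18 * K\<^sup>2 * CP * Cd"
  have C: "0 \<le> ?C" using CP Cd by simp
  show ?thesis
  proof (rule codim1_hausdorff_density_eq_0[OF \<mu>_ball _ hfin])
    fix x assume "x \<in> {x \<in> frontier \<Omega>. \<not> same_trace_at \<mu> \<Omega> smooth u x}"
    then have x: "x \<in> frontier \<Omega>" and nt: "\<not> same_trace_at \<mu> \<Omega> smooth u x" by auto
    have xn: "x \<notin> \<Omega>" and xc: "x \<in> closure \<Omega>"
      using x open_\<Omega> by (auto simp: frontier_def interior_open)
    have "\<not> (?q x \<longlongrightarrow> 0) (at_right 0)"
    proof
      assume q: "(?q x \<longlongrightarrow> 0) (at_right 0)"
      obtain p where p: "p \<in> \<Omega>" using xc by (metis closure_empty empty_iff equals0I)
      have "0 < dist x p" using p xn by auto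
      then obtain p' where p': "p' \<in> \<Omega>" "dist p' x < dist x p" using xc closure_approachable by blast
      then have "0 < dist p p'" by (auto simp: dist_commute)
      moreover have "ennreal (dist p p') \<le> ediam \<Omega>"
        unfolding ediam_def using p p' by (intro SUP_upper2[of "(p, p')"]) auto
      ultimately have diam: "ennreal r < ediam \<Omega>" if "r < dist p p'" for r
        using that by (metis ennreal_lessI less_le_trans)
      have "same_trace_at \<mu> \<Omega> smooth u x"
        unfolding same_trace_at_def
      proof (rule tendsto_sandwich[OF _ _ tendsto_const])
        show "((\<lambda>r. ennreal (?C / cm) * ?q x r) \<longlongrightarrow> 0) (at_right 0)"
          using ennreal_tendsto_cmult[OF _ q, of "ennreal (?C / cm)"] by simp
        show "eventually (\<lambda>r. (\<integral>\<^sup>+y. eabs_diff (ereal (smooth y)) (u y) \<partial>restrict_space (carath \<mu>) (ball x r \<inter> \<Omega>))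
            / \<mu> (ball x r \<inter> \<Omega>) \<le> ennreal (?C / cm) * ?q x r) (at_right 0)"
        proof (rule eventually_at_rightI[OF _ \<open>0 < dist p p'\<close>])
          fix r assume "r \<in> {0<..<dist p p'}"
          then have r: "0 < r" "r < dist p p'" by auto
          let ?X = "\<integral>\<^sup>+y. eabs_diff (ereal (smooth y)) (u y) \<partial>restrict_space (carath \<mu>) (ball x r \<inter> \<Omega>)"
          define m where "m = measure M (ball x r)"
          have m: "0 < m" "emeasure M (ball x r) = ennreal m"
            using measure_ball_pos[OF r(1)] by (auto simp: m_def emeasure_ball)
          have "?X = (\<integral>\<^sup>+y. eabs_diff (ereal (smooth y)) (u y) * indicator (ball x r \<inter> \<Omega>) y \<partial>M)"
            unfolding M[symmetric] by (rule restrict_nn_integral) simp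
          also have "\<dots> = (\<integral>\<^sup>+y. ennreal \<bar>smooth y - w y\<bar> * indicator (ball x r \<inter> \<Omega>) y \<partial>M)"
          proof (rule nn_integral_cong_AE, use AE_finite in eventually_elim)
            fix y assume "y \<in> \<Omega> \<longrightarrow> \<bar>u y\<bar> \<noteq> \<infinity>"
            then show "eabs_diff (ereal (smooth y)) (u y) * indicator (ball x r \<inter> \<Omega>) y
                = ennreal \<bar>smooth y - w y\<bar> * indicator (ball x r \<inter> \<Omega>) y"
              by (auto simp: indicator_def eabs_diff_def w_eq)
          qed
          also have "\<dots> \<le> ennreal (?C * r) * ?I x r"
            by (rule smooth_trace[OF h xn r(1)])
          finally have X: "?X \<le> ennreal (?C * r) * ?I x r" .
          have "ennreal (cm * m) \<le> \<mu> (ball x r \<inter> \<Omega>)"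
            using cm(2)[OF xc r(1) diam[OF r(2)]] cm(1) m by (simp add: \<mu>_ball ennreal_mult)
          then have "?X / \<mu> (ball x r \<inter> \<Omega>) \<le> ?X / ennreal (cm * m)"
            by (rule divide_left_mono_ennreal)
          also have "\<dots> \<le> ennreal (?C * r) * ?I x r / ennreal (cm * m)"
            using X by (rule divide_right_mono_ennreal)
          also have "\<dots> = ennreal (?C / cm) * ?q x r"
          proof -
            have "ennreal (?C * r) * ?I x r / ennreal (cm * m) = ennreal (?C * r * (1 / (cm * m))) * ?I x r"
            proof -
              have "ennreal a * y * ennreal b = ennreal (a * b) * y" if "0 \<le> a" "0 \<le> b" for a b y
                using that by (simp add: ennreal_mult ac_simps)
              then show ?thesis
                unfolding divide_ennreal_eq_mult[OF mult_pos_pos[OF cm(1) m(1)]]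
                using cm(1) m(1) C r(1) by auto
            qed
            moreover have "ennreal (?C / cm) * ?q x r = ennreal (?C / cm) * (ennreal r * (ennreal (1 / m) * ?I x r))"
              unfolding m(2) divide_ennreal_eq_mult[OF m(1)] by (simp only: ac_simps)
            moreover have "\<dots> = ennreal (?C / cm * r * (1 / m)) * ?I x r"
              using cm(1) m(1) C r(1) by (intro ennreal_mult3) auto
            moreover have "?C * r * (1 / (cm * m)) = ?C / cm * r * (1 / m)" by simp
            ultimately show ?thesis by simp
          qed
          finally show "?X / \<mu> (ball x r \<inter> \<Omega>) \<le> ennreal (?C / cm) * ?q x r" .
        qed
      qed auto
      with nt show False ..
    qed
    with xn show "x \<notin> \<Omega> \<and> \<not> (?q x \<longlongrightarrow> 0) (at_right 0)" by blast
  qed measurable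
qed

end

lemma (in smoothing) smooth_diff_uniform:
  assumes lp: "local_poincare CP h" and c: "0 < c" and curve: "is_curve \<gamma> 0 l" and in\<Omega>: "\<gamma> ` {0..l} \<subseteq> \<Omega>"
    and arc: "\<And>t. t \<in> {0..l} \<Longrightarrow> curve_length \<gamma> 0 t = ennreal t"
    and l: "l \<le> dist (\<gamma> 0) (\<gamma> l) / c"
    and far: "\<And>t. t \<in> {0..l} \<Longrightarrow> c * min t (l - t) \<le> bdist (\<gamma> t)"
  shows "ennreal \<bar>smooth (\<gamma> 0) - smooth (\<gamma> l)\<bar> \<le> ennreal (108 * K\<^sup>2 * CP * Cd / c * dist (\<gamma> 0) (\<gamma> l)) *
    (avg (2 / c + 1) h (\<gamma> 0) + avg (2 / c + 1) h (\<gamma> l))"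
proof -
  let ?C = "216 * K\<^sup>2 * CP * Cd"
  have C: "0 \<le> ?C" using lp K Cd by (simp add: local_poincare_def)
  have l0: "0 \<le> l" using curve by (simp add: is_curve_def)
  have le: "dist (\<gamma> s) (\<gamma> t) \<le> t - s" if "0 \<le> s" "s \<le> t" "t \<le> l" for s t
  proof -
    have "ennreal s + curve_length \<gamma> s t = ennreal t"
      using curve_length_add[of 0 s t \<gamma>] arc[of s] arc[of t] that by auto
    also have "\<dots> = ennreal s + ennreal (t - s)" using that by (subst ennreal_plus[symmetric]) auto
    finally have "curve_length \<gamma> s t = ennreal (t - s)" by (simp add: ennreal_add_left_cancel)
    then have "ennreal (dist (\<gamma> s) (\<gamma> t)) \<le> ennreal (t - s)"
      using dist_le_curve_length[of s s t t \<gamma>] that by simp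
    then show ?thesis using that by (simp add: ennreal_le_iff)
  qed
  have lip: "dist (\<gamma> s) (\<gamma> t) \<le> \<bar>s - t\<bar>" if "s \<in> {0..l}" "t \<in> {0..l}" for s t
    using le[of s t] le[of t s] that by (cases "s \<le> t") (auto simp: dist_commute)
  have 1: "ennreal \<bar>smooth (\<gamma> 0) - smooth (\<gamma> (l/2))\<bar> \<le> ennreal (?C * (l/2)) * avg (2 / c + 1) h (\<gamma> 0)"
  proof (rule smooth_along_curve[OF lp c])
    fix t assume "t \<in> {0..l/2}"
    then show "c * t \<le> bdist (\<gamma> t)" using far[of t] by (auto simp: min_def)
  qed (use l0 lip in\<Omega> in auto)
  have 2: "ennreal \<bar>smooth (\<gamma> (l - 0)) - smooth (\<gamma> (l - l/2))\<bar> \<le> ennreal (?C * (l/2)) * avg (2 / c + 1) h (\<gamma> (l - 0))"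
  proof (rule smooth_along_curve[OF lp c, where \<gamma> = "\<lambda>t. \<gamma> (l - t)"])
    fix t assume t: "t \<in> {0..l/2}"
    then have "min (l - t) (l - (l - t)) = t" by auto
    then show "c * t \<le> bdist (\<gamma> (l - t))" using far[of "l - t"] t by auto
    show "\<gamma> (l - t) \<in> \<Omega>" using t in\<Omega> by (auto simp: image_subset_iff)
    fix s assume "s \<in> {0..l/2}"
    then show "dist (\<gamma> (l - s)) (\<gamma> (l - t)) \<le> \<bar>s - t\<bar>" using lip[of "l - s" "l - t"] t by auto
  qed (use l0 in auto)
  have "ennreal \<bar>smooth (\<gamma> 0) - smooth (\<gamma> l)\<bar>
      \<le> ennreal (\<bar>smooth (\<gamma> 0) - smooth (\<gamma> (l/2))\<bar> + \<bar>smooth (\<gamma> l) - smooth (\<gamma> (l/2))\<bar>)"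
    by (intro ennreal_leI) linarith
  also have "\<dots> = ennreal \<bar>smooth (\<gamma> 0) - smooth (\<gamma> (l/2))\<bar> + ennreal \<bar>smooth (\<gamma> l) - smooth (\<gamma> (l/2))\<bar>"
    by (rule ennreal_plus) auto
  also have "\<dots> \<le> ennreal (?C * (l/2)) * avg (2 / c + 1) h (\<gamma> 0) + ennreal (?C * (l/2)) * avg (2 / c + 1) h (\<gamma> l)"
    using 1 2 by (intro add_mono) auto
  also have "\<dots> = ennreal (?C * (l/2)) * (avg (2 / c + 1) h (\<gamma> 0) + avg (2 / c + 1) h (\<gamma> l))"
    by (simp add: distrib_left)
  also have "\<dots> \<le> ennreal (108 * K\<^sup>2 * CP * Cd / c * dist (\<gamma> 0) (\<gamma> l)) * (avg (2 / c + 1) h (\<gamma> 0) + avg (2 / c + 1) h (\<gamma> l))"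
  proof (intro mult_right_mono ennreal_leI)
    have "?C * (l/2) \<le> ?C * (dist (\<gamma> 0) (\<gamma> l) / c / 2)" using l C by (intro mult_left_mono) auto
    then show "?C * (l/2) \<le> 108 * K\<^sup>2 * CP * Cd / c * dist (\<gamma> 0) (\<gamma> l)" by (simp add: mult_ac)
  qed auto
  finally show ?thesis .
qed

lemma doubling_space_carath:
  assumes reg: "borel_regular_outer_measure \<mu>" and "doubling \<mu>"
  shows "\<exists>Cd. doubling_space (carath \<mu>) Cd"
proof -
  obtain Cd where Cd: "1 \<le> Cd" and d: "\<And>x r. 0 < r \<Longrightarrow> 0 < \<mu> (ball x (2 * r)) \<and>
        \<mu> (ball x (2 * r)) \<le> ennreal Cd * \<mu> (ball x r) \<and> ennreal Cd * \<mu> (ball x r) < \<infinity>"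
    using assms(2) unfolding doubling_def by blast
  have B: "sets borel \<subseteq> sets (carath \<mu>)" by (rule borel_carath[OF reg])
  then have E: "emeasure (carath \<mu>) (ball x r) = \<mu> (ball x r)" for x r
    by (intro emeasure_carath[OF reg]) auto
  have "doubling_space (carath \<mu>) Cd"
  proof
    show "space (carath \<mu>) = UNIV" by (rule space_carath[OF reg])
    show "sets borel \<subseteq> sets (carath \<mu>)" by (rule B)
    show "1 \<le> Cd" by (rule Cd)
    fix x and r :: real
    show "emeasure (carath \<mu>) (ball x r) < \<infinity>"
    proof (cases "0 < r")
      case True
      have "1 * \<mu> (ball x r) \<le> ennreal Cd * \<mu> (ball x r)" using Cd by (intro mult_right_mono) auto
      also have "\<dots> < \<infinity>" using d[OF True] by blast
      finally show ?thesis by (simp add: E)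
    next
      case False
      then show ?thesis by (simp add: ball_empty)
    qed
    assume r: "0 < r"
    show "0 < emeasure (carath \<mu>) (ball x r)" using d[of "r/2" x] r by (simp add: E)
    show "emeasure (carath \<mu>) (ball x (2 * r)) \<le> ennreal Cd * emeasure (carath \<mu>) (ball x r)"
      using d[OF r, of x] by (simp add: E)
  qed
  then show ?thesis ..
qed

theorem theorem1p6:
  fixes \<mu> :: "'a::complete_space set \<Rightarrow> ennreal" and \<Omega> :: "'a set"
  assumes "borel_regular_outer_measure \<mu>" and "doubling \<mu>" and "poincare_1_1 \<mu>"
    and "open \<Omega>" and "\<Omega> \<noteq> {}" and "- \<Omega> \<noteq> {}"
    and "measure_density \<mu> \<Omega>"
  shows "(\<exists>cH C :: real. 0 < cH \<and> cH < 1 \<and> 0 < C \<and>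
            (\<forall>u. in_N11 \<mu> \<Omega> u \<longrightarrow>
               (\<exists>v. in_M11c cH \<mu> \<Omega> v \<and> Lip_loc \<Omega> v \<and>
                    M11c_norm cH \<mu> \<Omega> v \<le> ennreal C * N11_norm \<mu> \<Omega> u \<and>
                    codim1_hausdorff \<mu> {x \<in> frontier \<Omega>. \<not> same_trace_at \<mu> \<Omega> v u x} = 0)))
       \<and> (uniform_domain \<Omega> \<longrightarrow>
            (\<exists>C :: real. 0 < C \<and>
              (\<forall>u. in_N11 \<mu> \<Omega> u \<longrightarrow>
                 (\<exists>v. in_M11 \<mu> \<Omega> v \<and> Lip_loc \<Omega> v \<and>
                      M11_norm \<mu> \<Omega> v \<le> ennreal C * N11_norm \<mu> \<Omega> u \<and>
                      codim1_hausdorff \<mu> {x \<in> frontier \<Omega>. \<not> same_trace_at \<mu> \<Omega> v u x} = 0))))"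
proof -
  let ?M = "carath \<mu>"
  obtain Cd where ds: "doubling_space ?M Cd"
    using doubling_space_carath[OF assms(1,2)] by blast
  interpret doubling_open ?M Cd \<Omega>
    using ds assms(4,6) by (simp add: doubling_open_def doubling_open_axioms_def)
  obtain CP \<Lambda> where CP: "0 < CP" and \<Lambda>: "1 \<le> \<Lambda>"
    and poincare: "\<And>x r u g. 0 < r \<Longrightarrow> in_L1_loc \<mu> UNIV u \<Longrightarrow> upper_gradient u g \<Longrightarrow>
        (\<integral>\<^sup>+ y. eabs_diff (u y) (ereal (mean \<mu> (ball x r) u))
            \<partial>restrict_space (carath \<mu>) (ball x r)) / \<mu> (ball x r)
        \<le> ennreal (CP * r) *
          ((\<integral>\<^sup>+ y. g y \<partial>restrict_space (carath \<mu>) (ball x (\<Lambda> * r))) / \<mu> (ball x (\<Lambda> * r)))"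
    using assms(3) unfolding poincare_1_1_def by blast
  define w where "w u y = (if y \<in> \<Omega> then real_of_ereal (u y) else 0)" for u y
  have ns: "newtonian_smoothing ?M Cd \<Omega> \<Lambda> (w u) \<mu> u CP" if u: "in_N11 \<mu> \<Omega> u" for u
  proof -
    have um: "(\<lambda>y. u y * indicator \<Omega> y) \<in> borel_measurable ?M"
      using u unfolding in_N11_def by (subst (asm) borel_measurable_restrict_space_iff_ereal) auto
    have "w u = (\<lambda>y. real_of_ereal (u y * indicator \<Omega> y))"
      by (auto simp: w_def indicator_def)
    then have wm: "w u \<in> borel_measurable ?M"
      using borel_measurable_real_of_ereal[OF um] by (simp only:)
    have "(\<integral>\<^sup>+y. ennreal (norm (w u y)) \<partial>?M) \<le> (\<integral>\<^sup>+y. e2ennreal \<bar>u y\<bar> * indicator \<Omega> y \<partial>?M)"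
    proof (rule nn_integral_mono)
      show "ennreal (norm (w u y)) \<le> e2ennreal \<bar>u y\<bar> * indicator \<Omega> y" for y
        by (cases "u y") (auto simp: w_def indicator_def)
    qed
    also have "\<dots> = L1_norm \<mu> \<Omega> u"
      unfolding L1_norm_def by (rule nn_integral_restrict_space[symmetric]) simp
    also have "\<dots> < \<infinity>" using u by (auto simp: in_N11_def N11_norm_def less_top)
    finally have "integrable ?M (w u)" using wm by (intro integrableI_bounded) auto
    then show ?thesis
      using assms(1) CP \<Lambda> poincare u by unfold_locales (auto simp: w_def)
  qed
  interpret Z: smoothing ?M Cd \<Omega> \<Lambda> "\<lambda>_. 0"
    using \<Lambda> by unfold_locales auto
  let ?C = "216 * Z.K\<^sup>2 * CP * Cd"
  have C: "0 < ?C" using Z.K Cd CP by simp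
  have pos: "0 < 8 * Z.K * Cd\<^sup>2" using Z.K Cd by simp
  have local_part: "\<exists>v. in_M11c Z.\<delta> \<mu> \<Omega> v \<and> Lip_loc \<Omega> v \<and>
      M11c_norm Z.\<delta> \<mu> \<Omega> v \<le> ennreal (8 * Z.K * Cd\<^sup>2 + ?C * Cd ^ 1) * N11_norm \<mu> \<Omega> u \<and>
      codim1_hausdorff \<mu> {x \<in> frontier \<Omega>. \<not> same_trace_at \<mu> \<Omega> v u x} = 0"
    if u: "in_N11 \<mu> \<Omega> u" for u
  proof -
    interpret S: newtonian_smoothing ?M Cd \<Omega> \<Lambda> "w u" \<mu> u CP by (rule ns[OF u])
    have bound: "ennreal \<bar>S.smooth x - S.smooth y\<bar> \<le> ennreal (?C * dist x y) * (avg 1 h x + avg 1 h y)"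
      if h: "S.local_poincare CP h" and x: "x \<in> \<Omega>" and R: "inner_pairs Z.\<delta> \<Omega> x y" for h x y
    proof -
      have "dist x y \<le> Z.\<delta> * min (bdist x) (bdist y)"
        using R by (simp add: inner_pairs_def bdist_def)
      also have "\<dots> \<le> Z.\<delta> * bdist x" using Z.\<delta> by (intro mult_left_mono) auto
      finally have "ennreal \<bar>S.smooth x - S.smooth y\<bar> \<le> ennreal (?C * dist x y) * avg (2 * 0 + 1) h x"
        using bdist_pos_iff[of x] x by (intro S.smooth_diff_avg[OF h x]) auto
      also have "\<dots> \<le> ennreal (?C * dist x y) * (avg 1 h x + avg 1 h y)"
        by (intro mult_left_mono) auto
      finally show ?thesis .
    qed
    show ?thesis
      using S.in_hajlasz_smooth[of 1 1 ?C "inner_pairs Z.\<delta> \<Omega>"] C bound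
        S.Lip_loc_smooth S.same_trace_smooth[OF assms(7)]
      by (intro exI[of _ S.smooth]) auto
  qed
  have global_part: "\<exists>C>0. \<forall>u. in_N11 \<mu> \<Omega> u \<longrightarrow>
      (\<exists>v. in_M11 \<mu> \<Omega> v \<and> Lip_loc \<Omega> v \<and> M11_norm \<mu> \<Omega> v \<le> ennreal C * N11_norm \<mu> \<Omega> u \<and>
        codim1_hausdorff \<mu> {x \<in> frontier \<Omega>. \<not> same_trace_at \<mu> \<Omega> v u x} = 0)"
    if uni: "uniform_domain \<Omega>"
  proof -
    obtain c where c: "0 < c" and curve: "\<forall>x\<in>\<Omega>. \<forall>y\<in>\<Omega>. x \<noteq> y \<longrightarrow>
      (\<exists>\<gamma> l. is_curve \<gamma> 0 l \<and> \<gamma> ` {0..l} \<subseteq> \<Omega> \<and> (\<forall>t \<in> {0..l}. curve_length \<gamma> 0 t = ennreal t) \<and>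
        \<gamma> 0 = x \<and> \<gamma> l = y \<and> l \<le> dist x y / c \<and> (\<forall>t \<in> {0..l}. c * min t (l - t) \<le> bdist (\<gamma> t)))"
      using uni unfolding uniform_domain_def bdist_def[symmetric] by (elim conjE exE) (rule that)
    obtain k where k: "2 / c + 1 < 2 ^ k" using real_arch_pow[of 2] by auto
    let ?D = "108 * Z.K\<^sup>2 * CP * Cd / c"
    have D: "0 < ?D" using C c by simp
    have "\<exists>v. in_M11 \<mu> \<Omega> v \<and> Lip_loc \<Omega> v \<and>
        M11_norm \<mu> \<Omega> v \<le> ennreal (8 * Z.K * Cd\<^sup>2 + ?D * Cd ^ k) * N11_norm \<mu> \<Omega> u \<and>
        codim1_hausdorff \<mu> {x \<in> frontier \<Omega>. \<not> same_trace_at \<mu> \<Omega> v u x} = 0"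
      if u: "in_N11 \<mu> \<Omega> u" for u
    proof -
      interpret S: newtonian_smoothing ?M Cd \<Omega> \<Lambda> "w u" \<mu> u CP by (rule ns[OF u])
      have bound: "ennreal \<bar>S.smooth x - S.smooth y\<bar>
          \<le> ennreal (?D * dist x y) * (avg (2 / c + 1) h x + avg (2 / c + 1) h y)"
        if h: "S.local_poincare CP h" and xy: "x \<in> \<Omega>" "y \<in> \<Omega>" for h x y
      proof (cases "x = y")
        case False
        obtain \<gamma> l where \<gamma>: "is_curve \<gamma> 0 l" "\<gamma> ` {0..l} \<subseteq> \<Omega>" "\<And>t. t \<in> {0..l} \<Longrightarrow> curve_length \<gamma> 0 t = ennreal t"
          "\<gamma> 0 = x" "\<gamma> l = y" "l \<le> dist x y / c" "\<And>t. t \<in> {0..l} \<Longrightarrow> c * min t (l - t) \<le> bdist (\<gamma> t)"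
          using curve[rule_format, OF xy False] by blast
        show ?thesis
          using S.smooth_diff_uniform[OF h c \<gamma>(1-3), unfolded \<gamma>(4,5), OF _ \<gamma>(6,7)] by blast
      qed simp
      show ?thesis
        using S.in_hajlasz_smooth[OF k less_imp_le[OF D], of all_pairs] bound
          S.Lip_loc_smooth S.same_trace_smooth[OF assms(7)]
        by (intro exI[of _ S.smooth]) auto
    qed
    moreover have "0 < ?D * Cd ^ k" using D Cd by (intro mult_pos_pos zero_less_power) linarith+
    then have "0 < 8 * Z.K * Cd\<^sup>2 + ?D * Cd ^ k" using pos by (rule add_pos_pos[rotated])
    ultimately show ?thesis by blast
  qed
  have "0 < 8 * Z.K * Cd\<^sup>2 + ?C * Cd ^ 1" using pos C Cd by (intro add_pos_pos) auto
  moreover have "Z.\<delta> < 1" using Z.\<delta> by linarith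
  ultimately show ?thesis using local_part global_part Z.\<delta>(1) by blast
qed

end
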